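(* Let $1\le r\le s$ and $r'\le 2r-2$. Then every local proper holomorphic map from $\mathbb B^{r,s}$ to $\mathbb B^{r',s',t'}$ is quasi-standard.
   Context: Let $r,s,t\ge 0$ be integers with $n=r+s+t>0$. $\mathbb C^{r,s,t}$ denotes $\mathbb C^n$ equipped with the (possibly degenerate, indefinite) Hermitian form $\langle z,w\rangle_{r,s,t}=\sum_{j=1}^{r}z_j\bar w_j-\sum_{j=r+1}^{r+s}z_j\bar w_j$, and $\mathbb P^{r,s,t}$ is its projectivization; $\mathbb P^{r,s}=\mathbb P^{r,s,0}$, $\mathbb B^{r,s}=\mathbb B^{r,s,0}$. A point $[z]$ is positive or null according as $\langle z,z\rangle_{r,s,t}>0$ or $=0$. The generalized ball $\mathbb B^{r,s,t}$ is the set of positive points and $\partial\mathbb B^{r,s,t}$ the set of null points. A local proper holomorphic map from $\mathbb B^{r,s,t}$ to $\mathbb B^{r',s',t'}$ is a holomorphic map $f:U\to\mathbb P^{r',s',t'}$ on a connected open set $U\subset\mathbb P^{r,s,t}$ with $U\cap\partial\mathbb B^{r,s,t}\ne\varnothing$, $f(U\cap\mathbb B^{r,s,t})\subset\mathbb B^{r',s',t'}$ and $f(U\cap\partial\mathbb B^{r,s,t})\subset\partial\mathbb B^{r',s',t'}$. A complex linear subspace $H$ (or $\mathbb PH$) is a null space if the form vanishes identically on $H$. $f$ is standard if it is induced by a linear isometry $\mathbb C^{r,s,t}\to\mathbb C^{r',s',t'}$ (a linear map $L$ with $\langle Lu,Lv\rangle_{r',s',t'}=\langle u,v\rangle_{r,s,t}$);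 null if $f(U)$ is contained in a null space. $f$ is quasi-standard if either $f$ is standard, or there is a decomposition $\mathbb C^{r',s',t'}=A\oplus B$ into nonzero subspaces with $\langle a,b\rangle_{r',s',t'}=0$ for all $a\in A,b\in B$ such that $\pi_A\circ f$ is standard and $\pi_B\circ f$ is null, where $\pi_A:\mathbb P^{r',s',t'}\dashrightarrow\mathbb PA$, $\pi_B:\mathbb P^{r',s',t'}\dashrightarrow\mathbb PB$ are induced by the linear projections, and $\mathbb PA,\mathbb PB$ carry the restricted forms. *)

theory Defs
  imports "HOL-Analysis.Analysis"
begin

text \<open>Coordinates of \<open>\<complex>^n\<close> are indexed by a finite type. A sign function
  \<open>\<sigma> i \<in> {1,-1,0}\<close> encodes the form of \<open>\<complex>^{r,s,t}\<close>:
  \<open>r\<close>, \<open>s\<close>, \<open>t\<close> are the numbers of indices with sign \<open>1\<close>, \<open>-1\<close>, \<open>0\<close>.\<close>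

definition hform :: "('n::finite \<Rightarrow> real) \<Rightarrow> complex^'n \<Rightarrow> complex^'n \<Rightarrow> complex" where
  "hform \<sigma> z w = (\<Sum>i\<in>UNIV. complex_of_real (\<sigma> i) * z$i * cnj (w$i))"

definition csubspace :: "(complex^'m::finite) set \<Rightarrow> bool" where
  "csubspace H \<longleftrightarrow> 0 \<in> H \<and> (\<forall>x\<in>H. \<forall>y\<in>H. x + y \<in> H) \<and> (\<forall>c. \<forall>x\<in>H. c *s x \<in> H)"

definition cholo_at :: "(complex^'n::finite \<Rightarrow> complex^'m::finite) \<Rightarrow> complex^'n \<Rightarrow> bool" where
  "cholo_at G z \<longleftrightarrow> (\<exists>D. (G has_derivative D) (at z) \<and> (\<forall>c v. D (c *s v) = c *s D v))"

text \<open>An open connected subset U of projective space is represented by its cone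
  V = pi^{-1}(U) in \<complex>^n - {0}.\<close>
definition proj_cone :: "(complex^'n::finite) set \<Rightarrow> bool" where
  "proj_cone V \<longleftrightarrow> open V \<and> connected V \<and> 0 \<notin> V \<and> (\<forall>z\<in>V. \<forall>c. c \<noteq> 0 \<longrightarrow> c *s z \<in> V)"

text \<open>A holomorphic map U -> P^{m-1} is represented by a function F on the cone V giving a
  nonzero representative of the image point, whose projective class depends only on the
  projective class of z, and which locally has holomorphic nonvanishing lifts.\<close>
definition proj_holo :: "(complex^'n::finite \<Rightarrow> complex^'m::finite) \<Rightarrow> (complex^'n) set \<Rightarrow> bool" where
  "proj_holo F V \<longleftrightarrow>
     (\<forall>z\<in>V. F z \<noteq> 0) \<and>
     (\<forall>z\<in>V. \<forall>c. c \<noteq> 0 \<longrightarrow> (\<exists>d. d \<noteq> 0 \<and> F (c *s z) = d *s F z)) \<and>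
     (\<forall>z\<in>V. \<exists>W G. open W \<and> z \<in> W \<and> W \<subseteq> V \<and>
         (\<forall>w\<in>W. cholo_at G w \<and> G w \<noteq> 0 \<and> (\<exists>d. d \<noteq> 0 \<and> G w = d *s F w)))"

definition local_proper ::
  "('n::finite \<Rightarrow> real) \<Rightarrow> ('m::finite \<Rightarrow> real) \<Rightarrow> (complex^'n \<Rightarrow> complex^'m) \<Rightarrow> (complex^'n) set \<Rightarrow> bool" where
  "local_proper \<sigma> \<tau> F V \<longleftrightarrow> proj_cone V \<and> proj_holo F V \<and>
     (\<exists>z\<in>V. hform \<sigma> z z = 0) \<and>
     (\<forall>z\<in>V. Re (hform \<sigma> z z) > 0 \<longrightarrow> Re (hform \<tau> (F z) (F z)) > 0) \<and>
     (\<forall>z\<in>V. hform \<sigma> z z = 0 \<longrightarrow> hform \<tau> (F z) (F z) = 0)"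

definition lin_isometry ::
  "('n::finite \<Rightarrow> real) \<Rightarrow> ('m::finite \<Rightarrow> real) \<Rightarrow> complex^'n^'m \<Rightarrow> bool" where
  "lin_isometry \<sigma> \<tau> L \<longleftrightarrow> (\<forall>u v. hform \<tau> (L *v u) (L *v v) = hform \<sigma> u v)"

definition standard_map ::
  "('n::finite \<Rightarrow> real) \<Rightarrow> ('m::finite \<Rightarrow> real) \<Rightarrow> (complex^'n \<Rightarrow> complex^'m) \<Rightarrow> (complex^'n) set \<Rightarrow> bool" where
  "standard_map \<sigma> \<tau> F V \<longleftrightarrow>
     (\<exists>L. lin_isometry \<sigma> \<tau> L \<and> (\<forall>z\<in>V. \<exists>c. c \<noteq> 0 \<and> L *v z = c *s F z))"

definition null_space :: "('m::finite \<Rightarrow> real) \<Rightarrow> (complex^'m) set \<Rightarrow> bool" where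
  "null_space \<tau> H \<longleftrightarrow> csubspace H \<and> (\<forall>a\<in>H. \<forall>b\<in>H. hform \<tau> a b = 0)"

definition null_map ::
  "('m::finite \<Rightarrow> real) \<Rightarrow> (complex^'n::finite \<Rightarrow> complex^'m) \<Rightarrow> (complex^'n) set \<Rightarrow> bool" where
  "null_map \<tau> F V \<longleftrightarrow> (\<exists>H. null_space \<tau> H \<and> (\<forall>z\<in>V. F z \<in> H))"

definition proj_along :: "(complex^'m::finite) set \<Rightarrow> (complex^'m) set \<Rightarrow> complex^'m \<Rightarrow> complex^'m" where
  "proj_along A B x = (THE a. a \<in> A \<and> x - a \<in> B)"

definition quasi_standard ::
  "('n::finite \<Rightarrow> real) \<Rightarrow> ('m::finite \<Rightarrow> real) \<Rightarrow> (complex^'n \<Rightarrow> complex^'m) \<Rightarrow> (complex^'n) set \<Rightarrow> bool" where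
  "quasi_standard \<sigma> \<tau> F V \<longleftrightarrow> standard_map \<sigma> \<tau> F V \<or>
     (\<exists>A B. csubspace A \<and> csubspace B \<and> A \<noteq> {0} \<and> B \<noteq> {0} \<and> A \<inter> B = {0} \<and>
        (\<forall>x. \<exists>a\<in>A. \<exists>b\<in>B. x = a + b) \<and>
        (\<forall>a\<in>A. \<forall>b\<in>B. hform \<tau> a b = 0) \<and>
        \<comment> \<open>pi_A o f is standard: induced by a linear isometry into A (restricted form),
            wherever pi_A o f is defined\<close>
        (\<exists>L. (\<forall>u. L *v u \<in> A) \<and> lin_isometry \<sigma> \<tau> L \<and>
             (\<forall>z\<in>V. proj_along A B (F z) \<noteq> 0 \<longrightarrow>
                 (\<exists>c. c \<noteq> 0 \<and> L *v z = c *s proj_along A B (F z)))) \<and>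
        \<comment> \<open>pi_B o f is null: its image lies in a null subspace of B\<close>
        (\<exists>H. H \<subseteq> B \<and> null_space \<tau> H \<and> (\<forall>z\<in>V. proj_along B A (F z) \<in> H)))"

end

theory Submission
  imports Defs "HOL-Complex_Analysis.Conformal_Mappings"
begin

text \<open>
  Near a null point, write \<open>\<Phi> z w = \<langle>G z, G w\<rangle>\<close> for a holomorphic lift \<open>G\<close>. Polarizing the boundary
  condition gives \<open>\<Phi> z w = 0\<close> whenever \<open>\<langle>z, w\<rangle> = 0\<close>. Hence \<open>G\<close> maps a null space into a null space, which
  has at most \<open>r' \<le> 2r - 2\<close> independent elements modulo the radical; since null \<open>r\<close>-spaces form a
  uniqueness set, \<open>G\<close> takes at most \<open>2r - 2\<close> independent values on every \<open>r\<close>-dimensional subspace.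

  This bound is played off against chains of subspaces of dimensions \<open>1, 2, \<dots>, r\<close> in which each step
  would contribute two new independent values, \<open>2r - 1\<close> in total. A first chain shows that
  \<open>\<Phi> z u / \<Phi> z u'\<close> is constant along lines through points orthogonal to \<open>u\<close> and \<open>u'\<close>, so that it depends
  on \<open>\<langle>z, u\<rangle> / \<langle>z, u'\<rangle>\<close> only; a second chain shows that the increments of these functions are all
  proportional along lines, which forces the functions to be linear. Therefore
  \<open>\<Phi> z w = a z * cnj (a w) * \<langle>z, w\<rangle>\<close> up to a positive constant, i.e. \<open>G / a\<close> preserves the forms. Such a map
  is linear up to a null part orthogonal to the linear part, and this conclusion spreads over the
  connected domain by the identity theorem.
\<close>

section \<open>Indefinite Hermitian forms\<close>

text \<open>Every new direction of a chain is sought in the common kernel of two functionals, which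
  costs two dimensions. The first chain starts from the line of a point in the whole space, the
  second from zero inside a hyperplane, so both fit exactly when \<open>r + 2 \<le> n\<close>; this
  follows from \<open>2 \<le> r\<close> and \<open>r \<le> s\<close>. The case \<open>r = 1\<close>
  is separate: the target then has no positive points, so there is no local proper map. For larger
  \<open>r\<close>, positivity only makes the lift nonzero at two chosen points and fixes the sign
  of the final constant. The obstacle is that all points must stay in a small ball about a null
  point. Vectors can therefore be corrected only slightly, relations are first proved near points
  where a denominator is nonzero, and the identity theorem then spreads them. Radical coordinates of
  the target would spoil the bound by \<open>r'\<close>, so they are removed from the lift and
  restored only before the linear part is split off.\<close>

lemma hform_add_left: "hform \<sigma> (x + y) w = hform \<sigma> x w + hform \<sigma> y w"
  by (simp add: hform_def algebra_simps sum.distrib)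

lemma hform_add_right: "hform \<sigma> w (x + y) = hform \<sigma> w x + hform \<sigma> w y"
  by (simp add: hform_def algebra_simps sum.distrib)

lemma hform_diff_left: "hform \<sigma> (x - y) w = hform \<sigma> x w - hform \<sigma> y w"
  by (simp add: hform_def algebra_simps sum_subtractf)

lemma hform_diff_right: "hform \<sigma> w (x - y) = hform \<sigma> w x - hform \<sigma> w y"
  by (simp add: hform_def algebra_simps sum_subtractf)

lemma hform_scale_left: "hform \<sigma> (c *s x) w = c * hform \<sigma> x w"
  by (simp add: hform_def sum_distrib_left algebra_simps)

lemma hform_scale_right: "hform \<sigma> w (c *s x) = cnj c * hform \<sigma> w x"
  by (simp add: hform_def sum_distrib_left algebra_simps)

lemma hform_zero_left [simp]: "hform \<sigma> 0 w = 0"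
  and hform_zero_right [simp]: "hform \<sigma> w 0 = 0"
  by (simp_all add: hform_def)

lemma hform_minus_left: "hform \<sigma> (- x) w = - hform \<sigma> x w"
  and hform_minus_right: "hform \<sigma> w (- x) = - hform \<sigma> w x"
  by (simp_all add: hform_def sum_negf)

lemma hform_sum_left: "hform \<sigma> (\<Sum>a\<in>I. f a) w = (\<Sum>a\<in>I. hform \<sigma> (f a) w)"
  by (induction I rule: infinite_finite_induct) (simp_all add: hform_add_left)

lemma hform_sum_right: "hform \<sigma> w (\<Sum>a\<in>I. f a) = (\<Sum>a\<in>I. hform \<sigma> w (f a))"
  by (induction I rule: infinite_finite_induct) (simp_all add: hform_add_right)

lemmas hform_lin = hform_add_left hform_add_right hform_diff_left hform_diff_right
  hform_scale_left hform_scale_right hform_minus_left hform_minus_right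

lemma hform_cnj: "cnj (hform \<sigma> z w) = hform \<sigma> w z"
  by (simp add: hform_def mult_ac)

lemma hform_eq_0_commute: "hform \<sigma> z w = 0 \<longleftrightarrow> hform \<sigma> w z = 0"
  by (metis complex_cnj_zero_iff hform_cnj)

lemma hform_real: "Im (hform \<sigma> z z) = 0"
  by (metis hform_cnj Reals_cnj_iff complex_is_Real_iff)

lemma hform_self: "hform \<sigma> z z = complex_of_real (Re (hform \<sigma> z z))"
  by (simp add: complex_eq_iff hform_real)

lemma hform_self_eq: "hform \<sigma> z z = complex_of_real (\<Sum>i\<in>UNIV. \<sigma> i * (cmod (z $ i))\<^sup>2)"
proof -
  have "hform \<sigma> z z = (\<Sum>i\<in>UNIV. complex_of_real (\<sigma> i) * (z$i * cnj (z$i)))"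
    by (simp add: hform_def mult_ac)
  also have "\<dots> = (\<Sum>i\<in>UNIV. complex_of_real (\<sigma> i * (cmod (z $ i))\<^sup>2))"
    by (rule sum.cong) (simp_all flip: complex_norm_square)
  finally show ?thesis by simp
qed

lemma continuous_on_hform [continuous_intros]:
  assumes "continuous_on S f" "continuous_on S g"
  shows "continuous_on S (\<lambda>x. hform \<sigma> (f x) (g x))"
  unfolding hform_def by (intro continuous_intros assms)

lemma isCont_hform [continuous_intros]:
  assumes "isCont f x" "isCont g x"
  shows "isCont (\<lambda>x. hform \<sigma> (f x) (g x)) x"
proof -
  have "isCont (\<lambda>x. cnj (g x $ i)) x" for i
    using continuous_cnj isCont_vec_nth[OF assms(2)] by blast
  moreover have "isCont (\<lambda>x. f x $ i) x" for i using isCont_vec_nth[OF assms(1)] .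
  ultimately show ?thesis unfolding hform_def using assms by (intro continuous_intros)
qed

lemma norm_cscale: "norm (c *s (x::complex^'n)) = norm c * norm x"
proof -
  have "norm (c *s x) = L2_set (\<lambda>i. norm c * norm (x $ i)) UNIV"
    by (simp add: norm_vec_def norm_mult)
  also have "\<dots> = norm c * norm x" by (simp add: norm_vec_def L2_set_right_distrib)
  finally show ?thesis .
qed

lemma bounded_bilinear_cscale: "bounded_bilinear (\<lambda>c (x::complex^'n). c *s x)"
proof
  show "\<exists>K. \<forall>a b. norm (a *s (b::complex^'n)) \<le> norm a * norm b * K"
    by (rule exI[of _ 1]) (simp add: norm_cscale)
qed (simp_all add: vec_eq_iff algebra_simps)

lemmas continuous_on_cscale [continuous_intros] =
  bounded_bilinear.continuous_on [OF bounded_bilinear_cscale]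
lemmas isCont_cscale [continuous_intros] =
  bounded_bilinear.isCont [OF bounded_bilinear_cscale]

text \<open>The real orthogonal complement of a complex subspace is its Hermitian complement.\<close>

lemma hermitian_separation:
  fixes Y :: "(complex^'n::finite) set"
  assumes Y: "vec.subspace Y" and y: "y \<notin> Y"
  obtains e where "\<And>z. z \<in> Y \<Longrightarrow> hform (\<lambda>_. 1) e z = 0" "hform (\<lambda>_. 1) e y \<noteq> 0"
proof -
  have ip: "inner a b = Re (hform (\<lambda>_. 1) a b)" for a b :: "complex^'n"
    by (simp add: inner_vec_def hform_def inner_complex_def)
  have rs: "c *\<^sub>R x = complex_of_real c *s x" for c and x :: "complex^'n"
    by (simp add: vec_eq_iff scaleR_conv_of_real[symmetric])
  have sub: "subspace Y" unfolding subspace_def rs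
    using Y vec.subspace_0 vec.subspace_add vec.subspace_scale by blast
  then have sp: "span Y = Y" by (simp add: span_eq_iff)
  obtain a e where ae: "a \<in> span Y" "\<And>w. w \<in> span Y \<Longrightarrow> orthogonal e w" "y = a + e"
    using orthogonal_subspace_decomp_exists[of Y y] by blast
  have o: "hform (\<lambda>_. 1) e z = 0" if "z \<in> Y" for z
  proof -
    have "\<i> *s z \<in> Y" using Y that vec.subspace_scale by blast
    then have "Re (hform (\<lambda>_. 1) e (\<i> *s z)) = 0" and "Re (hform (\<lambda>_. 1) e z) = 0"
      using ae(2) that by (simp_all add: sp orthogonal_def ip)
    then show ?thesis by (simp add: hform_scale_right complex_eq_iff)
  qed
  have "e \<noteq> 0" using ae y sp by auto
  then have "inner e e \<noteq> 0" by simp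
  then have "hform (\<lambda>_. 1) e e \<noteq> 0" using ip[of e e] by auto
  moreover have "hform (\<lambda>_. 1) e y = hform (\<lambda>_. 1) e e"
    using ae o sp by (simp add: hform_add_right)
  ultimately show thesis using that o by metis
qed

text \<open>Dividing coordinates by the signs turns the standard product into the given form. The
  vector \<open>e\<close> later corrects other vectors without disturbing their orthogonality to
  \<open>Y\<close>.\<close>

lemma hform_separation:
  fixes Y :: "(complex^'n::finite) set"
  assumes Y: "vec.subspace Y" and y: "y \<notin> Y" and \<sigma>: "\<And>i. \<sigma> i \<noteq> 0"
  obtains e where "\<And>z. z \<in> Y \<Longrightarrow> hform \<sigma> e z = 0" "hform \<sigma> e y \<noteq> 0"
proof -
  obtain e where e: "\<And>z. z \<in> Y \<Longrightarrow> hform (\<lambda>_. 1) e z = 0" "hform (\<lambda>_. 1) e y \<noteq> 0"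
    using hermitian_separation[OF Y y] by blast
  define e' where "e' = (\<chi> i. e $ i / complex_of_real (\<sigma> i))"
  have "hform \<sigma> e' z = hform (\<lambda>_. 1) e z" for z
    unfolding hform_def e'_def by (rule sum.cong) (use \<sigma> in auto)
  then show thesis using that e by metis
qed

lemma hform_nondegenerate:
  assumes \<sigma>: "\<And>i. \<sigma> i \<noteq> 0" and "\<And>z. hform \<sigma> z w = 0"
  shows "w = 0"
proof (rule ccontr)
  assume "w \<noteq> 0"
  then obtain e where "hform \<sigma> e w \<noteq> 0"
    using hform_separation[where Y = "{0}" and \<sigma> = \<sigma>, OF vec.subspace_single_0 _ \<sigma>] by blast
  with assms(2) show False by blast
qed

lemma dim_Int_kernel:
  fixes Z :: "(complex^'n::finite) set"
  assumes Z: "vec.subspace Z"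
  shows "vec.dim Z \<le> vec.dim (Z \<inter> {y. hform \<sigma> y u = 0}) + 1"
proof (cases "\<exists>e\<in>Z. hform \<sigma> e u \<noteq> 0")
  case True
  then obtain e where e: "e \<in> Z" "hform \<sigma> e u \<noteq> 0" by blast
  let ?K = "Z \<inter> {y. hform \<sigma> y u = 0}"
  have "Z \<subseteq> vec.span (insert e ?K)"
  proof
    fix z assume z: "z \<in> Z"
    define c where "c = hform \<sigma> z u / hform \<sigma> e u"
    have "z - c *s e \<in> ?K"
      using z e Z by (auto simp: hform_lin c_def vec.subspace_diff vec.subspace_scale)
    then show "z \<in> vec.span (insert e ?K)"
      by (metis vec.span_breakdown_eq vec.span_base)
  qed
  then have "vec.dim Z \<le> vec.dim (insert e ?K)"
    by (metis vec.dim_span vec.dim_subset)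
  then show ?thesis by (simp add: vec.dim_insert split: if_splits)
next
  case False
  then have "Z \<inter> {y. hform \<sigma> y u = 0} = Z" by auto
  then show ?thesis by simp
qed

lemma subspace_kernel: "vec.subspace {y. hform \<sigma> y u = 0}"
  by (auto simp: vec.subspace_def hform_lin)

lemma subspace_kernel_right: "vec.subspace {y. hform \<sigma> u y = 0}"
  by (auto simp: vec.subspace_def hform_lin)

section \<open>Holomorphy along complex lines\<close>

lemma cholo_curve:
  assumes G: "cholo_at G (c t)" and c: "\<And>i. (\<lambda>s. c s $ i) field_differentiable (at t)"
  shows "(\<lambda>s. G (c s) $ j) field_differentiable (at t)"
proof -
  obtain D where D: "(G has_derivative D) (at (c t))" "\<And>k v. D (k *s v) = k *s D v"
    using G unfolding cholo_at_def by blast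
  define v where "v = (\<chi> i. deriv (\<lambda>s. c s $ i) t)"
  have "((\<lambda>s. c s $ i) has_derivative (\<lambda>h. (h *s v) $ i)) (at t)" for i
    using field_differentiable_derivI[OF c[of i]]
    by (simp add: has_field_derivative_def v_def mult.commute mult_commute_abs)
  then have "(c has_derivative (\<lambda>h. h *s v)) (at t)"
    by (subst has_derivative_componentwise_within) (auto simp: Basis_vec_def inner_axis intro!: has_derivative_inner_left)
  then have "((\<lambda>s. G (c s)) has_derivative (\<lambda>h. D (h *s v))) (at t)"
    using diff_chain_at[of c "\<lambda>h. h *s v" t G D] D(1) by (simp add: o_def)
  then have "((\<lambda>s. G (c s) $ j) has_derivative (\<lambda>h. (h *s D v) $ j)) (at t)"
    unfolding D(2) by (rule bounded_linear.has_derivative[OF bounded_linear_vec_nth])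
  then show ?thesis
    unfolding field_differentiable_def has_field_derivative_def
    by (auto simp: mult_commute_abs intro!: exI[of _ "D v $ j"])
qed

lemma cholo_compose:
  assumes "cholo_at G z" "cholo_at H (G z)" shows "cholo_at (\<lambda>x. H (G x)) z"
proof -
  obtain D where D: "(G has_derivative D) (at z)" "\<And>k v. D (k *s v) = k *s D v"
    using assms(1) unfolding cholo_at_def by blast
  obtain E where E: "(H has_derivative E) (at (G z))" "\<And>k v. E (k *s v) = k *s E v"
    using assms(2) unfolding cholo_at_def by blast
  have "((\<lambda>x. H (G x)) has_derivative (\<lambda>v. E (D v))) (at z)"
    using diff_chain_at[OF D(1) E(1)] by (simp add: o_def)
  with D E show ?thesis unfolding cholo_at_def by (intro exI[of _ "\<lambda>v. E (D v)"]) simp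
qed

lemma cholo_isCont: "cholo_at G z \<Longrightarrow> isCont G z"
  unfolding cholo_at_def using has_derivative_continuous by blast

text \<open>Holomorphy along complex lines is all that the identity theorem on convex sets needs.\<close>

definition line_holo :: "(complex^'n::finite \<Rightarrow> complex) \<Rightarrow> (complex^'n) set \<Rightarrow> bool" where
  "line_holo f W \<longleftrightarrow> (\<forall>z\<in>W. \<forall>v. (\<lambda>t. f (z + t *s v)) field_differentiable (at 0))"

named_theorems line_holo_intros

lemma line_holo_const [line_holo_intros]: "line_holo (\<lambda>_. c) W"
  by (simp add: line_holo_def)

lemma line_holo_add [line_holo_intros]:
  "line_holo f W \<Longrightarrow> line_holo g W \<Longrightarrow> line_holo (\<lambda>z. f z + g z) W"
  by (auto simp: line_holo_def intro!: derivative_intros)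

lemma line_holo_diff [line_holo_intros]:
  "line_holo f W \<Longrightarrow> line_holo g W \<Longrightarrow> line_holo (\<lambda>z. f z - g z) W"
  by (auto simp: line_holo_def intro!: derivative_intros)

lemma line_holo_mult [line_holo_intros]:
  "line_holo f W \<Longrightarrow> line_holo g W \<Longrightarrow> line_holo (\<lambda>z. f z * g z) W"
  by (auto simp: line_holo_def intro!: derivative_intros)

lemma line_holo_sum [line_holo_intros]:
  "(\<And>i. i \<in> I \<Longrightarrow> line_holo (f i) W) \<Longrightarrow> line_holo (\<lambda>z. \<Sum>i\<in>I. f i z) W"
  by (induction I rule: infinite_finite_induct) (auto intro: line_holo_intros)

lemma line_holo_nth [line_holo_intros]: "line_holo (\<lambda>z. z $ i) W"
  by (auto simp: line_holo_def intro!: derivative_intros)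

lemma line_holo_hform [line_holo_intros]:
  "(\<And>i. line_holo (\<lambda>z. f z $ i) W) \<Longrightarrow> line_holo (\<lambda>z. hform \<sigma> (f z) w) W"
  unfolding hform_def by (intro line_holo_intros)

lemma line_holo_cholo:
  assumes "\<And>z. z \<in> W \<Longrightarrow> cholo_at G z" shows "line_holo (\<lambda>z. G z $ j) W"
  unfolding line_holo_def
proof (intro ballI allI)
  fix z v assume "z \<in> W"
  then show "(\<lambda>t. G (z + t *s v) $ j) field_differentiable at 0"
    using assms by (intro cholo_curve[where c = "\<lambda>t. z + t *s v" and G = G and t = 0])
      (auto intro!: derivative_intros)
qed

lemma line_holo_affine:
  assumes f: "line_holo f W"
  shows "(\<lambda>t. f (z + t *s v)) holomorphic_on {t. z + t *s v \<in> W}"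
proof (rule holomorphic_onI)
  fix t assume "t \<in> {t. z + t *s v \<in> W}"
  then have "(\<lambda>s. f ((z + t *s v) + s *s v)) field_differentiable at 0"
    using f unfolding line_holo_def by blast
  moreover have "(\<lambda>s. f ((z + t *s v) + s *s v)) = (\<lambda>s. f (z + (s + t) *s v))"
    by (auto simp: vec.scale_left_distrib algebra_simps)
  ultimately have "(\<lambda>s. f (z + (s + t) *s v)) field_differentiable at 0" by simp
  then obtain d where "((\<lambda>s. f (z + (s + t) *s v)) has_field_derivative d) (at 0)"
    unfolding field_differentiable_def by blast
  then have "((\<lambda>s. f (z + s *s v)) has_field_derivative d) (at t)"
    using DERIV_shift[of "\<lambda>s. f (z + s *s v)" d 0 t] by simp
  then show "(\<lambda>s. f (z + s *s v)) field_differentiable at t within {t. z + t *s v \<in> W}"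
    using field_differentiable_def field_differentiable_at_within by blast
qed

lemma line_holo_subset: "line_holo f W \<Longrightarrow> U \<subseteq> W \<Longrightarrow> line_holo f U"
  by (auto simp: line_holo_def)

lemma open_line:
  fixes z v :: "complex^'n::finite"
  assumes "open W" shows "open {t. z + t *s v \<in> W}"
proof -
  have "open ((\<lambda>t. z + t *s v) -` W)"
    by (rule open_vimage[OF assms]) (intro continuous_intros)
  then show ?thesis by (simp add: vimage_def)
qed

lemma convex_line:
  fixes z v :: "complex^'n::finite"
  assumes W: "convex W" shows "convex {t. z + t *s v \<in> W}"
proof (rule convexI)
  fix x y :: complex and a b :: real
  assume h: "x \<in> {t. z + t *s v \<in> W}" "y \<in> {t. z + t *s v \<in> W}" "0 \<le> a" "0 \<le> b" "a + b = 1"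
  have e: "z + (a *\<^sub>R x + b *\<^sub>R y) *s v = a *\<^sub>R (z + x *s v) + b *\<^sub>R (z + y *s v)"
  proof -
    have "b = 1 - a" using h by simp
        show ?thesis unfolding \<open>b = 1 - a\<close>
      by (simp add: vec_eq_iff) (simp add: scaleR_conv_of_real algebra_simps)
  qed
  have "a *\<^sub>R (z + x *s v) + b *\<^sub>R (z + y *s v) \<in> W" using W h by (auto intro: convexD)
  with e show "a *\<^sub>R x + b *\<^sub>R y \<in> {t. z + t *s v \<in> W}" by simp
qed

text \<open>Convexity makes the parameters with \<open>y0 + t *s (y1 - y0)\<close> in
  \<open>W\<close> a connected set, so vanishing near \<open>t = 0\<close> would force vanishing at
  \<open>t = 1\<close>, which is \<open>y1\<close>. The lemma serves to move \<open>y0\<close> as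
  little as desired to a point where \<open>f\<close> is nonzero.\<close>

lemma line_holo_nonzero_near:
  fixes f :: "complex^'n::finite \<Rightarrow> complex"
  assumes W: "open W" "convex W" and f: "line_holo f W"
    and y0: "y0 \<in> W" and y1: "y1 \<in> W" "f y1 \<noteq> 0" and e: "e > 0"
  obtains t where "cmod t < e" "y0 + t *s (y1 - y0) \<in> W" "f (y0 + t *s (y1 - y0)) \<noteq> 0"
proof -
  note found = that
  define v where "v = y1 - y0"
  let ?D = "{t. y0 + t *s v \<in> W}"
  have D: "open ?D" "connected ?D"
    using open_line[OF W(1)] convex_connected[OF convex_line[OF W(2)]] by blast+
  have m: "0 \<in> ?D" "1 \<in> ?D" using y0 y1 by (simp_all add: v_def)
  obtain d where d: "d > 0" "ball 0 d \<subseteq> ?D" using D(1) m(1) openE by blast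
  show thesis
  proof (rule ccontr)
    assume n: "\<not> thesis"
    have z: "f (y0 + t *s v) = 0" if "t \<in> ball 0 (min d e)" for t
    proof -
      have "cmod t < e" "t \<in> ball 0 d" using that by (simp_all add: dist_norm)
      then show ?thesis using found[of t] n d(2) unfolding v_def by blast
    qed
    have "f (y0 + 1 *s v) = 0"
    proof (rule analytic_continuation[where f = "\<lambda>t. f (y0 + t *s v)" and S = ?D
            and U = "ball 0 (min d e)" and \<xi> = 0])
      show "(\<lambda>t. f (y0 + t *s v)) holomorphic_on ?D" by (rule line_holo_affine[OF f])
      show "open ?D" "connected ?D" by (rule D)+
      show "ball 0 (min d e) \<subseteq> ?D" using d(2) by auto
      show "0 \<in> ?D" "1 \<in> ?D" by (rule m)+
      show "(0::complex) islimpt ball 0 (min d e)" using d(1) e by (simp add: islimpt_ball)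
    qed (rule z)
    with y1 show False by (simp add: v_def)
  qed
qed

lemma line_holo_identity:
  fixes f :: "complex^'n::finite \<Rightarrow> complex"
  assumes W: "open W" "convex W" and f: "line_holo f W"
    and U: "open U" "y0 \<in> U" "y0 \<in> W" "\<And>y. y \<in> U \<Longrightarrow> y \<in> W \<Longrightarrow> f y = 0"
    and y: "y \<in> W"
  shows "f y = 0"
proof (rule ccontr)
  assume n: "f y \<noteq> 0"
  define v where "v = y - y0"
  have "open {t. y0 + t *s v \<in> U}" using U(1) by (rule open_line)
  moreover have "0 \<in> {t. y0 + t *s v \<in> U}" using U(2) by simp
  ultimately obtain e where e: "e > 0" "ball 0 e \<subseteq> {t. y0 + t *s v \<in> U}"
    using openE by blast
  obtain t where "cmod t < e" "y0 + t *s (y - y0) \<in> W" "f (y0 + t *s (y - y0)) \<noteq> 0"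
    using line_holo_nonzero_near[OF W f U(3) y n e(1)] by blast
  moreover from this have "t \<in> {t. y0 + t *s v \<in> U}" using e(2) by (auto simp: dist_norm)
  ultimately show False using U(4) by (simp add: v_def)
qed

section \<open>Linear independence of holomorphic families\<close>

text \<open>Independence of an indexed family, so that a repeated value counts as a dependence;
  \<open>vec.independent\<close> of the image would not notice it.\<close>

definition cindep :: "'a set \<Rightarrow> ('a \<Rightarrow> complex^'m::finite) \<Rightarrow> bool" where
  "cindep I g \<longleftrightarrow> (\<forall>c. (\<Sum>a\<in>I. c a *s g a) = 0 \<longrightarrow> (\<forall>a\<in>I. c a = 0))"

lemma cindep_inj_on:
  assumes "finite I" "cindep I g" shows "inj_on g I"
proof (rule inj_onI)
  fix a b assume ab: "a \<in> I" "b \<in> I" "g a = g b"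
  show "a = b"
  proof (rule ccontr)
    assume ne: "a \<noteq> b"
    let ?c = "(\<lambda>_. 0)(a := 1, b := -1 :: complex)"
    have "(\<Sum>x\<in>I. ?c x *s g x) = (\<Sum>x\<in>{a, b}. ?c x *s g x)"
      by (rule sum.mono_neutral_right) (use ab assms in auto)
    also have "\<dots> = 0" using ne ab by (simp add: vector_smult_lneg)
    finally have "?c a = 0" using assms ab unfolding cindep_def by blast
    with ne show False by simp
  qed
qed

lemma cindep_independent:
  assumes "finite I" "cindep I g" shows "vec.independent (g ` I)"
proof -
  have inj: "inj_on g I" by (rule cindep_inj_on[OF assms])
  show ?thesis unfolding vec.independent_explicit
  proof (intro conjI allI impI ballI)
    show "finite (g ` I)" using assms by simp
    fix c v assume "(\<Sum>v\<in>g ` I. c v *s v) = 0" "v \<in> g ` I"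
    then have "(\<Sum>a\<in>I. c (g a) *s g a) = 0" by (simp add: sum.reindex[OF inj])
    then have "\<forall>a\<in>I. c (g a) = 0" using assms(2) unfolding cindep_def
      by (elim allE[of _ "\<lambda>a. c (g a)"]) simp
    with \<open>v \<in> g ` I\<close> show "c v = 0" by auto
  qed
qed

lemma independent_cindep:
  assumes "vec.independent (g ` I)" "inj_on g I" "finite I" shows "cindep I g"
  unfolding cindep_def
proof (intro allI impI)
  fix c assume c: "(\<Sum>a\<in>I. c a *s g a) = 0"
  have "(\<Sum>v\<in>g ` I. c (the_inv_into I g v) *s v) = 0"
    unfolding sum.reindex[OF assms(2)] using c
    by (simp add: the_inv_into_f_f[OF assms(2)] cong: sum.cong)
  then have "\<forall>v\<in>g ` I. c (the_inv_into I g v) = 0"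
    using assms(1) unfolding vec.independent_explicit
    by (elim conjE allE[of _ "\<lambda>v. c (the_inv_into I g v)"]) simp
  then show "\<forall>a\<in>I. c a = 0" by (simp add: the_inv_into_f_f[OF assms(2)])
qed

lemma cindep_card_le_dim:
  assumes "finite I" "cindep I g" "g ` I \<subseteq> A" shows "card I \<le> vec.dim A"
  using vec.independent_card_le_dim[OF assms(3) cindep_independent[OF assms(1,2)]]
    card_image[OF cindep_inj_on[OF assms(1,2)]] by simp

text \<open>A family completed to a basis at \<open>t1\<close> stays a basis wherever its determinant
  does not vanish.\<close>

lemma cindep_determinant:
  fixes g :: "'a \<Rightarrow> complex \<Rightarrow> complex^'m::finite"
  assumes fin: "finite I" and hol: "\<And>a j. a \<in> I \<Longrightarrow> (\<lambda>t. g a t $ j) holomorphic_on D"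
    and ind: "cindep I (\<lambda>a. g a t1)"
  obtains \<Delta> where "\<Delta> holomorphic_on D" "\<Delta> t1 \<noteq> 0" "\<And>t. \<Delta> t \<noteq> 0 \<Longrightarrow> cindep I (\<lambda>a. g a t)"
proof -
  define h where "h = (\<lambda>a. g a t1)"
  have inj: "inj_on h I" and indS: "vec.independent (h ` I)"
    using cindep_inj_on[OF fin] cindep_independent[OF fin] ind unfolding h_def by blast+
  obtain B where B: "h ` I \<subseteq> B" "vec.independent B" "UNIV \<subseteq> vec.span B"
    using vec.maximal_independent_subset_extend[OF subset_UNIV indS] by metis
  have "finite B" using B(2) vec.finiteI_independent by blast
  moreover have "card B = CARD('m)"
    using vec.basis_card_eq_dim[OF subset_UNIV B(3,2)] vec_dim_card[where 'a = complex] by simp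
  ultimately obtain e where e: "bij_betw e (UNIV::'m set) B"
    using finite_same_card_bij[of "UNIV :: 'm set" B] by auto
  define k where "k = the_inv_into I h"
  have k: "k (h a) = a" if "a \<in> I" for a
    unfolding k_def by (rule the_inv_into_f_f[OF inj that])
  \<comment> \<open>Basis vectors that come from \<open>I\<close> move with \<open>t\<close>; those
    added to complete the basis stay fixed.\<close>
  define R where "R = (\<lambda>i t. if e i \<in> h ` I then g (k (e i)) t else e i)"
  define \<Delta> where "\<Delta> t = det (\<chi> i. R i t)" for t
  have row: "row i (\<chi> i. R i t) = R i t" for i t by (simp add: row_def vec_eq_iff)
  have nz: "\<Delta> t \<noteq> 0 \<longleftrightarrow> (\<forall>c. (\<Sum>i\<in>UNIV. c i *s R i t) = 0 \<longrightarrow> (\<forall>i. c i = 0))" for t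
    unfolding \<Delta>_def invertible_det_nz[symmetric] invertible_right_inverse
      matrix_right_invertible_independent_rows row ..
  have R1: "R i t1 = e i" for i unfolding R_def using k by (auto simp: h_def)
  have "cindep UNIV e"
    by (rule independent_cindep) (use e B(2) in \<open>auto simp: bij_betw_def\<close>)
  then have "\<Delta> t1 \<noteq> 0" unfolding nz R1 cindep_def by simp
  moreover have "(\<lambda>t. R i t $ j) holomorphic_on D" for i j
    unfolding R_def using hol k by (cases "e i \<in> h ` I") auto
  then have "\<Delta> holomorphic_on D"
    unfolding \<Delta>_def det_def by (auto intro!: holomorphic_intros)
  moreover have "cindep I (\<lambda>a. g a t)" if "\<Delta> t \<noteq> 0" for t
    unfolding cindep_def
  proof (intro allI impI)
    fix c assume c: "(\<Sum>a\<in>I. c a *s g a t) = 0"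
    define c' where "c' i = (if e i \<in> h ` I then c (k (e i)) else 0)" for i
    define J where "J = {i. e i \<in> h ` I}"
    have bJ: "bij_betw (\<lambda>i. k (e i)) J I"
      unfolding bij_betw_def
    proof
      show "inj_on (\<lambda>i. k (e i)) J"
      proof (rule inj_onI)
        fix i j assume ij: "i \<in> J" "j \<in> J" "k (e i) = k (e j)"
        then have "e i = e j" using k unfolding J_def by auto
        then show "i = j" using e unfolding bij_betw_def inj_def by auto
      qed
      show "(\<lambda>i. k (e i)) ` J = I"
      proof
        show "(\<lambda>i. k (e i)) ` J \<subseteq> I" using k unfolding J_def by auto
        show "I \<subseteq> (\<lambda>i. k (e i)) ` J"
        proof
          fix a assume a: "a \<in> I"
          then obtain i where "e i = h a" using e B(1) unfolding bij_betw_def by (metis image_eqI image_iff subsetD)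
          then show "a \<in> (\<lambda>i. k (e i)) ` J" using a k unfolding J_def by force
        qed
      qed
    qed
    have "(\<Sum>i\<in>UNIV. c' i *s R i t) = (\<Sum>i\<in>J. c' i *s R i t)"
      by (rule sum.mono_neutral_right) (auto simp: J_def c'_def)
    also have "\<dots> = (\<Sum>i\<in>J. c (k (e i)) *s g (k (e i)) t)"
      by (rule sum.cong) (auto simp: J_def c'_def R_def)
    also have "\<dots> = (\<Sum>a\<in>I. c a *s g a t)"
      by (rule sum.reindex_bij_betw[OF bJ])
    finally have "(\<Sum>i\<in>UNIV. c' i *s R i t) = 0" using c by simp
    then have "\<forall>i. c' i = 0" using nz[THEN iffD1, OF that] by (elim allE[of _ c']) simp
    then have "\<forall>i\<in>J. c (k (e i)) = 0" unfolding c'_def J_def by (simp split: if_splits)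
    then show "\<forall>a\<in>I. c a = 0" unfolding bij_betw_imp_surj_on[OF bJ, symmetric] by blast
  qed
  ultimately show thesis using that by blast
qed

text \<open>A determinant that is nonzero at \<open>t1\<close> cannot vanish on a set accumulating
  inside the connected domain. In \<open>rank_bound\<close> the set \<open>S\<close> is once a real
  interval, otherwise a disc.\<close>

lemma cindep_propagates:
  fixes g :: "'a \<Rightarrow> complex \<Rightarrow> complex^'m::finite"
  assumes fin: "finite I" and hol: "\<And>a j. a \<in> I \<Longrightarrow> (\<lambda>t. g a t $ j) holomorphic_on D"
    and D: "open D" "connected D" and t1: "t1 \<in> D" "cindep I (\<lambda>a. g a t1)"
    and S: "S \<subseteq> D" "t0 \<in> D" "t0 islimpt S"
  obtains t where "t \<in> S" "cindep I (\<lambda>a. g a t)"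
proof -
  obtain \<Delta> where \<Delta>: "\<Delta> holomorphic_on D" "\<Delta> t1 \<noteq> 0" "\<And>t. \<Delta> t \<noteq> 0 \<Longrightarrow> cindep I (\<lambda>a. g a t)"
    using cindep_determinant[OF fin hol t1(2)] by metis
  have "\<exists>t\<in>S. \<Delta> t \<noteq> 0"
    using analytic_continuation[OF \<Delta>(1) D S _ t1(1)] \<Delta>(2) by blast
  then show thesis using that \<Delta>(3) by blast
qed

lemma cindep_open:
  fixes g :: "'a \<Rightarrow> complex \<Rightarrow> complex^'m::finite"
  assumes fin: "finite I" and hol: "\<And>a j. a \<in> I \<Longrightarrow> (\<lambda>t. g a t $ j) holomorphic_on D"
    and D: "open D" and t1: "t1 \<in> D" "cindep I (\<lambda>a. g a t1)"
  obtains e where "e > 0" "ball t1 e \<subseteq> D" "\<And>t. t \<in> ball t1 e \<Longrightarrow> cindep I (\<lambda>a. g a t)"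
proof -
  obtain \<Delta> where \<Delta>: "\<Delta> holomorphic_on D" "\<Delta> t1 \<noteq> 0" "\<And>t. \<Delta> t \<noteq> 0 \<Longrightarrow> cindep I (\<lambda>a. g a t)"
    using cindep_determinant[OF fin hol t1(2)] by metis
  have "open {t \<in> D. \<Delta> t \<noteq> 0}"
    using continuous_open_preimage[OF holomorphic_on_imp_continuous_on[OF \<Delta>(1)] D, of "- {0}"]
    by (simp add: vimage_def Int_def open_Compl Collect_conj_eq[symmetric])
  then obtain e where "e > 0" "ball t1 e \<subseteq> {t \<in> D. \<Delta> t \<noteq> 0}"
    using t1(1) \<Delta>(2) openE by blast
  then show thesis using that[of e] \<Delta>(3) by blast
qed

section \<open>Polarization of the boundary condition\<close>

lemma reals_islimpt_0: "d > 0 \<Longrightarrow> (0::complex) islimpt (complex_of_real ` {-d<..<d})"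
  unfolding islimpt_approachable
proof (intro allI impI)
  fix e :: real assume "d > 0" "e > 0"
  then have "min d e / 2 \<in> {-d<..<d}" "complex_of_real (min d e / 2) \<noteq> 0"
    "dist (complex_of_real (min d e / 2)) 0 < e"
    unfolding dist_norm by (simp_all add: min_def)
  then show "\<exists>x'\<in>complex_of_real ` {-d<..<d}. x' \<noteq> 0 \<and> dist x' 0 < e" by blast
qed

lemma isCont_eventually_less:
  fixes f :: "'a::t2_space \<Rightarrow> real"
  assumes "isCont f x" "f x < R" shows "eventually (\<lambda>y. f y < R) (nhds x)"
  using assms order_tendstoD(2) unfolding isCont_def tendsto_at_iff_tendsto_nhds by blast

lemma isCont_eventually_nonzero:
  fixes f :: "'a::t2_space \<Rightarrow> complex"
  assumes "isCont f x" "f x \<noteq> 0" shows "eventually (\<lambda>y. f y \<noteq> 0) (nhds x)"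
  using assms tendsto_imp_eventually_ne unfolding isCont_def tendsto_at_iff_tendsto_nhds by blast

lemma isCont_eventually_in_open:
  assumes "isCont f x" "open S" "f x \<in> S" shows "eventually (\<lambda>y. f y \<in> S) (nhds x)"
  using assms topological_tendstoD unfolding isCont_def tendsto_at_iff_tendsto_nhds by blast

text \<open>With \<open>z = u + \<i> v\<close> and \<open>w = u - \<i> v\<close>, the product of
  \<open>z\<close> and \<open>w\<close> is \<open><u,u> - <v,v> + \<i> (<u,v> + <v,u>)\<close>,
  where both parts are real, so both vanish. For real \<open>t\<close> the vector
  \<open>u + t v\<close> then has square \<open><u,u> (1 + t^2)\<close>.\<close>

lemma hform_polarized_vectors:
  assumes zw: "hform \<sigma> z w = 0"
  defines "u \<equiv> (1/2) *s (z + w)" and "v \<equiv> (- \<i>/2) *s (z - w)"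
  shows "hform \<sigma> v v = hform \<sigma> u u" "hform \<sigma> u v + hform \<sigma> v u = 0"
    "u + \<i> *s v = z" "u - \<i> *s v = w"
proof -
  have wz: "hform \<sigma> w z = 0" using zw hform_eq_0_commute by blast
  show "hform \<sigma> v v = hform \<sigma> u u" "hform \<sigma> u v + hform \<sigma> v u = 0"
    unfolding u_def v_def by (simp_all add: hform_lin zw wz algebra_simps)
  show "u + \<i> *s v = z" "u - \<i> *s v = w" unfolding u_def v_def
    by (simp_all add: vec_eq_iff algebra_simps)
qed

text \<open>The null cone is made real-analytically flat by the parabola \<open>t \<mapsto> u + t v - g(t)/2 q\<close>
  through null points, whose complexification passes through both \<open>z\<close> and \<open>w\<close>.\<close>

lemma orthogonality_polarization:
  fixes G :: "complex^'n::finite \<Rightarrow> complex^'m::finite"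
  assumes W: "open W" "p \<in> W" and hol: "\<And>z. z \<in> W \<Longrightarrow> cholo_at G z"
    and hom: "\<And>z c. z \<in> W \<Longrightarrow> c \<noteq> 0 \<Longrightarrow> c *s z \<in> W \<Longrightarrow> G (c *s z) = G z"
    and null: "\<And>z. z \<in> W \<Longrightarrow> hform \<sigma> z z = 0 \<Longrightarrow> hform \<tau> (G z) (G z) = 0"
    and p: "hform \<sigma> p p = 0" "hform \<sigma> p q = 1" "hform \<sigma> q q = 0"
  obtains \<rho> where "\<rho> > 0" "ball p \<rho> \<subseteq> W"
    "\<And>z w. z \<in> ball p \<rho> \<Longrightarrow> w \<in> ball p \<rho> \<Longrightarrow> hform \<sigma> z w = 0 \<Longrightarrow> hform \<tau> (G z) (G w) = 0"
proof -
  obtain R where R: "R > 0" "ball p R \<subseteq> W" using W openE by blast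
  \<comment> \<open>Once the product with the null vector \<open>q\<close> is \<open>1\<close>,
    subtracting \<open>(g/2) q\<close> lowers the square by exactly the real number
    \<open>g\<close>.\<close>
  define nz where "nz z = (1 / hform \<sigma> z q) *s z" for z
  define U where "U z w = (1/2) *s (nz z + nz w)" for z w
  define Vv where "Vv z w = (- \<i>/2) *s (nz z - nz w)" for z w
  \<comment> \<open>Bounds the distance from \<open>p\<close> to the curve \<open>x t\<close> below
    on the disc of radius \<open>2\<close>, which contains \<open>\<i>\<close> and
    \<open>- \<i>\<close>. The factor \<open>3\<close> is half of the coarse bound \<open>6\<close>
    for \<open>1 + t^2\<close>.\<close>
  define \<Psi> where "\<Psi> x = norm (U (fst x) (snd x) - p) + 2 * norm (Vv (fst x) (snd x))
     + 3 * cmod (hform \<sigma> (U (fst x) (snd x)) (U (fst x) (snd x))) * norm q" for x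
  have nzp: "nz p = p" by (simp add: nz_def p)
  have U0: "U p p = p" by (simp add: U_def nzp vec_eq_iff)
  have \<Psi>0: "\<Psi> (p, p) = 0" by (simp add: \<Psi>_def U0 Vv_def p)
  have c1: "isCont (\<lambda>x. nz (fst x)) (p, p)" "isCont (\<lambda>x. nz (snd x)) (p, p)"
    unfolding nz_def by (intro continuous_intros; simp add: p)+
  have "isCont \<Psi> (p, p)"
    unfolding \<Psi>_def U_def Vv_def by (intro continuous_intros c1)
  then have "eventually (\<lambda>x. \<Psi> x < R) (nhds (p, p))"
    by (rule isCont_eventually_less) (simp add: \<Psi>0 R)
  moreover have "eventually (\<lambda>x. hform \<sigma> (fst x) q \<noteq> 0) (nhds (p, p))"
    by (rule isCont_eventually_nonzero) (auto simp: p intro!: continuous_intros)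
  moreover have "eventually (\<lambda>x. hform \<sigma> (snd x) q \<noteq> 0) (nhds (p, p))"
    by (rule isCont_eventually_nonzero) (auto simp: p intro!: continuous_intros)
  ultimately have "eventually (\<lambda>x. \<Psi> x < R \<and> hform \<sigma> (fst x) q \<noteq> 0 \<and> hform \<sigma> (snd x) q \<noteq> 0) (nhds (p, p))"
    by eventually_elim auto
  then obtain \<delta> where \<delta>: "\<delta> > 0"
    "\<And>x. dist x (p, p) < \<delta> \<Longrightarrow> \<Psi> x < R \<and> hform \<sigma> (fst x) q \<noteq> 0 \<and> hform \<sigma> (snd x) q \<noteq> 0"
    unfolding eventually_nhds_metric by blast
  show thesis
  proof (rule that[of "min R (\<delta>/2)"])
    show "min R (\<delta>/2) > 0" "ball p (min R (\<delta>/2)) \<subseteq> W" using R \<delta> by auto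
    fix z w assume z: "z \<in> ball p (min R (\<delta>/2))" and w: "w \<in> ball p (min R (\<delta>/2))"
      and zw: "hform \<sigma> z w = 0"
    have "dist (z, w) (p, p) \<le> dist z p + dist w p"
      unfolding dist_Pair_Pair by (rule sqrt_sum_squares_le_sum) auto
    also have "\<dots> < \<delta>" using z w by (simp add: dist_commute)
    finally have \<Psi>R: "\<Psi> (z, w) < R" and nz0: "hform \<sigma> z q \<noteq> 0" "hform \<sigma> w q \<noteq> 0"
      using \<delta>(2) by fastforce+
    define u where "u = U z w"
    define v where "v = Vv z w"
    have ort: "hform \<sigma> (nz z) (nz w) = 0" by (simp add: nz_def hform_lin zw)
    note pv = hform_polarized_vectors[OF ort, folded U_def Vv_def, folded u_def v_def]
    have nq: "hform \<sigma> (nz z) q = 1" "hform \<sigma> (nz w) q = 1" using nz0 by (simp_all add: nz_def hform_lin)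
    have uq: "hform \<sigma> u q = 1" and vq: "hform \<sigma> v q = 0"
      by (simp_all add: u_def v_def U_def Vv_def hform_lin nq)
    have qu: "hform \<sigma> q u = 1" and qv: "hform \<sigma> q v = 0"
      using uq vq hform_cnj by (metis complex_cnj_one, metis complex_cnj_zero)
    define a where "a = hform \<sigma> u u"
    have a_real: "cnj a = a" unfolding a_def by (rule hform_cnj)
    define x where "x t = u + t *s v - (a * (1 + t\<^sup>2) / 2) *s q" for t :: complex
    have xi: "x \<i> = nz z" "x (- \<i>) = nz w" using pv by (simp_all add: x_def vector_smult_lneg)
    have xball: "x t \<in> ball p R" if "t \<in> ball 0 2" for t
    proof -
      have t: "cmod t < 2" using that by simp
      have "cmod (1 + t\<^sup>2) \<le> 1 + (cmod t)\<^sup>2" using norm_triangle_ineq[of 1 "t\<^sup>2"] by (simp add: norm_power)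
      also have "\<dots> \<le> 1 + 2\<^sup>2" using t by (intro add_left_mono power_mono) auto
      finally have b: "cmod (1 + t\<^sup>2) \<le> 6" by simp
      have "norm (x t - p) \<le> norm (u - p) + norm (t *s v) + norm ((a * (1 + t\<^sup>2) / 2) *s q)"
      proof -
        have xp: "x t - p = (u - p) + t *s v - (a * (1 + t\<^sup>2) / 2) *s q" by (simp add: x_def)
        show ?thesis unfolding xp
          using norm_triangle_ineq4[of "(u - p) + t *s v" "(a * (1 + t\<^sup>2) / 2) *s q"]
            norm_triangle_ineq[of "u - p" "t *s v"] by linarith
      qed
      also have "norm (t *s v) \<le> 2 * norm v" using t by (simp add: norm_cscale mult_right_mono)
      also have "norm ((a * (1 + t\<^sup>2) / 2) *s q) \<le> 3 * cmod a * norm q"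
      proof -
        have "cmod a * cmod (1 + t\<^sup>2) / 2 \<le> cmod a * 6 / 2"
          by (intro divide_right_mono mult_left_mono b) auto
        then have "cmod (a * (1 + t\<^sup>2) / 2) \<le> 3 * cmod a" by (simp add: norm_mult norm_divide)
        then show ?thesis unfolding norm_cscale by (rule mult_right_mono) auto
      qed
      also have "norm (u - p) + 2 * norm v + 3 * cmod a * norm q = \<Psi> (z, w)"
        by (simp add: \<Psi>_def u_def v_def a_def)
      finally show ?thesis using \<Psi>R by (simp add: dist_norm norm_minus_commute)
    qed
    have xnull: "hform \<sigma> (x t) (x t) = 0" if "cnj t = t" for t
    proof -
      have "hform \<sigma> (x t) (x t) = t * (hform \<sigma> u v + hform \<sigma> v u) + a + t\<^sup>2 * hform \<sigma> v v - a * (1 + t\<^sup>2)"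
        by (simp add: x_def hform_lin uq vq qu qv p that a_real a_def[symmetric] algebra_simps power2_eq_square)
      then show ?thesis by (simp add: pv a_def algebra_simps)
    qed
    have hx: "(\<lambda>t. G (x t) $ j) holomorphic_on ball 0 2" for j
    proof (rule holomorphic_onI)
      fix t :: complex assume t: "t \<in> ball 0 2"
      have "(\<lambda>s. G (x s) $ j) field_differentiable at t"
      proof (rule cholo_curve[where G = G and c = x and t = t])
        show "cholo_at G (x t)" using hol xball[OF t] R(2) by blast
        show "(\<lambda>s. x s $ i) field_differentiable at t" for i
          by (simp add: x_def) (auto intro!: derivative_intros)
      qed
      then show "(\<lambda>t. G (x t) $ j) field_differentiable at t within ball 0 2"
        using field_differentiable_at_within by blast
    qed
    have hxc: "(\<lambda>t. cnj (G (x (cnj t)) $ j)) holomorphic_on ball 0 2" for j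
    proof -
      have "(\<lambda>t. G (x t) $ j) holomorphic_on cnj ` ball 0 2"
        by (rule holomorphic_on_subset[OF hx]) auto
      then have "(cnj \<circ> (\<lambda>t. G (x t) $ j) \<circ> cnj) holomorphic_on ball 0 2"
        by (rule holomorphic_on_compose_cnj_cnj) simp
      then show ?thesis by (simp add: o_def)
    qed
    \<comment> \<open>Conjugating \<open>t\<close> compensates for the conjugate linear second slot,
      so \<open>f\<close> is holomorphic. For real \<open>t\<close> it is the square of a value at a
      null point; at \<open>\<i>\<close> it pairs the values at the two normalized points.\<close>
    define f where "f t = hform \<tau> (G (x t)) (G (x (cnj t)))" for t
    have "f \<i> = 0"
    proof (rule analytic_continuation[where f = f and S = "ball 0 2"
          and U = "complex_of_real ` {-1<..<1}" and \<xi> = 0])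
      show "f holomorphic_on ball 0 2"
        unfolding f_def hform_def by (intro holomorphic_intros hx hxc)
      show "complex_of_real ` {-1<..<1} \<subseteq> ball 0 2" by auto
      show "0 islimpt complex_of_real ` {-1<..<1}" by (rule reals_islimpt_0) simp
      fix t assume t: "t \<in> complex_of_real ` {-1<..<1}"
      then have "cnj t = t" "cmod t < 2" by auto
      then show "f t = 0" unfolding f_def using null xnull xball[of t] R(2) by auto
    qed auto
    then have "hform \<tau> (G (nz z)) (G (nz w)) = 0" by (simp add: f_def xi)
    moreover have "nz z \<in> W" "nz w \<in> W" using xball[of \<i>] xball[of "- \<i>"] xi R(2) by auto
    moreover have "z \<in> W" "w \<in> W" using z w R by auto
    ultimately show "hform \<tau> (G z) (G w) = 0"
      using hom[of z "1 / hform \<sigma> z q"] hom[of w "1 / hform \<sigma> w q"] nz0 by (simp add: nz_def)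
  qed
qed

section \<open>Bound for the rank on subspaces\<close>

lemma hform_axis:
  "hform \<sigma> (axis i a) w = complex_of_real (\<sigma> i) * a * cnj (w $ i)"
  "hform \<sigma> w (axis i a) = complex_of_real (\<sigma> i) * w $ i * cnj a"
proof -
  have "hform \<sigma> (axis i a) w
      = (\<Sum>k\<in>UNIV. if k = i then complex_of_real (\<sigma> i) * a * cnj (w $ i) else 0)"
    unfolding hform_def by (rule sum.cong) (auto simp: axis_def)
  moreover have "hform \<sigma> w (axis i a)
      = (\<Sum>k\<in>UNIV. if k = i then complex_of_real (\<sigma> i) * w $ i * cnj a else 0)"
    unfolding hform_def by (rule sum.cong) (auto simp: axis_def)
  ultimately show "hform \<sigma> (axis i a) w = complex_of_real (\<sigma> i) * a * cnj (w $ i)"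
    "hform \<sigma> w (axis i a) = complex_of_real (\<sigma> i) * w $ i * cnj a" by simp_all
qed

lemma axis_component: "axis i a $ j = (if j = i then a else 0)"
  by (simp add: axis_def)

lemma hform_self_eq_0_iff: "hform \<sigma> x x = 0 \<longleftrightarrow> (\<Sum>i\<in>UNIV. \<sigma> i * (cmod (x $ i))\<^sup>2) = 0"
  unfolding hform_self_eq by (simp only: of_real_eq_0_iff)

text \<open>Keeping only the positive coordinates is injective on the span: a combination killed by
  this has no positive and no radical coordinates, so its square is negative unless it is zero,
  whereas nullity makes it \<open>0\<close>.\<close>

lemma null_family_card:
  fixes v :: "'a \<Rightarrow> complex^'m::finite"
  assumes \<tau>: "\<And>j. \<tau> j = 1 \<or> \<tau> j = -1 \<or> \<tau> j = 0"
    and fin: "finite I" and ind: "cindep I v"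
    and null: "\<And>a b. a \<in> I \<Longrightarrow> b \<in> I \<Longrightarrow> hform \<tau> (v a) (v b) = 0"
    and rad: "\<And>a j. a \<in> I \<Longrightarrow> \<tau> j = 0 \<Longrightarrow> v a $ j = 0"
  shows "card I \<le> card {j. \<tau> j = 1}"
proof -
  define w where "w a = (\<chi> j. if \<tau> j = 1 then v a $ j else 0)" for a
  have "cindep I w" unfolding cindep_def
  proof (intro allI impI)
    fix c assume c: "(\<Sum>a\<in>I. c a *s w a) = 0"
    define x where "x = (\<Sum>a\<in>I. c a *s v a)"
    have "x $ j = 0" if "\<tau> j = 1" for j
    proof -
      have "(\<Sum>a\<in>I. c a *s w a) $ j = x $ j" using that by (simp add: x_def w_def)
      then show ?thesis using c by simp
    qed
    moreover have "x $ j = 0" if "\<tau> j = 0" for j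
      using that rad by (simp add: x_def)
    ultimately have pos: "- (\<tau> j * (cmod (x $ j))\<^sup>2) = (cmod (x $ j))\<^sup>2" for j
      using \<tau>[of j] by auto
    have "hform \<tau> x x = 0" unfolding x_def hform_sum_left hform_sum_right
      by (intro sum.neutral ballI) (simp add: hform_lin null)
    then have "(\<Sum>j\<in>UNIV. \<tau> j * (cmod (x $ j))\<^sup>2) = 0" unfolding hform_self_eq_0_iff .
    then have "(\<Sum>j\<in>UNIV. - (\<tau> j * (cmod (x $ j))\<^sup>2)) = 0" by (simp add: sum_negf)
    then have "x = 0" unfolding pos by (simp add: sum_nonneg_eq_0_iff vec_eq_iff)
    then show "\<forall>a\<in>I. c a = 0" using ind unfolding cindep_def x_def by blast
  qed
  moreover have sp: "w ` I \<subseteq> vec.span ((\<lambda>j. axis j 1) ` {j. \<tau> j = 1})"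
  proof safe
    fix a assume "a \<in> I"
    have "w a = (\<Sum>j\<in>{j. \<tau> j = 1}. v a $ j *s axis j 1)"
      by (auto simp: vec_eq_iff w_def axis_component if_distrib cong: if_cong)
    also have "\<dots> \<in> vec.span ((\<lambda>j. axis j 1) ` {j. \<tau> j = 1})"
      by (intro vec.span_sum vec.span_scale vec.span_base) simp
    finally show "w a \<in> vec.span ((\<lambda>j. axis j 1) ` {j. \<tau> j = 1})" .
  qed
  ultimately have "card I \<le> vec.dim (vec.span ((\<lambda>j. axis j (1::complex)) ` {j. \<tau> j = 1}))"
    using cindep_card_le_dim[OF fin] by blast
  also have "\<dots> \<le> card ((\<lambda>j. axis j (1::complex)) ` {j. \<tau> j = 1})"
    unfolding vec.dim_span by (rule vec.dim_le_card') simp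
  also have "\<dots> \<le> card {j. \<tau> j = 1}" by (rule card_image_le) simp
  finally show ?thesis .
qed

text \<open>\<open>H\<close> is the reflection in \<open>x - y\<close>. It takes \<open>x\<close> to
  \<open>y\<close> because both are null with real product, which makes twice the product of
  \<open>x\<close> with \<open>x - y\<close> equal to the square of \<open>x - y\<close>. This is
  the case of Witt's extension theorem needed for \<open>null_frame\<close>.\<close>

lemma hform_reflection:
  assumes null: "hform \<sigma> x x = 0" "hform \<sigma> y y = 0" and sym: "hform \<sigma> x y = hform \<sigma> y x"
    and ni: "x \<noteq> y \<Longrightarrow> hform \<sigma> (x - y) (x - y) \<noteq> 0"
  obtains H where "\<And>a b. hform \<sigma> (H a) (H b) = hform \<sigma> a b" "\<And>a b. H (a + b) = H a + H b"
    "\<And>c a. H (c *s a) = c *s H a" "H x = y"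
proof (cases "x = y")
  case True then show thesis using that[of id] by simp
next
  case False
  define v where "v = x - y"
  define N where "N = hform \<sigma> v v"
  have N: "N \<noteq> 0" "cnj N = N" using ni[OF False] by (simp_all add: N_def v_def hform_cnj)
  define H where "H a = a - (2 * hform \<sigma> a v / N) *s v" for a
  show thesis
  proof (rule that[of H])
    show "hform \<sigma> (H a) (H b) = hform \<sigma> a b" for a b
    proof -
      have "hform \<sigma> (H a) (H b) = hform \<sigma> a b - cnj (2 * hform \<sigma> b v / N) * hform \<sigma> a v
         - (2 * hform \<sigma> a v / N) * hform \<sigma> v b + (2 * hform \<sigma> a v / N) * cnj (2 * hform \<sigma> b v / N) * N"
        by (simp add: H_def hform_lin N_def[symmetric] algebra_simps)
      also have "\<dots> = hform \<sigma> a b" using N by (simp add: hform_cnj field_simps)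
      finally show ?thesis .
    qed
    show "H (a + b) = H a + H b" for a b
      by (simp add: H_def hform_lin vec_eq_iff algebra_simps add_divide_distrib)
    show "H (c *s a) = c *s H a" for c a
      by (simp add: H_def hform_lin vec_eq_iff algebra_simps)
    have "2 * hform \<sigma> x v = N" unfolding N_def v_def by (simp add: hform_lin null sym)
    then show "H x = y" using N by (simp add: H_def v_def)
  qed
qed

text \<open>The \<open>e i\<close> span a maximal null space through \<open>p\<close>, the
  \<open>e' i\<close> a dual one. A model frame joins each positive axis to a negative axis of its
  own, which is possible by \<open>le\<close>. Its null space contains the vector \<open>p0\<close>
  with the same positive coordinates as \<open>p\<close>, and a reflection carries \<open>p0\<close>
  to \<open>p\<close>.\<close>

lemma null_frame:
  fixes p :: "complex^'n::finite"
  assumes \<sigma>: "\<And>i. \<sigma> i = 1 \<or> \<sigma> i = -1" and le: "card {i. \<sigma> i = 1} \<le> card {i. \<sigma> i = -1}"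
    and p: "hform \<sigma> p p = 0"
  obtains e e' where "\<And>i k. \<sigma> i = 1 \<Longrightarrow> \<sigma> k = 1 \<Longrightarrow> hform \<sigma> (e i) (e k) = 0"
    "\<And>i k. \<sigma> i = 1 \<Longrightarrow> \<sigma> k = 1 \<Longrightarrow> hform \<sigma> (e' i) (e' k) = 0"
    "\<And>i k. \<sigma> i = 1 \<Longrightarrow> \<sigma> k = 1 \<Longrightarrow> hform \<sigma> (e i) (e' k) = (if i = k then 1 else 0)"
    "p = (\<Sum>i\<in>{i. \<sigma> i = 1}. hform \<sigma> p (e' i) *s e i)"
proof -
  let ?P = "{i. \<sigma> i = 1}"
  obtain \<iota> where \<iota>: "\<iota> ` ?P \<subseteq> {i. \<sigma> i = -1}" "inj_on \<iota> ?P"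
    using card_le_inj[OF _ _ le] by auto
  have \<iota>m: "\<sigma> (\<iota> i) = -1" if "\<sigma> i = 1" for i using \<iota>(1) that by auto
  have \<iota>eq: "\<iota> i = \<iota> k \<longleftrightarrow> i = k" if "\<sigma> i = 1" "\<sigma> k = 1" for i k
    using \<iota>(2) that by (auto dest: inj_onD)
  have ne: "\<iota> i \<noteq> k" if "\<sigma> i = 1" "\<sigma> k = 1" for i k using \<iota>m[OF that(1)] that(2) by auto
  define \<gamma> where "\<gamma> = (\<Sum>i\<in>?P. p $ i * cnj (p $ \<iota> i))"
  \<comment> \<open>A phase that makes \<open>c * \<gamma>\<close>, and with it the product of
    \<open>p0\<close> and \<open>p\<close>, real, as the reflection requires.\<close>
  obtain c where c: "c * cnj c = 1" "cnj (c * \<gamma>) = c * \<gamma>"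
  proof (cases "\<gamma> = 0")
    case True then show thesis using that[of 1] by simp
  next
    case False
    have "cnj \<gamma> / complex_of_real (cmod \<gamma>) * cnj (cnj \<gamma> / complex_of_real (cmod \<gamma>)) = 1"
      using False by (simp add: complex_norm_square[symmetric] mult.commute power2_eq_square flip: of_real_mult)
    then show thesis using that[of "cnj \<gamma> / complex_of_real (cmod \<gamma>)"] by (simp add: mult.commute)
  qed
  define f where "f i = axis i 1 + axis (\<iota> i) c" for i
  define f' where "f' i = (1/2) *s (axis i 1 - axis (\<iota> i) c)" for i
  have ff: "hform \<sigma> (f i) (f k) = 0" "hform \<sigma> (f' i) (f' k) = 0"
      "hform \<sigma> (f i) (f' k) = (if i = k then 1 else 0)" if "\<sigma> i = 1" "\<sigma> k = 1" for i k
    using that \<iota>m[OF that(1)] \<iota>m[OF that(2)] \<iota>eq[OF that] ne[OF that] ne[OF that(2,1)] c(1)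
    by (auto simp: f_def f'_def hform_lin hform_axis axis_component)
  define p0 where "p0 = (\<Sum>i\<in>?P. p $ i *s f i)"
  have p0p: "hform \<sigma> p0 (f' k) = p $ k" if "\<sigma> k = 1" for k
    unfolding p0_def hform_sum_left hform_scale_left using that by (simp add: ff if_distrib cong: if_cong)
  have p0nth: "p0 $ k = p $ k" if "\<sigma> k = 1" for k
  proof -
    have "p0 $ k = (\<Sum>i\<in>?P. if i = k then p $ k else 0)"
      unfolding p0_def sum_component by (rule sum.cong) (use that ne in \<open>auto simp: f_def axis_component\<close>)
    then show ?thesis using that by simp
  qed
  have p0null: "hform \<sigma> p0 p0 = 0" unfolding p0_def hform_sum_left hform_sum_right
    by (intro sum.neutral ballI) (simp add: hform_lin ff)
  have "hform \<sigma> p0 p = (\<Sum>i\<in>?P. p $ i * (cnj (p $ i) - c * cnj (p $ \<iota> i)))"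
    unfolding p0_def hform_sum_left
    by (rule sum.cong) (auto simp: f_def hform_lin hform_axis axis_component \<iota>m algebra_simps)
  also have "\<dots> = (\<Sum>i\<in>?P. p $ i * cnj (p $ i)) - c * \<gamma>"
    by (simp add: \<gamma>_def sum_distrib_left sum_subtractf algebra_simps)
  finally have "cnj (hform \<sigma> p0 p) = hform \<sigma> p0 p"
    using c(2) by (simp add: mult.commute)
  then have sym: "hform \<sigma> p0 p = hform \<sigma> p p0" by (simp add: hform_cnj)
  \<comment> \<open>\<open>p0 - p\<close> has no positive coordinates, so its square is negative
    unless it is zero.\<close>
  have ni: "hform \<sigma> (p0 - p) (p0 - p) \<noteq> 0" if "p0 \<noteq> p"
  proof
    assume "hform \<sigma> (p0 - p) (p0 - p) = 0"
    then have "(\<Sum>i\<in>UNIV. \<sigma> i * (cmod ((p0 - p) $ i))\<^sup>2) = 0" unfolding hform_self_eq_0_iff .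
    then have "(\<Sum>i\<in>UNIV. - (\<sigma> i * (cmod ((p0 - p) $ i))\<^sup>2)) = 0" by (simp add: sum_negf)
    moreover have "- (\<sigma> i * (cmod ((p0 - p) $ i))\<^sup>2) = (cmod ((p0 - p) $ i))\<^sup>2" for i
      using \<sigma>[of i] p0nth[of i] by auto
    ultimately have "p0 - p = 0" by (simp add: sum_nonneg_eq_0_iff vec_eq_iff)
    with that show False by simp
  qed
  obtain H where H: "\<And>a b. hform \<sigma> (H a) (H b) = hform \<sigma> a b" "\<And>a b. H (a + b) = H a + H b"
    "\<And>c a. H (c *s a) = c *s H a" "H p0 = p"
    using hform_reflection[OF p0null p sym ni] by metis
  have H0: "H 0 = 0" using H(3)[of 0 0] by simp
  have Hsum: "H (\<Sum>i\<in>I. g i) = (\<Sum>i\<in>I. H (g i))" for g and I :: "'n set"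
    by (induction I rule: infinite_finite_induct) (simp_all add: H H0)
  show thesis
  proof (rule that[of "\<lambda>i. H (f i)" "\<lambda>i. H (f' i)"])
    have "p = (\<Sum>i\<in>?P. p $ i *s H (f i))"
      using H(4) unfolding p0_def Hsum H(3) by simp
    moreover have "hform \<sigma> p (H (f' i)) = p $ i" if "\<sigma> i = 1" for i
      using H(1)[of p0 "f' i"] H(4) p0p[OF that] by simp
    ultimately show "p = (\<Sum>i\<in>?P. hform \<sigma> p (H (f' i)) *s H (f i))" by simp
  qed (simp_all add: H(1) ff)
qed

section \<open>Deformation of subspaces to null subspaces\<close>

lemma holo_along_line:
  assumes "\<And>z. z \<in> W \<Longrightarrow> cholo_at G z" "\<And>t. t \<in> D \<Longrightarrow> z + t *s v \<in> W"
  shows "(\<lambda>t. G (z + t *s v) $ j) holomorphic_on D"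
  by (rule holomorphic_on_subset[OF line_holo_affine[OF line_holo_cholo[OF assms(1)]]]) (use assms(2) in auto)

text \<open>The index set is prescribed so that the basis can be compared member by member with a
  null frame.\<close>

lemma subspace_enlarge_basis:
  fixes A :: "(complex^'n::finite) set"
  assumes A: "vec.dim A \<le> card P" and P: "finite P" "card P \<le> CARD('n)"
  obtains b where "inj_on b P" "vec.independent (b ` P)" "A \<subseteq> vec.span (b ` P)"
proof -
  obtain B where B: "B \<subseteq> A" "vec.independent B" "A \<subseteq> vec.span B" "card B = vec.dim A"
    using vec.basis_exists by blast
  obtain C where C: "B \<subseteq> C" "vec.independent C" "(UNIV :: (complex^'n) set) \<subseteq> vec.span C"
    using vec.maximal_independent_subset_extend[OF subset_UNIV B(2)] by metis
  have fC: "finite C" using C(2) vec.finiteI_independent by blast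
  have "card C = CARD('n)"
    using vec.basis_card_eq_dim[OF subset_UNIV C(3,2)] vec_dim_card[where 'a = complex] by simp
  then obtain B' where B': "B \<subseteq> B'" "B' \<subseteq> C" "card B' = card P"
    using exists_subset_between[of B "card P" C] A P B(4) C(1) fC by auto
  have "finite B'" using B'(2) fC finite_subset by blast
  then obtain b where b: "bij_betw b P B'"
    using finite_same_card_bij[OF P(1)] B'(3) by metis
  have "vec.independent B'" using C(2) B'(2) vec.independent_mono by blast
  moreover have "A \<subseteq> vec.span B'" using B(3) vec.span_mono[OF B'(1)] by blast
  ultimately show thesis using that[of b] b unfolding bij_betw_def by metis
qed

lemma span_image_eq:
  assumes "finite P" "z \<in> vec.span (b ` P)"
  obtains \<alpha> where "z = (\<Sum>i\<in>P. \<alpha> i *s b i)"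
proof -
  have "\<exists>\<alpha>. z = (\<Sum>i\<in>P. \<alpha> i *s b i)" using assms(2)
  proof (induction rule: vec.span_induct_alt)
    case base
    show ?case by (rule exI[of _ "\<lambda>_. 0"]) simp
  next
    case (step c x y)
    then obtain k \<alpha> where k: "k \<in> P" "x = b k" and y: "y = (\<Sum>i\<in>P. \<alpha> i *s b i)" by blast
    have "c *s x + y = (\<Sum>i\<in>P. (if i = k then c else 0) *s b i) + (\<Sum>i\<in>P. \<alpha> i *s b i)"
      using k assms(1) by (simp add: y if_distrib[where f = "\<lambda>c. c *s _"] cong: if_cong)
    also have "\<dots> = (\<Sum>i\<in>P. ((if i = k then c else 0) + \<alpha> i) *s b i)"
      by (simp add: sum.distrib[symmetric] vec.scale_left_distrib)
    finally show ?case by (rule exI[of _ "\<lambda>i. (if i = k then c else 0) + \<alpha> i"])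
  qed
  then show thesis using that by blast
qed

text \<open>The number of independent values on null \<open>r\<close>-spaces is bounded by the positive index of the
  target; null \<open>r\<close>-spaces form a uniqueness set among all \<open>r\<close>-spaces, so the bound persists.
  For subspaces with basis \<open>d\<close> dual to the null frame \<open>e'\<close>, subtracting \<open>(1 + i\<theta>)/2\<close> times the
  Gram correction gives null spaces for real \<open>\<theta>\<close> and the given space for \<open>\<theta> = i\<close>.\<close>

lemma rank_bound:
  fixes G :: "complex^'n::finite \<Rightarrow> complex^'m::finite" and p :: "complex^'n"
  assumes \<sigma>: "\<And>i. \<sigma> i = 1 \<or> \<sigma> i = -1" and le: "card {i. \<sigma> i = 1} \<le> card {i. \<sigma> i = -1}"
    and \<tau>: "\<And>j. \<tau> j = 1 \<or> \<tau> j = -1 \<or> \<tau> j = 0"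
    and p: "hform \<sigma> p p = 0" and R: "R > 0"
    and hol: "\<And>z. z \<in> ball p R \<Longrightarrow> cholo_at G z"
    and orth: "\<And>z w. z \<in> ball p R \<Longrightarrow> w \<in> ball p R \<Longrightarrow> hform \<sigma> z w = 0 \<Longrightarrow> hform \<tau> (G z) (G w) = 0"
    and rad: "\<And>z j. \<tau> j = 0 \<Longrightarrow> G z $ j = 0"
  obtains \<rho> where "\<rho> > 0" "\<rho> \<le> R"
    "\<And>A z (I :: nat set). vec.dim A \<le> card {i. \<sigma> i = 1} \<Longrightarrow> finite I \<Longrightarrow> card {j. \<tau> j = 1} < card I \<Longrightarrow>
       (\<And>a. a \<in> I \<Longrightarrow> z a \<in> A \<inter> ball p \<rho>) \<Longrightarrow> \<not> cindep I (\<lambda>a. G (z a))"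
proof -
  let ?P = "{i. \<sigma> i = 1}"
  obtain e e' where frame: "\<And>i k. \<sigma> i = 1 \<Longrightarrow> \<sigma> k = 1 \<Longrightarrow> hform \<sigma> (e i) (e k) = 0"
    "\<And>i k. \<sigma> i = 1 \<Longrightarrow> \<sigma> k = 1 \<Longrightarrow> hform \<sigma> (e' i) (e' k) = 0"
    "\<And>i k. \<sigma> i = 1 \<Longrightarrow> \<sigma> k = 1 \<Longrightarrow> hform \<sigma> (e i) (e' k) = (if i = k then 1 else 0)"
    and pe: "p = (\<Sum>i\<in>?P. hform \<sigma> p (e' i) *s e i)"
    by (rule null_frame[OF \<sigma> le p]) blast
  have e: "hform \<sigma> (e i) (e k) = 0" and e': "hform \<sigma> (e' i) (e' k) = 0"
    and ee: "hform \<sigma> (e i) (e' k) = (if i = k then 1 else 0)" if "i \<in> ?P" "k \<in> ?P" for i k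
    using frame[of i k] that by simp_all
  \<comment> \<open>The projection onto the span of \<open>e\<close> along the common kernel of the
    products with \<open>e'\<close>. It fixes \<open>p\<close>, so it keeps points near
    \<open>p\<close> in the ball.\<close>
  define Pr where "Pr z = (\<Sum>i\<in>?P. hform \<sigma> z (e' i) *s e i)" for z
  have Pp: "Pr p = p" using pe by (simp add: Pr_def)
  have Padd: "Pr (x + y) = Pr x + Pr y" for x y
    by (simp add: Pr_def hform_lin vec.scale_left_distrib sum.distrib)
  have Pscale: "Pr (c *s x) = c *s Pr x" for c x
    by (simp add: Pr_def hform_lin vec.scale_sum_right vector_smult_assoc)
  have P0: "Pr 0 = 0" by (simp add: Pr_def)
  have Pdiff: "Pr (x - y) = Pr x - Pr y" for x y
    using Padd[of "x - y" y] by simp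
  have Psum: "Pr (\<Sum>i\<in>J. g i) = (\<Sum>i\<in>J. Pr (g i))" for g and J :: "'n set"
    by (induction J rule: infinite_finite_induct) (simp_all add: Padd P0)
  have Pe': "hform \<sigma> (Pr z) (e' k) = hform \<sigma> z (e' k)" if "k \<in> ?P" for z k
    unfolding Pr_def hform_sum_left hform_scale_left using that
    by (simp add: ee if_distrib cong: if_cong)
  have Pee: "Pr (e k) = e k" if "k \<in> ?P" for k
    unfolding Pr_def using that by (simp add: ee if_distrib[where f = "\<lambda>c. c *s _"] cong: if_cong)
  have cP: "isCont Pr z" for z unfolding Pr_def by (intro continuous_intros)
  have "eventually (\<lambda>z. Pr z \<in> ball p R) (nhds p)"
    using topological_tendstoD[OF cP[of p, unfolded isCont_def tendsto_at_iff_tendsto_nhds], of "ball p R"] R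
    by (simp add: Pp)
  then obtain \<rho>0 where \<rho>0: "\<rho>0 > 0" "\<And>z. dist z p < \<rho>0 \<Longrightarrow> Pr z \<in> ball p R"
    unfolding eventually_nhds_metric by blast
  define \<rho> where "\<rho> = min \<rho>0 R"
  have \<rho>: "\<rho> > 0" "\<rho> \<le> R" "\<And>z. z \<in> ball p \<rho> \<Longrightarrow> Pr z \<in> ball p R" "ball p \<rho> \<subseteq> ball p R"
    using \<rho>0 R by (auto simp: \<rho>_def dist_commute)
  have finP: "finite ?P" by simp
  have cardP: "card ?P \<le> CARD('n)" by (rule card_mono) auto
  show thesis
  proof (rule that[OF \<rho>(1,2)])
    fix A and z :: "nat \<Rightarrow> complex^'n" and I :: "nat set"
    assume A: "vec.dim A \<le> card ?P" and I: "finite I" "card {j. \<tau> j = 1} < card I"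
      and z: "\<And>a. a \<in> I \<Longrightarrow> z a \<in> A \<inter> ball p \<rho>"
    show "\<not> cindep I (\<lambda>a. G (z a))"
    proof
      assume ind: "cindep I (\<lambda>a. G (z a))"
      obtain b where b: "inj_on b ?P" "vec.independent (b ` ?P)" "A \<subseteq> vec.span (b ` ?P)"
        using subspace_enlarge_basis[OF A finP cardP] by metis
      have "\<exists>\<alpha>. z a = (\<Sum>i\<in>?P. \<alpha> i *s b i)" if "a \<in> I" for a
        using z[OF that] b(3) span_image_eq[OF finP, of "z a" b] by (metis IntD1 subsetD)
      then obtain \<alpha> where \<alpha>: "\<And>a. a \<in> I \<Longrightarrow> z a = (\<Sum>i\<in>?P. \<alpha> a i *s b i)" by metis

      \<comment> \<open>A small perturbation makes the projection \<open>Pr\<close> onto the span of \<open>e\<close> injective on the subspace.\<close>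
      define zz where "zz a s = z a + s *s ((\<Sum>i\<in>?P. \<alpha> a i *s e i) - z a)" for a s
      define bb where "bb i s = b i + s *s (e i - b i)" for i s
      have zb: "zz a s = (\<Sum>i\<in>?P. \<alpha> a i *s bb i s)" if "a \<in> I" for a s
        using \<alpha>[OF that] by (simp add: zz_def bb_def vec.scale_sum_right vector_smult_assoc
          sum_subtractf[symmetric] sum.distrib[symmetric] vec.scale_right_distrib
          vec.scale_right_diff_distrib mult.commute)
      define D1 where "D1 = (\<Inter>a\<in>I. {s. zz a s \<in> ball p \<rho>})"
      have D1: "open D1" unfolding D1_def zz_def using I(1) by (intro open_INT ballI open_line) auto
      have D10: "0 \<in> D1" using z by (auto simp: D1_def zz_def)
      have hol1: "(\<lambda>s. G (zz a s) $ j) holomorphic_on D1" if "a \<in> I" for a j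
        unfolding zz_def by (rule holo_along_line[where W = "ball p \<rho>"])
          (use hol \<rho>(4) that in \<open>auto simp: D1_def zz_def\<close>)
      obtain \<epsilon> where \<epsilon>: "\<epsilon> > 0" "ball 0 \<epsilon> \<subseteq> D1" "\<And>s. s \<in> ball 0 \<epsilon> \<Longrightarrow> cindep I (\<lambda>a. G (zz a s))"
        using cindep_open[of I "\<lambda>a s. G (zz a s)" D1 0] I(1) hol1 D1 D10 ind
        by (auto simp: zz_def)
      have "cindep ?P e" unfolding cindep_def
      proof (intro allI impI ballI)
        fix c k assume c: "(\<Sum>a\<in>?P. c a *s e a) = 0" and k: "k \<in> ?P"
        have "hform \<sigma> (\<Sum>a\<in>?P. c a *s e a) (e' k) = c k"
          unfolding hform_sum_left hform_scale_left using k by (simp add: ee if_distrib cong: if_cong)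
        with c show "c k = 0" by simp
      qed
      \<comment> \<open>At \<open>s = 1\<close> the moved basis is \<open>e\<close> itself;
        independence of its projections is then carried back to some \<open>s\<close> near
        \<open>0\<close>.\<close>
      then have "cindep ?P (\<lambda>i. Pr (bb i 1))" unfolding bb_def using Pee by (simp add: cindep_def)
      moreover have "(\<lambda>s. Pr (bb i s) $ j) holomorphic_on UNIV" for i j
        unfolding Pr_def bb_def by (simp add: hform_lin) (intro holomorphic_intros)
      ultimately obtain s where s: "s \<in> ball 0 \<epsilon>" "cindep ?P (\<lambda>i. Pr (bb i s))"
        using cindep_propagates[of ?P "\<lambda>i s. Pr (bb i s)" UNIV 1 "ball 0 \<epsilon>" 0] \<epsilon>(1)
          convex_connected[OF convex_UNIV, where 'a = complex]
        by (auto simp: islimpt_ball)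
      define y where "y a = zz a s" for a
      define c where "c i = bb i s" for i
      have y: "y a \<in> ball p \<rho>" if "a \<in> I" for a using s(1) \<epsilon>(2) that unfolding D1_def y_def by auto
      have yind: "cindep I (\<lambda>a. G (y a))" unfolding y_def by (rule \<epsilon>(3)[OF s(1)])
      have yc: "y a = (\<Sum>i\<in>?P. \<alpha> a i *s c i)" if "a \<in> I" for a unfolding y_def c_def by (rule zb[OF that])
      have cind: "cindep ?P (\<lambda>i. Pr (c i))" using s(2) by (simp add: c_def)

      have "e k \<in> vec.span ((\<lambda>i. Pr (c i)) ` ?P)" if "k \<in> ?P" for k
      proof -
        have "Pr x \<in> vec.span (e ` ?P)" for x
          unfolding Pr_def by (intro vec.span_sum vec.span_scale vec.span_base) simp
        then have "(\<lambda>i. Pr (c i)) ` ?P \<subseteq> vec.span (e ` ?P)" by blast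
        moreover have "vec.dim (vec.span (e ` ?P)) \<le> card ((\<lambda>i. Pr (c i)) ` ?P)"
        proof -
          have "vec.dim (vec.span (e ` ?P)) \<le> card (e ` ?P)"
            unfolding vec.dim_span by (rule vec.dim_le_card') simp
          also have "\<dots> \<le> card ?P" by (rule card_image_le) simp
          also have "\<dots> = card ((\<lambda>i. Pr (c i)) ` ?P)"
            using card_image[OF cindep_inj_on[OF finP cind]] by simp
          finally show ?thesis .
        qed
        ultimately have "vec.span (e ` ?P) \<subseteq> vec.span ((\<lambda>i. Pr (c i)) ` ?P)"
          by (rule vec.card_ge_dim_independent[OF _ cindep_independent[OF finP cind]])
        moreover have "e k \<in> vec.span (e ` ?P)" using that by (intro vec.span_base imageI)
        ultimately show ?thesis by (rule subsetD)
      qed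
      then have "\<exists>\<gamma>. e k = (\<Sum>i\<in>?P. \<gamma> i *s Pr (c i))" if "k \<in> ?P" for k
        using span_image_eq[OF finP, of "e k" "\<lambda>i. Pr (c i)"] that by metis
      then obtain \<gamma> where \<gamma>: "\<And>k. k \<in> ?P \<Longrightarrow> e k = (\<Sum>i\<in>?P. \<gamma> k i *s Pr (c i))" by metis
      \<comment> \<open>The basis of the perturbed subspace that projects to \<open>e\<close>; it is
        dual to \<open>e'\<close>.\<close>
      define d where "d k = (\<Sum>i\<in>?P. \<gamma> k i *s c i)" for k
      have Pd: "Pr (d k) = e k" if "k \<in> ?P" for k using \<gamma>[OF that] by (simp add: d_def Psum Pscale)
      have yd: "y a = (\<Sum>k\<in>?P. hform \<sigma> (y a) (e' k) *s d k)" if a: "a \<in> I" for a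
      proof -
        let ?x = "y a - (\<Sum>k\<in>?P. hform \<sigma> (y a) (e' k) *s d k)"
        have "?x \<in> vec.span (c ` ?P)" unfolding yc[OF a] d_def
          by (intro vec.span_diff vec.span_sum vec.span_scale vec.span_base) auto
        then obtain \<beta> where \<beta>: "?x = (\<Sum>i\<in>?P. \<beta> i *s c i)" using span_image_eq[OF finP] by blast
        have "Pr ?x = Pr (y a) - (\<Sum>k\<in>?P. hform \<sigma> (y a) (e' k) *s e k)"
          by (simp add: Pdiff Psum Pscale Pd)
        also have "\<dots> = 0" by (simp add: Pr_def)
        finally have "(\<Sum>i\<in>?P. \<beta> i *s Pr (c i)) = 0" unfolding \<beta> by (simp add: Psum Pscale)
        then have "\<forall>i\<in>?P. \<beta> i = 0" using cind unfolding cindep_def by blast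
        then have "?x = 0" unfolding \<beta> by simp
        then show ?thesis by simp
      qed
      have de': "hform \<sigma> (d j) (e' k) = (if j = k then 1 else 0)" if "j \<in> ?P" "k \<in> ?P" for j k
        using Pe'[OF that(2), of "d j"] Pd[OF that(1)] ee[OF that] by simp

      \<comment> \<open>For small \<open>s\<close> the contracted subspace is close to the null space spanned by \<open>e\<close>,
        so that the correction \<open>E\<close> is small.\<close>
      define m where "m k s = e k + s *s (d k - e k)" for k s
      define Y where "Y a s = Pr (y a) + s *s (y a - Pr (y a))" for a s
      have Ym: "Y a s = (\<Sum>k\<in>?P. hform \<sigma> (y a) (e' k) *s m k s)" if "a \<in> I" for a s
      proof -
        have "(\<Sum>k\<in>?P. hform \<sigma> (y a) (e' k) *s m k s)
          = Pr (y a) + s *s ((\<Sum>k\<in>?P. hform \<sigma> (y a) (e' k) *s d k) - Pr (y a))"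
          by (simp add: m_def Pr_def vec.scale_sum_right vector_smult_assoc
            sum_subtractf[symmetric] sum.distrib[symmetric] vec.scale_right_distrib
            vec.scale_right_diff_distrib mult.commute)
        then show ?thesis unfolding Y_def using yd[OF that] by simp
      qed
      define D2 where "D2 = (\<Inter>a\<in>I. {s. Y a s \<in> ball p R})"
      have D2: "open D2" "connected D2"
      proof -
        show "open D2" unfolding D2_def Y_def using I(1) by (intro open_INT ballI open_line) auto
        have "convex D2" unfolding D2_def Y_def by (intro convex_INT convex_line convex_ball)
        then show "connected D2" by (rule convex_connected)
      qed
      have "y a \<in> ball p R" if "a \<in> I" for a using y[OF that] \<rho>(4) by blast
      then have D2m: "0 \<in> D2" "1 \<in> D2" using y \<rho>(3) by (auto simp: D2_def Y_def)
      have hol2: "(\<lambda>s. G (Y a s) $ j) holomorphic_on D2" if "a \<in> I" for a j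
        unfolding Y_def by (rule holo_along_line[where W = "ball p R"])
          (use hol that in \<open>auto simp: D2_def Y_def\<close>)
      \<comment> \<open>The vector in the null span of \<open>e'\<close> that has the same products
        as \<open>Y a s\<close> with every \<open>Y a' s\<close>. It vanishes at
        \<open>s = 0\<close> because the span of \<open>e\<close> is null.\<close>
      define E where "E a s = (\<Sum>k\<in>?P. hform \<sigma> (Y a s) (m k s) *s e' k)" for a s
      have E0: "E a 0 = 0" for a
      proof -
        have "hform \<sigma> (Pr (y a)) (e k) = 0" if "k \<in> ?P" for k
          unfolding Pr_def hform_sum_left hform_scale_left by (intro sum.neutral ballI) (use that e in simp)
        then show ?thesis by (simp add: E_def Y_def m_def)
      qed
      have cE: "isCont (\<lambda>s. norm (Y a s - p) + 2 * norm (E a s)) 0" for a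
        unfolding E_def Y_def m_def by (intro continuous_intros)
      have "eventually (\<lambda>s. \<forall>a\<in>I. norm (Y a s - p) + 2 * norm (E a s) < R) (nhds 0)"
      proof (rule eventually_ball_finite[OF I(1)], rule ballI)
        fix a assume "a \<in> I"
        then have "Pr (y a) \<in> ball p R" using y \<rho>(3) by blast
        then show "eventually (\<lambda>s. norm (Y a s - p) + 2 * norm (E a s) < R) (nhds 0)"
          by (intro isCont_eventually_less[OF cE]) (simp add: E0 Y_def dist_norm norm_minus_commute)
      qed
      then obtain \<delta> where \<delta>: "\<delta> > 0"
        "\<And>s a. dist s 0 < \<delta> \<Longrightarrow> a \<in> I \<Longrightarrow> norm (Y a s - p) + 2 * norm (E a s) < R"
        unfolding eventually_nhds_metric by blast
      have "ball 0 \<delta> \<subseteq> D2"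
      proof
        fix s assume s: "s \<in> ball (0::complex) \<delta>"
        have "dist p (Y a s) < R" if "a \<in> I" for a
        proof -
          have "norm (Y a s - p) + 2 * norm (E a s) < R" using \<delta>(2)[of s a] s that by (simp add: dist_commute)
          moreover have "0 \<le> 2 * norm (E a s)" by simp
          ultimately have "norm (Y a s - p) < R" by linarith
          then show ?thesis by (simp add: dist_norm norm_minus_commute)
        qed
        then show "s \<in> D2" unfolding D2_def by auto
      qed
      moreover have "cindep I (\<lambda>a. G (Y a 1))" using yind by (simp add: Y_def)
      ultimately obtain s where s: "s \<in> ball 0 \<delta>" "cindep I (\<lambda>a. G (Y a s))"
        using cindep_propagates[of I "\<lambda>a s. G (Y a s)" D2 1 "ball 0 \<delta>" 0] I(1) hol2 D2 D2m \<delta>(1)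
        by (auto simp: islimpt_ball)

      \<comment> \<open>Equal to \<open>Y a s - ((1 + \<i> * \<theta>) / 2) *s E a s\<close>,
        written as a line in \<open>\<theta>\<close> for \<open>holo_along_line\<close>. For real
        \<open>\<theta>\<close> the coefficient and its conjugate add up to \<open>1\<close>, so the
        cross terms cancel the products of the \<open>Y a s\<close>; the products of the
        \<open>E a s\<close> are zero anyway.\<close>
      define X where "X a \<theta> = (Y a s - (1/2) *s E a s) + \<theta> *s ((- \<i>/2) *s E a s)" for a \<theta>
      have Xeq: "X a \<theta> = Y a s - ((1 + \<i> * \<theta>) / 2) *s E a s" for a \<theta>
        by (simp add: X_def vec_eq_iff algebra_simps)
      have Xball: "X a \<theta> \<in> ball p R" if "a \<in> I" "cmod \<theta> < 2" for a \<theta>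
      proof -
        have "cmod (1 + \<i> * \<theta>) \<le> 1 + cmod \<theta>" using norm_triangle_ineq[of 1 "\<i> * \<theta>"] by (simp add: norm_mult)
        then have "norm (((1 + \<i> * \<theta>) / 2) *s E a s) \<le> 2 * norm (E a s)"
          unfolding norm_cscale using that by (intro mult_right_mono) (auto simp: norm_divide)
        moreover have "norm (X a \<theta> - p) \<le> norm (Y a s - p) + norm (((1 + \<i> * \<theta>) / 2) *s E a s)"
          unfolding Xeq using norm_triangle_ineq4[of "Y a s - p" "((1 + \<i> * \<theta>) / 2) *s E a s"]
          by (simp add: algebra_simps)
        moreover have "norm (Y a s - p) + 2 * norm (E a s) < R"
          using \<delta>(2)[of s a] s(1) that by (simp add: dist_commute)
        ultimately have "norm (X a \<theta> - p) < R" by linarith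
        then show ?thesis by (simp add: dist_norm norm_minus_commute)
      qed
      have EY: "hform \<sigma> (E a s) (Y a' s) = hform \<sigma> (Y a s) (Y a' s)" if "a' \<in> I" for a a'
      proof -
        have me: "hform \<sigma> (m j s) (e' k) = (if j = k then 1 else 0)" if "j \<in> ?P" "k \<in> ?P" for j k
          using that by (simp add: m_def hform_lin de' ee)
        have em: "hform \<sigma> (e' k) (m j s) = (if j = k then 1 else 0)" if "j \<in> ?P" "k \<in> ?P" for j k
          using me[OF that] hform_cnj[of \<sigma> "m j s" "e' k"] by (auto split: if_splits)
        have "hform \<sigma> (e' k) (Y a' s) = cnj (hform \<sigma> (y a') (e' k))" if "k \<in> ?P" for k
          unfolding Ym[OF \<open>a' \<in> I\<close>] hform_sum_right hform_scale_right using that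
          by (simp add: em if_distrib cong: if_cong)
        then show ?thesis unfolding E_def hform_sum_left hform_scale_left
          unfolding Ym[OF \<open>a' \<in> I\<close>] hform_sum_right hform_scale_right
          by (simp add: mult.commute)
      qed
      have YE: "hform \<sigma> (Y a s) (E a' s) = hform \<sigma> (Y a s) (Y a' s)" if "a \<in> I" for a a'
        by (metis EY[OF that, of a'] hform_cnj)
      have EE: "hform \<sigma> (E a s) (E a' s) = 0" for a a'
        unfolding E_def hform_sum_left hform_sum_right
        by (intro sum.neutral ballI) (simp add: hform_lin e')
      have Xnull: "hform \<sigma> (X a \<theta>) (X a' \<theta>) = 0" if "a \<in> I" "a' \<in> I" "cnj \<theta> = \<theta>" for a a' \<theta>
        unfolding Xeq hform_lin EY[OF that(2)] YE[OF that(1)] EE using that(3) by (simp add: field_simps)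
      have hol3: "(\<lambda>\<theta>. G (X a \<theta>) $ j) holomorphic_on ball 0 2" if "a \<in> I" for a j
        unfolding X_def by (rule holo_along_line[where W = "ball p R"])
          (use hol Xball[OF that] in \<open>auto simp: X_def\<close>)
      have sub2: "complex_of_real ` {-1<..<1} \<subseteq> ball 0 2" by auto
      have "cindep I (\<lambda>a. G (X a \<i>))" using s(2) by (simp add: Xeq)
      then obtain \<theta> where \<theta>: "\<theta> \<in> complex_of_real ` {-1<..<1}" "cindep I (\<lambda>a. G (X a \<theta>))"
        using cindep_propagates[of I "\<lambda>a \<theta>. G (X a \<theta>)" "ball 0 2" \<i> "complex_of_real ` {-1<..<1}" 0]
          I(1) hol3 reals_islimpt_0[of 1] sub2 by auto
      have "cnj \<theta> = \<theta>" "cmod \<theta> < 2" using \<theta>(1) by auto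
      then have "hform \<tau> (G (X a \<theta>)) (G (X a' \<theta>)) = 0" if "a \<in> I" "a' \<in> I" for a a'
        using that by (intro orth Xball Xnull)
      then have "card I \<le> card {j. \<tau> j = 1}"
        by (intro null_family_card[OF \<tau> I(1) \<theta>(2)]) (auto simp: rad)
      with I(2) show False by simp
    qed
  qed
qed

section \<open>Local rigidity\<close>

lemma two_equations:
  fixes a b a' b' c c' :: complex
  assumes "c * a + c' * b = 0" "c * a' + c' * b' = 0" "a * b' - b * a' \<noteq> 0"
  shows "c = 0" "c' = 0"
proof -
  have "c * (a * b' - b * a') = (c * a + c' * b) * b' - (c * a' + c' * b') * b" by (simp add: algebra_simps)
  then show "c = 0" using assms by simp
  have "c' * (a * b' - b * a') = (c * a' + c' * b') * a - (c * a + c' * b) * a'" by (simp add: algebra_simps)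
  then show "c' = 0" using assms by simp
qed

text \<open>Each step adjoins to \<open>Y\<close> a direction \<open>y\<close> on which the functionals of \<open>u\<close>, \<open>u'\<close> are
  independent; \<open>u\<close>, \<open>u'\<close> are then moved slightly so as to become orthogonal to \<open>y\<close> as well, which
  makes their functionals vanish at the points found so far. The resulting system is block
  triangular with invertible \<open>2 \<times> 2\<close> blocks.\<close>

lemma independent_chain:
  fixes ga gb :: "complex^'n::finite \<Rightarrow> complex^'m::finite" and v :: "complex^'n \<Rightarrow> complex^'m"
    and \<sigma> :: "'n \<Rightarrow> real" and \<tau> :: "'m \<Rightarrow> real"
  defines "F \<equiv> \<lambda>y u u'. hform \<tau> (ga y) (v u) * hform \<tau> (gb y) (v u')
                      - hform \<tau> (gb y) (v u) * hform \<tau> (ga y) (v u')"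
  assumes \<sigma>: "\<And>i. \<sigma> i \<noteq> 0"
    and D: "open D" "convex D" "0 \<in> D" and Z: "vec.subspace Z"
    and hol: "\<And>j. line_holo (\<lambda>y. ga y $ j) D" "\<And>j. line_holo (\<lambda>y. gb y $ j) D"
    and U: "open U" "continuous_on U v"
    and vanish: "\<And>y u. y \<in> Z \<Longrightarrow> y \<in> D \<Longrightarrow> u \<in> U \<Longrightarrow> hform \<sigma> y u = 0 \<Longrightarrow>
        (\<And>w. w \<in> Y0 \<Longrightarrow> hform \<sigma> w u = 0) \<Longrightarrow> hform \<tau> (ga y) (v u) = 0 \<and> hform \<tau> (gb y) (v u) = 0"
  shows "vec.subspace Y \<Longrightarrow> Y0 \<subseteq> Y \<Longrightarrow> u \<in> U \<Longrightarrow> u' \<in> U \<Longrightarrow>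
      (\<And>w. w \<in> Y \<Longrightarrow> hform \<sigma> w u = 0 \<and> hform \<sigma> w u' = 0) \<Longrightarrow> y1 \<in> Z \<inter> D \<Longrightarrow> F y1 u u' \<noteq> 0 \<Longrightarrow>
      vec.dim Y + k + 2 \<le> vec.dim Z \<Longrightarrow>
      \<exists>Y' ys. vec.subspace Y' \<and> Y \<subseteq> Y' \<and> vec.dim Y' \<le> vec.dim Y + k \<and> (\<forall>i<k. ys i \<in> Z \<inter> D \<inter> Y') \<and>
        (\<forall>c c' v0. (\<forall>w\<in>U. (\<forall>z\<in>Y. hform \<sigma> z w = 0) \<longrightarrow> hform \<tau> v0 (v w) = 0) \<longrightarrow>
           (\<Sum>i<k. c i *s ga (ys i) + c' i *s gb (ys i)) + v0 = 0 \<longrightarrow> (\<forall>i<k. c i = 0 \<and> c' i = 0))"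
proof (induction k arbitrary: Y u u')
  case 0
  show ?case by (rule exI[of _ Y]) (use 0 in simp)
next
  case (Suc k)
  note Y = Suc.prems(1,2) and u = Suc.prems(3-5) and y1 = Suc.prems(6) and Fy1 = Suc.prems(7)
  let ?K = "Z \<inter> {y. hform \<sigma> y u = 0} \<inter> {y. hform \<sigma> y u' = 0}"
  have "vec.dim Z \<le> vec.dim (Z \<inter> {y. hform \<sigma> y u = 0}) + 1" by (rule dim_Int_kernel[OF Z])
  also have "vec.dim (Z \<inter> {y. hform \<sigma> y u = 0}) \<le> vec.dim ?K + 1"
    by (rule dim_Int_kernel[OF vec.subspace_inter[OF Z subspace_kernel]])
  \<comment> \<open>The \<open>+ 2\<close> in the dimension bound pays for the two functionals, so
    their common kernel still contains a direction outside \<open>Y\<close>.\<close>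
  finally have "vec.dim Y < vec.dim ?K" using Suc.prems(8) by simp
  then have "\<not> ?K \<subseteq> Y" using vec.dim_subset linorder_not_le by blast
  then obtain x where x: "x \<in> Z" "hform \<sigma> x u = 0" "hform \<sigma> x u' = 0" "x \<notin> Y" by blast
  have "open {t. 0 + t *s x \<in> D}" by (rule open_line[OF D(1)])
  then obtain \<epsilon> where \<epsilon>: "\<epsilon> > 0" "ball 0 \<epsilon> \<subseteq> {t. 0 + t *s x \<in> D}"
    using openE[of "{t. 0 + t *s x \<in> D}" 0] D(3) by auto
  define r where "r = complex_of_real (\<epsilon> / 2)"
  have r: "r \<noteq> 0" "r \<in> ball 0 \<epsilon>" using \<epsilon>(1) by (auto simp: r_def)
  define y0 where "y0 = r *s x"
  have y0: "y0 \<in> D" "y0 \<in> Z" "hform \<sigma> y0 u = 0" "hform \<sigma> y0 u' = 0"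
    using r \<epsilon>(2) x Z by (auto simp: y0_def hform_lin vec.subspace_scale)
  have "x = (1 / r) *s y0" using r by (simp add: y0_def vec_eq_iff)
  then have y0Y: "y0 \<notin> Y" using x(4) Y(1) vec.subspace_scale by metis
  obtain e where e: "\<And>z. z \<in> Y \<Longrightarrow> hform \<sigma> e z = 0" "hform \<sigma> e y0 \<noteq> 0"
    using hform_separation[where \<sigma> = \<sigma>, OF Y(1) y0Y \<sigma>] by blast
  \<comment> \<open>At \<open>y0\<close> the \<open>2 \<times> 2\<close> block is zero; a small move
    towards \<open>y1\<close> makes it invertible. The correction \<open>w\<close> restores
    orthogonality to the moved point and is small, since \<open>u\<close> and \<open>u'\<close> are
    orthogonal to \<open>y0\<close>; it runs along \<open>e\<close> and so keeps orthogonality to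
    \<open>Y\<close>.\<close>
  define yt where "yt t = y0 + t *s (y1 - y0)" for t
  define w where "w x t = x - (hform \<sigma> x (yt t) / hform \<sigma> e (yt t)) *s e" for x t
  have cyt: "isCont yt 0" unfolding yt_def by (intro continuous_intros)
  have yt0: "yt 0 = y0" by (simp add: yt_def)
  have cw: "isCont (w x) 0" for x
    unfolding w_def by (intro continuous_intros cyt) (simp add: yt0 e)
  have w0: "w u 0 = u" "w u' 0 = u'"
    using y0(3,4) by (simp_all add: w_def yt0 hform_eq_0_commute[of \<sigma> u] hform_eq_0_commute[of \<sigma> u'])
  have "eventually (\<lambda>t. hform \<sigma> e (yt t) \<noteq> 0) (nhds 0)"
    by (rule isCont_eventually_nonzero) (auto simp: yt0 e intro!: continuous_intros cyt)
  moreover have "eventually (\<lambda>t. w u t \<in> U) (nhds 0)" "eventually (\<lambda>t. w u' t \<in> U) (nhds 0)"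
    using topological_tendstoD[OF cw[unfolded isCont_def tendsto_at_iff_tendsto_nhds] U(1)] w0 u(1,2) by auto
  moreover have "eventually (\<lambda>t. F y1 (w u t) (w u' t) \<noteq> 0) (nhds 0)"
  proof (rule isCont_eventually_nonzero)
    have cv: "isCont v z" if "z \<in> U" for z using U that continuous_on_eq_continuous_at by blast
    have "isCont (\<lambda>t. v (w u t)) 0" "isCont (\<lambda>t. v (w u' t)) 0"
      by (rule isCont_o2[OF cw], simp add: w0 cv u)+
    then show "isCont (\<lambda>t. F y1 (w u t) (w u' t)) 0" unfolding F_def by (intro continuous_intros)
    show "F y1 (w u 0) (w u' 0) \<noteq> 0" unfolding w0 by (rule Fy1)
  qed
  ultimately have "eventually (\<lambda>t. hform \<sigma> e (yt t) \<noteq> 0 \<and> w u t \<in> U \<and> w u' t \<in> U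
      \<and> F y1 (w u t) (w u' t) \<noteq> 0) (nhds 0)" by eventually_elim auto
  then obtain \<delta> where \<delta>: "\<delta> > 0" "\<And>t. dist t 0 < \<delta> \<Longrightarrow> hform \<sigma> e (yt t) \<noteq> 0 \<and> w u t \<in> U \<and> w u' t \<in> U
      \<and> F y1 (w u t) (w u' t) \<noteq> 0"
    unfolding eventually_nhds_metric by blast
  have "line_holo (\<lambda>y. F y u u') D" unfolding F_def by (intro line_holo_intros hol)
  then obtain t where t: "cmod t < \<delta>" "yt t \<in> D" "F (yt t) u u' \<noteq> 0"
    unfolding yt_def
    using line_holo_nonzero_near[OF D(1,2), of "\<lambda>y. F y u u'" y0 y1 \<delta>] y0(1) y1 Fy1 \<delta>(1) by blast
  define y where "y = yt t"
  have yZ: "y \<in> Z" "y \<in> D" using t(2) y0(2) y1 Z unfolding y_def yt_def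
    by (auto intro!: vec.subspace_add vec.subspace_scale vec.subspace_diff)
  have wU: "w u t \<in> U" "w u' t \<in> U" and Fw: "F y1 (w u t) (w u' t) \<noteq> 0" and ey: "hform \<sigma> e y \<noteq> 0"
    using \<delta>(2)[of t] t(1) by (auto simp: y_def)
  define Y1 where "Y1 = vec.span (insert y Y)"
  have Y1: "vec.subspace Y1" "Y \<subseteq> Y1" "y \<in> Y1" "vec.dim Y1 \<le> vec.dim Y + 1"
    unfolding Y1_def using vec.dim_insert[of y Y] by (auto intro: vec.span_base)
  have wort: "hform \<sigma> (w x t) y = 0" for x using ey by (simp add: w_def hform_lin y_def)
  have wY: "hform \<sigma> (w x t) z = 0" if "z \<in> Y" "hform \<sigma> z x = 0" for z x
    using that e(1) by (simp add: w_def hform_lin hform_eq_0_commute[of \<sigma> x])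
  have orthY1: "Y1 \<subseteq> {z. hform \<sigma> (w x t) z = 0}" if "\<And>z. z \<in> Y \<Longrightarrow> hform \<sigma> z x = 0" for x
    unfolding Y1_def by (rule vec.span_minimal[OF _ subspace_kernel_right]) (use wort wY that in auto)
  have "\<exists>Y' ys. vec.subspace Y' \<and> Y1 \<subseteq> Y' \<and> vec.dim Y' \<le> vec.dim Y1 + k \<and> (\<forall>i<k. ys i \<in> Z \<inter> D \<inter> Y') \<and>
        (\<forall>c c' v0. (\<forall>w\<in>U. (\<forall>z\<in>Y1. hform \<sigma> z w = 0) \<longrightarrow> hform \<tau> v0 (v w) = 0) \<longrightarrow>
           (\<Sum>i<k. c i *s ga (ys i) + c' i *s gb (ys i)) + v0 = 0 \<longrightarrow> (\<forall>i<k. c i = 0 \<and> c' i = 0))"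
  \<comment> \<open>By continuity of \<open>v\<close>, the point \<open>y1\<close> still witnesses
    independence for the corrected pair.\<close>
  proof (rule Suc.IH[OF Y1(1) _ wU _ y1 Fw])
    show "Y0 \<subseteq> Y1" using Y(2) Y1(2) by blast
    show "hform \<sigma> z (w u t) = 0 \<and> hform \<sigma> z (w u' t) = 0" if "z \<in> Y1" for z
      using orthY1[of u] orthY1[of u'] u(3) that hform_eq_0_commute[of \<sigma> z] by blast
    show "vec.dim Y1 + k + 2 \<le> vec.dim Z" using Y1(4) Suc.prems(8) by simp
  qed
  then obtain Y' ys where Y': "vec.subspace Y'" "Y1 \<subseteq> Y'" "vec.dim Y' \<le> vec.dim Y1 + k"
    "\<And>i. i < k \<Longrightarrow> ys i \<in> Z \<inter> D \<inter> Y'"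
    and indep: "\<And>c c' v0. (\<forall>w\<in>U. (\<forall>z\<in>Y1. hform \<sigma> z w = 0) \<longrightarrow> hform \<tau> v0 (v w) = 0) \<Longrightarrow>
           (\<Sum>i<k. c i *s ga (ys i) + c' i *s gb (ys i)) + v0 = 0 \<Longrightarrow> (\<forall>i<k. c i = 0 \<and> c' i = 0)"
    by blast
  let ?ys = "ys(k := y)"
  show ?case
  proof (intro exI[of _ Y'] exI[of _ ?ys] conjI allI impI)
    show "vec.subspace Y'" "Y \<subseteq> Y'" by (use Y' Y1 in auto)
    show "vec.dim Y' \<le> vec.dim Y + Suc k" using Y'(3) Y1(4) by simp
    show "?ys i \<in> Z \<inter> D \<inter> Y'" if "i < Suc k" for i
      using that Y' Y1 yZ by (cases "i = k") auto
  next
    fix c c' :: "nat \<Rightarrow> complex" and v0 i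
    assume v0: "\<forall>w\<in>U. (\<forall>z\<in>Y. hform \<sigma> z w = 0) \<longrightarrow> hform \<tau> v0 (v w) = 0"
      and sum0: "(\<Sum>i<Suc k. c i *s ga (?ys i) + c' i *s gb (?ys i)) + v0 = 0"
    \<comment> \<open>The terms at \<open>y\<close> together with \<open>v0\<close> act as the
      \<open>v0\<close> of the induction hypothesis: their products with \<open>v x\<close> vanish
      for every \<open>x\<close> in \<open>U\<close> orthogonal to \<open>Y1\<close>.\<close>
    have *: "(\<Sum>i<k. c i *s ga (ys i) + c' i *s gb (ys i)) + (c k *s ga y + c' k *s gb y + v0) = 0"
      using sum0 by (simp add: add.assoc)
    have "\<forall>i<k. c i = 0 \<and> c' i = 0"
    proof (rule indep[OF _ *], intro ballI impI)
      fix x assume x: "x \<in> U" "\<forall>z\<in>Y1. hform \<sigma> z x = 0"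
      then have "hform \<tau> (ga y) (v x) = 0 \<and> hform \<tau> (gb y) (v x) = 0"
        using vanish[OF yZ x(1)] Y1 Y(2) by blast
      moreover have "hform \<tau> v0 (v x) = 0" using v0 x Y1(2) by blast
      ultimately show "hform \<tau> (c k *s ga y + c' k *s gb y + v0) (v x) = 0" by (simp add: hform_lin)
    qed
    moreover from this have z: "c k *s ga y + c' k *s gb y + v0 = 0" using * by simp
    have "c k * hform \<tau> (ga y) (v x) + c' k * hform \<tau> (gb y) (v x) = 0" if "x = u \<or> x = u'" for x
    proof -
      have "hform \<tau> v0 (v x) = 0" using v0 u that by blast
      moreover have "hform \<tau> (c k *s ga y + c' k *s gb y + v0) (v x) = 0" unfolding z by simp
      ultimately show ?thesis by (simp add: hform_lin)
    qed
    then have "c k = 0" "c' k = 0"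
      using two_equations[of "c k" "hform \<tau> (ga y) (v u)" "c' k" "hform \<tau> (gb y) (v u)"
        "hform \<tau> (ga y) (v u')" "hform \<tau> (gb y) (v u')"] t(3) unfolding F_def y_def by blast+
    ultimately show "i < Suc k \<Longrightarrow> c i = 0" "i < Suc k \<Longrightarrow> c' i = 0" by (auto simp: less_Suc_eq)
  qed
qed

text \<open>The properties of the lift on which local rigidity rests. In \<open>rank\<close>, the
  bound \<open>2 * r \<le> card I + 1\<close> says that there are at least \<open>2 * r - 1\<close>
  points. The domain is a parameter so that a smaller ball can be substituted later.\<close>

locale orthogonal_map =
  fixes \<sigma> :: "'n::finite \<Rightarrow> real" and \<tau> :: "'m::finite \<Rightarrow> real"
    and G :: "complex^'n \<Rightarrow> complex^'m" and W :: "(complex^'n) set" and r :: nat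
  assumes signs: "\<And>i. \<sigma> i = 1 \<or> \<sigma> i = -1"
    and W: "open W" "convex W"
    and hol: "\<And>z. z \<in> W \<Longrightarrow> cholo_at G z"
    and hom: "\<And>z c. z \<in> W \<Longrightarrow> c \<noteq> 0 \<Longrightarrow> c *s z \<in> W \<Longrightarrow> G (c *s z) = G z"
    and orth: "\<And>z w. z \<in> W \<Longrightarrow> w \<in> W \<Longrightarrow> hform \<sigma> z w = 0 \<Longrightarrow> hform \<tau> (G z) (G w) = 0"
    and rank: "\<And>A z (I :: nat set). vec.dim A \<le> r \<Longrightarrow> finite I \<Longrightarrow> 2 * r \<le> card I + 1 \<Longrightarrow>
       (\<And>a. a \<in> I \<Longrightarrow> z a \<in> A \<inter> W) \<Longrightarrow> \<not> cindep I (\<lambda>a. G (z a))"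
    and dims: "2 \<le> r" "r + 2 \<le> CARD('n)"
begin

abbreviation \<Phi> :: "complex^'n \<Rightarrow> complex^'n \<Rightarrow> complex" where
  "\<Phi> z w \<equiv> hform \<tau> (G z) (G w)"

lemma \<sigma>0: "\<sigma> i \<noteq> 0" using signs[of i] by auto

lemma continuous_G: "continuous_on W G"
  by (intro continuous_at_imp_continuous_on ballI cholo_isCont hol)

lemma isCont_G: "z \<in> W \<Longrightarrow> isCont G z" using hol cholo_isCont by blast

lemma line_holo_G: "line_holo (\<lambda>z. G z $ j) W" by (rule line_holo_cholo[OF hol])

lemma affine_domain:
  "open {y. x + a *s y \<in> W}" "convex {y. x + a *s y \<in> W}"
  "line_holo (\<lambda>y. G (x + a *s y) $ j) {y. x + a *s y \<in> W}"
proof -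
  have "open ((\<lambda>y. x + a *s y) -` W)" by (rule open_vimage[OF W(1)]) (intro continuous_intros)
  then show "open {y. x + a *s y \<in> W}" by (simp add: vimage_def)
  show "convex {y. x + a *s y \<in> W}"
  proof (rule convexI)
    fix y z and s t :: real
    assume h: "y \<in> {y. x + a *s y \<in> W}" "z \<in> {y. x + a *s y \<in> W}" "0 \<le> s" "0 \<le> t" "s + t = 1"
    then have "s *\<^sub>R (x + a *s y) + t *\<^sub>R (x + a *s z) \<in> W" using W(2) by (auto intro: convexD)
    moreover have t: "t = 1 - s" using h by simp
    have "s *\<^sub>R (x + a *s y) + t *\<^sub>R (x + a *s z) = x + a *s (s *\<^sub>R y + t *\<^sub>R z)" unfolding t
      by (simp add: vec_eq_iff) (simp add: scaleR_conv_of_real algebra_simps)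
    ultimately show "s *\<^sub>R y + t *\<^sub>R z \<in> {y. x + a *s y \<in> W}" by simp
  qed
  show "line_holo (\<lambda>y. G (x + a *s y) $ j) {y. x + a *s y \<in> W}"
    unfolding line_holo_def
  proof (intro ballI allI)
    fix z v assume "z \<in> {y. x + a *s y \<in> W}"
    then have "(\<lambda>t. G ((x + a *s z) + t *s (a *s v)) $ j) field_differentiable at 0"
      using line_holo_G unfolding line_holo_def by blast
    then show "(\<lambda>t. G (x + a *s (z + t *s v)) $ j) field_differentiable at 0"
      by (simp add: vec.scale_right_distrib vector_smult_assoc mult.commute add.assoc)
  qed
qed

text \<open>\<open>x\<close> and the points \<open>x + a *s ys i\<close>,
  \<open>x + b *s ys i\<close> are \<open>2 * (r - 1) + 1\<close> points of a space of dimension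
  \<open>r\<close>. The premise says nothing about the coefficient of \<open>G x\<close>; that one
  vanishes because \<open>G x\<close> is nonzero.\<close>

lemma chain_contradiction:
  assumes x: "x \<in> W" "G x \<noteq> 0" and k: "k = r - 1" and A: "vec.subspace A" "vec.dim A \<le> r" "x \<in> A"
    and ys: "\<And>i. i < k \<Longrightarrow> ys i \<in> A \<and> x + a *s ys i \<in> W \<and> x + b *s ys i \<in> W"
    and ind: "\<And>c c' d. (\<Sum>i<k. c i *s G (x + a *s ys i) + c' i *s G (x + b *s ys i)) + d *s G x = 0
      \<Longrightarrow> \<forall>i<k. c i = 0 \<and> c' i = 0"
  shows False
proof -
  define z where "z i = (if i < k then x + a *s ys i else if i < 2 * k then x + b *s ys (i - k) else x)" for i
  have "cindep {..<2 * k + 1} (\<lambda>i. G (z i))"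
    unfolding cindep_def
  proof (intro allI impI)
    fix c assume c: "(\<Sum>i<2 * k + 1. c i *s G (z i)) = 0"
    have "(\<Sum>i<2 * k. c i *s G (z i)) = (\<Sum>i<k. c i *s G (z i)) + (\<Sum>i=k..<2*k. c i *s G (z i))"
      using sum.atLeastLessThan_concat[of 0 k "2 * k" "\<lambda>i. c i *s G (z i)"]
      by (simp add: atLeast0LessThan)
    also have "(\<Sum>i=k..<2*k. c i *s G (z i)) = (\<Sum>i<k. c (i + k) *s G (z (i + k)))"
      using sum.shift_bounds_nat_ivl[of "\<lambda>i. c i *s G (z i)" 0 k k]
      by (simp add: mult_2 atLeast0LessThan)
    finally have "(\<Sum>i<k. c i *s G (x + a *s ys i) + c (i + k) *s G (x + b *s ys i)) + c (2 * k) *s G x = 0"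
      using c by (simp add: sum.distrib z_def)
    then have *: "\<forall>i<k. c i = 0 \<and> c (i + k) = 0" and
      "(\<Sum>i<k. c i *s G (x + a *s ys i) + c (i + k) *s G (x + b *s ys i)) + c (2 * k) *s G x = 0"
      using ind[of c "\<lambda>i. c (i + k)" "c (2 * k)"] by blast+
    then have "c (2 * k) *s G x = 0" by simp
    then have "c (2 * k) = 0" using x(2) by simp
    moreover have "c i = 0" if "i < 2 * k" for i
      using *[rule_format, of i] *[rule_format, of "i - k"] that by (cases "i < k") auto
    ultimately show "\<forall>i\<in>{..<2 * k + 1}. c i = 0" by (metis Suc_eq_plus1 lessThan_iff less_Suc_eq)
  qed
  moreover have "z i \<in> A \<inter> W" if "i \<in> {..<2 * k + 1}" for i
    using ys[of i] ys[of "i - k"] x A that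
    by (auto simp: z_def intro!: vec.subspace_add vec.subspace_scale)
  moreover have "2 * r \<le> card {..<2 * k + 1} + 1" unfolding card_lessThan using k dims(1) by arith
  ultimately show False using rank[OF A(2), of "{..<2 * k + 1}" z] by blast
qed

text \<open>The first chain. Vectors orthogonal to \<open>x\<close> and \<open>y\<close> are
  orthogonal to every \<open>x + a *s y\<close>, so \<open>independent_chain\<close> applies from
  the span of \<open>x\<close> once the ratios differ at two points of a line through
  \<open>x\<close>. There \<open>d *s G x\<close> takes the role of \<open>v0\<close>.\<close>

lemma collinear_proportional:
  assumes x: "x \<in> W" "G x \<noteq> 0" and u: "u \<in> W" "u' \<in> W" "hform \<sigma> x u = 0" "hform \<sigma> x u' = 0"
    and y: "x + a *s y \<in> W" "x + b *s y \<in> W"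
  shows "\<Phi> (x + a *s y) u * \<Phi> (x + b *s y) u' = \<Phi> (x + b *s y) u * \<Phi> (x + a *s y) u'"
proof (rule ccontr)
  assume F: "\<not> ?thesis"
  define ga gb where "ga = (\<lambda>y. G (x + a *s y))" and "gb = (\<lambda>y. G (x + b *s y))"
  define D where "D = {y. x + a *s y \<in> W} \<inter> {y. x + b *s y \<in> W}"
  define Y where "Y = vec.span {x}"
  have Y: "vec.subspace Y" "x \<in> Y" "vec.dim Y \<le> 1"
    unfolding Y_def by (auto simp: vec.span_base)
  have Yorth: "hform \<sigma> w u = 0" if "w \<in> Y" "hform \<sigma> x u = 0" for w u
    using that unfolding Y_def by (auto simp: vec.span_singleton hform_lin)
  have "\<exists>Y' ys. vec.subspace Y' \<and> Y \<subseteq> Y' \<and> vec.dim Y' \<le> vec.dim Y + (r - 1) \<and>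
      (\<forall>i<r - 1. ys i \<in> UNIV \<inter> D \<inter> Y') \<and>
        (\<forall>c c' v0. (\<forall>w\<in>W. (\<forall>z\<in>Y. hform \<sigma> z w = 0) \<longrightarrow> hform \<tau> v0 (G w) = 0) \<longrightarrow>
           (\<Sum>i<r - 1. c i *s ga (ys i) + c' i *s gb (ys i)) + v0 = 0 \<longrightarrow> (\<forall>i<r - 1. c i = 0 \<and> c' i = 0))"
  proof (rule independent_chain[where Z = UNIV and Y = Y and Y0 = "{x}" and U = W and D = D and ga = ga
        and gb = gb and \<sigma> = \<sigma> and \<tau> = \<tau> and v = G and u = u and u' = u' and ?y1.0 = y and k = "r - 1"])
    show "open D" "convex D" "0 \<in> D" unfolding D_def using affine_domain x(1)
      by (auto intro: convex_Int)
    show "line_holo (\<lambda>y. ga y $ j) D" "line_holo (\<lambda>y. gb y $ j) D" for j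
      unfolding ga_def gb_def D_def by (rule line_holo_subset[OF affine_domain(3)], blast)+
    show "hform \<tau> (ga y) (G u) = 0 \<and> hform \<tau> (gb y) (G u) = 0"
      if "y \<in> D" "u \<in> W" "hform \<sigma> y u = 0" "\<And>w. w \<in> {x} \<Longrightarrow> hform \<sigma> w u = 0" for y u
      unfolding ga_def gb_def using that by (auto simp: D_def hform_lin intro!: orth)
    show "hform \<tau> (ga y) (G u) * hform \<tau> (gb y) (G u') - hform \<tau> (gb y) (G u) * hform \<tau> (ga y) (G u') \<noteq> 0"
      using F unfolding ga_def gb_def by simp
    show "vec.dim Y + (r - 1) + 2 \<le> vec.dim (UNIV :: (complex^'n) set)"
      unfolding vec_dim_card using Y(3) dims by linarith
    show "y \<in> UNIV \<inter> D" using y by (simp add: D_def)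
  qed (use \<sigma>0 W continuous_G Y Yorth u in auto)
  then obtain Y' ys where Y': "vec.subspace Y'" "Y \<subseteq> Y'" "vec.dim Y' \<le> vec.dim Y + (r - 1)"
     "\<And>i. i < r - 1 \<Longrightarrow> ys i \<in> D \<inter> Y'" and
    ind: "\<And>c c' v0. (\<forall>w\<in>W. (\<forall>z\<in>Y. hform \<sigma> z w = 0) \<longrightarrow> hform \<tau> v0 (G w) = 0) \<Longrightarrow>
           (\<Sum>i<r - 1. c i *s ga (ys i) + c' i *s gb (ys i)) + v0 = 0 \<Longrightarrow> (\<forall>i<r - 1. c i = 0 \<and> c' i = 0)"
    by auto
  show False
  proof (rule chain_contradiction[OF x refl Y'(1)])
    show "vec.dim Y' \<le> r" using Y'(3) Y(3) dims by linarith
    show "x \<in> Y'" using Y'(2) Y(2) by blast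
    show "ys i \<in> Y' \<and> x + a *s ys i \<in> W \<and> x + b *s ys i \<in> W" if "i < r - 1" for i
      using Y'(4)[OF that] by (auto simp: D_def)
    show "\<forall>i<r - 1. c i = 0 \<and> c' i = 0"
      if "(\<Sum>i<r - 1. c i *s G (x + a *s ys i) + c' i *s G (x + b *s ys i)) + d *s G x = 0" for c c' d
    proof (rule ind[of "d *s G x"])
      show "\<forall>w\<in>W. (\<forall>z\<in>Y. hform \<sigma> z w = 0) \<longrightarrow> hform \<tau> (d *s G x) (G w) = 0"
        using Y(2) x(1) by (auto simp: hform_lin intro: orth)
    qed (use that in \<open>simp add: ga_def gb_def\<close>)
  qed
qed

text \<open>The ratio \<open>\<Phi> z u / \<Phi> z w\<close> is constant along directions orthogonal to \<open>u\<close> and \<open>w\<close>: the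
  points \<open>z\<close> and \<open>z + v\<close> are both joined to the same point by lines through the
  points \<open>X\<close> and \<open>X - ((1 - c)/c) v\<close> orthogonal to \<open>u\<close> and \<open>w\<close>.\<close>

lemma shift_proportional:
  fixes c :: real
  assumes c: "0 < c" "c < 1" and z: "z \<in> W" "z + v \<in> W" and uw: "u \<in> W" "w \<in> W"
    and X: "X \<in> W" "X - complex_of_real ((1 - c) / c) *s v \<in> W" "G X \<noteq> 0"
      "G (X - complex_of_real ((1 - c) / c) *s v) \<noteq> 0"
    and ort: "hform \<sigma> X u = 0" "hform \<sigma> X w = 0" "hform \<sigma> v u = 0" "hform \<sigma> v w = 0"
    and nz: "\<Phi> (complex_of_real (1 - c) *s z + complex_of_real c *s X) w \<noteq> 0"
  shows "\<Phi> z u * \<Phi> (z + v) w = \<Phi> (z + v) u * \<Phi> z w"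
proof -
  define z1 where "z1 = complex_of_real (1 - c) *s z + complex_of_real c *s X"
  define X' where "X' = X - complex_of_real ((1 - c) / c) *s v"
  have sc: "complex_of_real k *s x = k *\<^sub>R x" for k and x :: "complex^'n"
    by (simp add: vec_eq_iff scaleR_conv_of_real[symmetric])
  have z1W: "z1 \<in> W" unfolding z1_def sc using W(2) z(1) X(1) c by (auto intro: convexD)
  have e1: "X + 1 *s (z - X) = z" "X + complex_of_real (1 - c) *s (z - X) = z1"
    by (simp_all add: z1_def vec_eq_iff algebra_simps)
  have "\<Phi> z u * \<Phi> z1 w = \<Phi> z1 u * \<Phi> z w"
    using collinear_proportional[OF X(1,3) uw ort(1,2), of 1 "z - X" "complex_of_real (1 - c)"]
    unfolding e1 using z z1W by blast
  moreover have e2: "X' + 1 *s ((z + v) - X') = z + v" "X' + complex_of_real (1 - c) *s ((z + v) - X') = z1"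
  proof -
    show "X' + 1 *s ((z + v) - X') = z + v" by simp
    have "complex_of_real c *s X' = complex_of_real c *s X - complex_of_real (1 - c) *s v"
    proof -
      have "complex_of_real c * complex_of_real ((1 - c) / c) = complex_of_real (1 - c)"
        using c by (simp del: of_real_divide flip: of_real_mult)
      then show ?thesis unfolding X'_def vec.scale_right_diff_distrib vector_smult_assoc by (rule arg_cong)
    qed
    then show "X' + complex_of_real (1 - c) *s ((z + v) - X') = z1"
      unfolding z1_def by (simp add: vec_eq_iff algebra_simps)
  qed
  have "hform \<sigma> X' u = 0" "hform \<sigma> X' w = 0" by (simp_all add: X'_def hform_lin ort)
  then have "\<Phi> (z + v) u * \<Phi> z1 w = \<Phi> z1 u * \<Phi> (z + v) w"
    using collinear_proportional[OF X(2,4) uw, folded X'_def, of 1 "z + v - X'" "complex_of_real (1 - c)"]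
    unfolding e2 using z z1W by blast
  ultimately have "(\<Phi> z u * \<Phi> (z + v) w) * \<Phi> z1 w = (\<Phi> (z + v) u * \<Phi> z w) * \<Phi> z1 w"
    by (metis mult.assoc mult.commute)
  then show ?thesis using nz by (simp add: z1_def)
qed

text \<open>The second chain. Up to the factor \<open>\<Phi> x q * \<Phi> z q\<close>,
  \<open>\<Psi> z u\<close> is the increment of \<open>\<Phi> z u / \<Phi> z q\<close> from
  \<open>x\<close> to \<open>z\<close>; by \<open>shift\<close> it vanishes when
  \<open>z - x\<close> is orthogonal to \<open>u\<close> and \<open>q\<close>. So the chain runs
  inside the complement of \<open>q\<close> and starts from zero; \<open>x\<close> is adjoined only
  at the end.\<close>

lemma increments_proportional:
  assumes x: "x \<in> W" "\<Phi> x q \<noteq> 0" and q: "q \<in> W" and B: "ball x \<rho> \<subseteq> W" "\<rho> > 0"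
    and U: "open U" "U \<subseteq> W"
    and shift: "\<And>u z z'. u \<in> U \<Longrightarrow> z \<in> ball x \<rho> \<Longrightarrow> z' \<in> ball x \<rho> \<Longrightarrow> hform \<sigma> (z - z') u = 0 \<Longrightarrow>
      hform \<sigma> (z - z') q = 0 \<Longrightarrow> \<Phi> z u * \<Phi> z' q = \<Phi> z' u * \<Phi> z q"
    and u: "u \<in> U" "u' \<in> U" and y: "hform \<sigma> y q = 0" "x + a *s y \<in> ball x \<rho>" "x + b *s y \<in> ball x \<rho>"
  defines "\<Psi> \<equiv> \<lambda>z u. \<Phi> x q * \<Phi> z u - \<Phi> x u * \<Phi> z q"
  shows "\<Psi> (x + a *s y) u * \<Psi> (x + b *s y) u' = \<Psi> (x + b *s y) u * \<Psi> (x + a *s y) u'"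
proof (rule ccontr)
  assume F: "\<not> ?thesis"
  \<comment> \<open>Products with \<open>v u\<close> are the values of \<open>\<Psi>\<close>, and
    the one with \<open>G x\<close> is zero by construction, so \<open>G x\<close> can later stand
    for \<open>v0\<close>.\<close>
  define v where "v u = cnj (\<Phi> x q) *s G u - cnj (\<Phi> x u) *s G q" for u
  have v: "hform \<tau> (G z) (v u) = \<Psi> z u" for z u by (simp add: v_def \<Psi>_def hform_lin)
  define Z where "Z = {y. hform \<sigma> y q = 0}"
  have Z: "vec.subspace Z" unfolding Z_def by (rule subspace_kernel)
  have dimZ: "CARD('n) \<le> vec.dim Z + 1"
    using dim_Int_kernel[OF vec.subspace_UNIV, of \<sigma> q] unfolding vec_dim_card Z_def by simp
  \<comment> \<open>On the smaller ball all points of the chain are within reach of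
    \<open>shift\<close>.\<close>
  interpret B: orthogonal_map \<sigma> \<tau> G "ball x \<rho>" r
    by unfold_locales (use B signs hol hom orth rank dims in \<open>auto simp: subset_iff\<close>)
  define ga gb where "ga = (\<lambda>y. G (x + a *s y))" and "gb = (\<lambda>y. G (x + b *s y))"
  define D where "D = {y. x + a *s y \<in> ball x \<rho>} \<inter> {y. x + b *s y \<in> ball x \<rho>}"
  have xb: "x \<in> ball x \<rho>" using B by simp
  have van: "\<Psi> z u = 0" if "z \<in> ball x \<rho>" "u \<in> U" "hform \<sigma> (z - x) u = 0" "hform \<sigma> (z - x) q = 0" for z u
    using shift[OF that(2,1) xb that(3,4)] unfolding \<Psi>_def by (simp add: mult.commute)
  have "\<exists>Y' ys. vec.subspace Y' \<and> {0} \<subseteq> Y' \<and> vec.dim Y' \<le> vec.dim {0::complex^'n} + (r - 1) \<and>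
      (\<forall>i<r - 1. ys i \<in> Z \<inter> D \<inter> Y') \<and>
        (\<forall>c c' v0. (\<forall>w\<in>U. (\<forall>z\<in>{0}. hform \<sigma> z w = 0) \<longrightarrow> hform \<tau> v0 (v w) = 0) \<longrightarrow>
           (\<Sum>i<r - 1. c i *s ga (ys i) + c' i *s gb (ys i)) + v0 = 0 \<longrightarrow> (\<forall>i<r - 1. c i = 0 \<and> c' i = 0))"
  proof (rule independent_chain[where Z = Z and Y = "{0}" and Y0 = "{}" and U = U and D = D and ga = ga
        and gb = gb and \<sigma> = \<sigma> and \<tau> = \<tau> and v = v and u = u and u' = u' and ?y1.0 = y and k = "r - 1"])
    show "open D" "convex D" "0 \<in> D" unfolding D_def using B.affine_domain xb
      by (auto intro: convex_Int)
    show "line_holo (\<lambda>y. ga y $ j) D" "line_holo (\<lambda>y. gb y $ j) D" for j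
      unfolding ga_def gb_def D_def by (rule line_holo_subset[OF B.affine_domain(3)], blast)+
    show "hform \<tau> (ga y) (v u) = 0 \<and> hform \<tau> (gb y) (v u) = 0"
      if "y \<in> Z" "y \<in> D" "u \<in> U" "hform \<sigma> y u = 0" for y u
      unfolding ga_def gb_def v using that by (auto simp: D_def Z_def hform_lin intro!: van)
    show "hform \<tau> (ga y) (v u) * hform \<tau> (gb y) (v u') - hform \<tau> (gb y) (v u) * hform \<tau> (ga y) (v u') \<noteq> 0"
      using F unfolding ga_def gb_def v by simp
    show "vec.dim {0::complex^'n} + (r - 1) + 2 \<le> vec.dim Z" using dimZ dims by simp
    show "y \<in> Z \<inter> D" using y by (simp add: D_def Z_def)
    have "continuous_on U G" using continuous_G U(2) continuous_on_subset by blast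
    then show "continuous_on U v" unfolding v_def by (intro continuous_intros)
  qed (use \<sigma>0 U Z u in \<open>auto simp: vec.subspace_single_0\<close>)
  then obtain Y' ys where Y': "vec.subspace Y'" "vec.dim Y' \<le> r - 1"
     "\<And>i. i < r - 1 \<Longrightarrow> ys i \<in> D \<inter> Y'" and
    ind: "\<And>c c' v0. (\<forall>w\<in>U. hform \<tau> v0 (v w) = 0) \<Longrightarrow>
           (\<Sum>i<r - 1. c i *s ga (ys i) + c' i *s gb (ys i)) + v0 = 0 \<Longrightarrow> (\<forall>i<r - 1. c i = 0 \<and> c' i = 0)"
    by auto
  have Gx: "G x \<noteq> 0" using x(2) by auto
  show False
  proof (rule chain_contradiction[OF x(1) Gx refl, where A = "vec.span (insert x Y')"])
    show "vec.dim (vec.span (insert x Y')) \<le> r" using Y'(2) dims vec.dim_insert[of x Y'] by auto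
    show "ys i \<in> vec.span (insert x Y') \<and> x + a *s ys i \<in> W \<and> x + b *s ys i \<in> W" if "i < r - 1" for i
      using Y'(3)[OF that] B(1) by (auto simp: D_def intro: vec.span_base)
    show "\<forall>i<r - 1. c i = 0 \<and> c' i = 0"
      if "(\<Sum>i<r - 1. c i *s G (x + a *s ys i) + c' i *s G (x + b *s ys i)) + d *s G x = 0" for c c' d
    proof (rule ind[of "d *s G x"])
      show "\<forall>w\<in>U. hform \<tau> (d *s G x) (v w) = 0" by (simp add: hform_scale_left v) (simp add: \<Psi>_def)
    qed (use that in \<open>simp add: ga_def gb_def\<close>)
  qed (auto intro: vec.span_base)
qed

end

section \<open>From proportional increments to linear ratios\<close>

lemma eventually_nhds_0D:
  fixes P :: "complex \<Rightarrow> bool"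
  assumes "eventually P (nhds 0)" obtains \<epsilon> where "\<epsilon> > 0" "\<And>t. cmod t < \<epsilon> \<Longrightarrow> P t"
  using assms unfolding eventually_nhds_metric by (auto simp: dist_norm)

text \<open>The case \<open>\<alpha> = 1\<close> eliminates \<open>\<psi>\<close> and leaves
  \<open>\<phi> (\<alpha> * t) * \<phi> s0 = \<phi> (\<alpha> * s0) * \<phi> t\<close>.
  Differentiation at \<open>t = 0\<close> gives
  \<open>\<phi> (\<alpha> * s0) = \<alpha> * \<phi> s0\<close>.\<close>

lemma linear_from_proportionality:
  fixes \<phi> \<psi> :: "complex \<Rightarrow> complex"
  assumes d: "\<delta> > 0" and hol: "(\<phi> has_field_derivative \<phi>') (at 0)" "\<phi>' \<noteq> 0" "\<phi> 0 = 0"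
    and pr: "\<And>\<alpha> t s. cmod \<alpha> \<le> 1 \<Longrightarrow> cmod t < \<delta> \<Longrightarrow> cmod s < \<delta> \<Longrightarrow> \<phi> (\<alpha> * t) * \<psi> s = \<phi> (\<alpha> * s) * \<psi> t"
    and s0: "cmod s0 < \<delta>" "\<phi> s0 \<noteq> 0" "\<psi> s0 \<noteq> 0"
  shows "cmod s \<le> cmod s0 \<Longrightarrow> \<phi> s = (\<phi> s0 / s0) * s"
proof -
  assume s: "cmod s \<le> cmod s0"
  have s0nz: "s0 \<noteq> 0" using s0(2) hol(3) by auto
  define \<alpha> where "\<alpha> = s / s0"
  have \<alpha>: "cmod \<alpha> \<le> 1" "\<alpha> * s0 = s" using s s0nz by (auto simp: \<alpha>_def norm_divide divide_le_eq_1)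
  have eq: "\<phi> (\<alpha> * t) * \<phi> s0 = \<phi> s * \<phi> t" if "t \<in> ball 0 \<delta>" for t
  proof -
    have t: "cmod t < \<delta>" using that by simp
    have 1: "\<phi> (\<alpha> * t) * \<psi> s0 = \<phi> s * \<psi> t" using pr[OF \<alpha>(1) t s0(1)] \<alpha>(2) by simp
    have 2: "\<phi> t * \<psi> s0 = \<phi> s0 * \<psi> t" using pr[of 1 t s0] t s0(1) by simp
    have "\<phi> (\<alpha> * t) * \<phi> s0 * \<psi> s0 = \<phi> s * (\<phi> s0 * \<psi> t)" using 1 by (simp add: mult_ac)
    also have "\<dots> = \<phi> s * \<phi> t * \<psi> s0" unfolding 2[symmetric] by (simp add: mult_ac)
    finally show ?thesis using s0(3) by simp
  qed
  have "((\<lambda>t. \<phi> (\<alpha> * t) * \<phi> s0) has_field_derivative \<phi>' * \<alpha> * \<phi> s0) (at 0)"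
  proof -
    have "((\<lambda>t. \<alpha> * t) has_field_derivative \<alpha>) (at 0)" by (auto intro!: derivative_eq_intros)
    then have "((\<lambda>t. \<phi> (\<alpha> * t)) has_field_derivative \<phi>' * \<alpha>) (at 0)"
      using DERIV_chain2[of \<phi> \<phi>' "\<lambda>t. \<alpha> * t" 0 \<alpha>] hol(1) by simp
    then show ?thesis by (rule DERIV_cmult_right)
  qed
  moreover have "((\<lambda>t. \<phi> (\<alpha> * t) * \<phi> s0) has_field_derivative \<phi> s * \<phi>') (at 0)"
    by (rule has_field_derivative_transform_within_open[OF DERIV_cmult[OF hol(1)], of "ball 0 \<delta>"])
       (use d eq in auto)
  ultimately have "\<phi>' * \<alpha> * \<phi> s0 = \<phi> s * \<phi>'" by (rule DERIV_unique)
  then have "\<phi> s = \<alpha> * \<phi> s0" using hol(2) by simp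
  then show "\<phi> s = (\<phi> s0 / s0) * s" using s0nz by (simp add: \<alpha>_def)
qed

context orthogonal_map
begin

lemma line_holo_\<Phi>: "line_holo (\<lambda>z. \<Phi> z w) W"
  by (intro line_holo_intros line_holo_G)

lemma holo_\<Phi>_line: "(\<lambda>t. \<Phi> (z + t *s v) w) holomorphic_on {t. z + t *s v \<in> W}"
  by (rule line_holo_affine[OF line_holo_\<Phi>])

lemma isCont_\<Phi>_right: "u \<in> W \<Longrightarrow> isCont (\<lambda>u. \<Phi> z u) u"
  by (intro continuous_intros isCont_G)

lemma isCont_\<Phi>_left: "z \<in> W \<Longrightarrow> isCont (\<lambda>z. \<Phi> z u) z"
  by (intro continuous_intros isCont_G)

text \<open>Rescales points near \<open>x\<close> to the affine slice where the product with
  \<open>q\<close> is that of \<open>x\<close>. As \<open>G\<close> ignores the scale, relations can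
  be checked on the slice.\<close>

lemma slice_scaling:
  assumes x: "x \<in> W" "hform \<sigma> x q \<noteq> 0" and \<rho>: "\<rho> > 0"
  shows "eventually (\<lambda>z. z \<in> W \<and> hform \<sigma> z q \<noteq> 0 \<and> (hform \<sigma> x q / hform \<sigma> z q) *s z \<in> ball x \<rho>) (nhds x)"
proof -
  define f where "f z = (hform \<sigma> x q / hform \<sigma> z q) *s z" for z
  have "isCont f x" unfolding f_def using x by (intro continuous_intros)
  then have "(f \<longlongrightarrow> f x) (nhds x)" unfolding isCont_def tendsto_at_iff_tendsto_nhds .
  moreover have "f x = x" using x by (simp add: f_def)
  ultimately have "eventually (\<lambda>z. f z \<in> ball x \<rho>) (nhds x)"
    using topological_tendstoD[of f x "nhds x" "ball x \<rho>"] \<rho> by simp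
  then have "eventually (\<lambda>z. (hform \<sigma> x q / hform \<sigma> z q) *s z \<in> ball x \<rho>) (nhds x)"
    unfolding f_def .
  moreover have "eventually (\<lambda>z. hform \<sigma> z q \<noteq> 0) (nhds x)"
    by (rule isCont_eventually_nonzero) (use x in \<open>auto intro!: continuous_intros\<close>)
  moreover have "eventually (\<lambda>z. z \<in> W) (nhds x)" using W(1) x(1) by (rule eventually_nhds_in_open)
  ultimately show ?thesis by eventually_elim auto
qed

text \<open>A uniform version of \<open>shift_proportional\<close>: one radius serves all
  \<open>u\<close> in \<open>U\<close>, because the auxiliary points \<open>X\<close> for all
  \<open>u\<close> lie in one ball where \<open>G\<close> has no zeros.\<close>

lemma shift_near:
  assumes x: "x \<in> W" "\<Phi> x q \<noteq> 0" and q: "q \<in> W" and U: "U \<subseteq> W"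
    and X: "ball X1 \<rho>X \<subseteq> W" "\<rho>X > 0" "\<And>X. X \<in> ball X1 \<rho>X \<Longrightarrow> G X \<noteq> 0"
    and XU: "\<And>u. u \<in> U \<Longrightarrow> \<exists>X\<in>ball X1 (\<rho>X / 2). hform \<sigma> X u = 0 \<and> hform \<sigma> X q = 0"
  obtains \<rho> where "\<rho> > 0" "ball x \<rho> \<subseteq> W" "\<And>z. z \<in> ball x \<rho> \<Longrightarrow> \<Phi> z q \<noteq> 0"
    "\<And>u z z'. u \<in> U \<Longrightarrow> z \<in> ball x \<rho> \<Longrightarrow> z' \<in> ball x \<rho> \<Longrightarrow> hform \<sigma> (z - z') u = 0 \<Longrightarrow>
      hform \<sigma> (z - z') q = 0 \<Longrightarrow> \<Phi> z u * \<Phi> z' q = \<Phi> z' u * \<Phi> z q"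
proof -
  have "eventually (\<lambda>z. z \<in> W \<and> \<Phi> z q \<noteq> 0) (nhds x)"
    using isCont_eventually_nonzero[OF isCont_\<Phi>_left[OF x(1)] x(2)] eventually_nhds_in_open[OF W(1) x(1)]
    by eventually_elim auto
  then obtain \<rho>2 where \<rho>2: "\<rho>2 > 0" "\<And>z. dist z x < \<rho>2 \<Longrightarrow> z \<in> W \<and> \<Phi> z q \<noteq> 0"
    unfolding eventually_nhds_metric by blast
  define K where "K = norm (X1 - x) + \<rho>X"
  have K: "K > 0" using X(2) by (simp add: K_def add_nonneg_pos)
  \<comment> \<open>So small that \<open>(1 - c) z + c X\<close> stays within \<open>\<rho>2\<close>
    of \<open>x\<close>, where \<open>\<Phi> _ q\<close> is nonzero; \<open>K\<close> bounds the
    distance from \<open>X\<close> to \<open>x\<close>.\<close>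
  define c where "c = min (1/2) (\<rho>2 / (4 * K))"
  have c: "0 < c" "c < 1" "c * K \<le> \<rho>2 / 4"
  proof -
    show "0 < c" "c < 1" using \<rho>2(1) K by (auto simp: c_def)
    have "c * K \<le> (\<rho>2 / (4 * K)) * K" using K by (intro mult_right_mono) (auto simp: c_def)
    then show "c * K \<le> \<rho>2 / 4" using K by simp
  qed
  \<comment> \<open>The second auxiliary point differs from \<open>X\<close> by
    \<open>(1 - c) / c\<close> times \<open>z' - z\<close>; the factor \<open>c\<close> in the
    radius keeps this below \<open>\<rho>X / 2\<close>.\<close>
  define \<rho> where "\<rho> = min (\<rho>2 / 2) (c * \<rho>X / 4)"
  show thesis
  proof (rule that[of \<rho>])
    show "\<rho> > 0" using \<rho>2(1) c X(2) by (simp add: \<rho>_def)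
    show sub: "ball x \<rho> \<subseteq> W" "\<And>z. z \<in> ball x \<rho> \<Longrightarrow> \<Phi> z q \<noteq> 0"
      using \<rho>2 by (auto simp: \<rho>_def dist_commute)
    fix u z z' assume u: "u \<in> U" and z: "z \<in> ball x \<rho>" "z' \<in> ball x \<rho>"
      and o0: "hform \<sigma> (z - z') u = 0" "hform \<sigma> (z - z') q = 0"
    define v where "v = z' - z"
    have v0: "hform \<sigma> v u = 0" "hform \<sigma> v q = 0" using o0 by (simp_all add: v_def hform_lin)
    obtain X where Xu: "X \<in> ball X1 (\<rho>X / 2)" "hform \<sigma> X u = 0" "hform \<sigma> X q = 0" using XU[OF u] by blast
    have "norm v < 2 * \<rho>" using z norm_triangle_ineq4[of "z' - x" "z - x"]
      by (simp add: v_def dist_norm norm_minus_commute)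
    moreover have "\<rho> \<le> c * \<rho>X / 4" by (simp add: \<rho>_def)
    ultimately have "norm v < c * \<rho>X / 2" by linarith
    then have "(1 / c) * norm v < \<rho>X / 2" using c by (simp add: field_simps)
    moreover have "norm (complex_of_real ((1 - c) / c) *s v) \<le> (1 / c) * norm v"
    proof -
      have "cmod (complex_of_real ((1 - c) / c)) = (1 - c) / c" using c by (simp del: of_real_divide)
      also have "\<dots> \<le> 1 / c" using c by (simp add: divide_right_mono)
      finally show ?thesis unfolding norm_cscale by (rule mult_right_mono) simp
    qed
    ultimately have "norm (complex_of_real ((1 - c) / c) *s v) < \<rho>X / 2" by linarith
    moreover have "dist X1 (X - complex_of_real ((1 - c) / c) *s v)
        \<le> dist X1 X + norm (complex_of_real ((1 - c) / c) *s v)"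
      using norm_triangle_ineq[of "X1 - X" "complex_of_real ((1 - c) / c) *s v"] by (simp add: dist_norm algebra_simps)
    ultimately have X': "X - complex_of_real ((1 - c) / c) *s v \<in> ball X1 \<rho>X" using Xu(1) by simp
    have X0: "X \<in> ball X1 \<rho>X" using Xu(1) X(2) by simp
    let ?z1 = "complex_of_real (1 - c) *s z + complex_of_real c *s X"
    have z1x: "?z1 - x = complex_of_real (1 - c) *s (z - x) + complex_of_real c *s (X - x)"
      by (simp add: vec_eq_iff algebra_simps)
    have "norm (complex_of_real (1 - c) *s (z - x)) = (1 - c) * norm (z - x)"
      "norm (complex_of_real c *s (X - x)) = c * norm (X - x)"
      unfolding norm_cscale norm_of_real using c by simp_all
    then have "norm (?z1 - x) \<le> (1 - c) * norm (z - x) + c * norm (X - x)"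
      using norm_triangle_ineq[of "complex_of_real (1 - c) *s (z - x)" "complex_of_real c *s (X - x)"]
      unfolding z1x by linarith
    also have "\<dots> \<le> 1 * (\<rho>2 / 2) + c * K"
    proof (intro add_mono mult_mono mult_left_mono)
      show "norm (z - x) \<le> \<rho>2 / 2" using z(1) by (simp add: \<rho>_def dist_norm norm_minus_commute)
      have "norm (X - X1) \<le> \<rho>X" using X0 by (simp add: dist_norm norm_minus_commute)
      then show "norm (X - x) \<le> K" using norm_triangle_ineq[of "X - X1" "X1 - x"] by (simp add: K_def)
    qed (use c in auto)
    also have "\<dots> < \<rho>2" using c \<rho>2(1) by simp
    finally have "\<Phi> ?z1 q \<noteq> 0" using \<rho>2(2) by (simp add: dist_norm)
    then have "\<Phi> z u * \<Phi> (z + v) q = \<Phi> (z + v) u * \<Phi> z q"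
      using X X0 X' Xu v0 z sub u U q by (intro shift_proportional[OF c(1,2)]) (auto simp: v_def)
    then show "\<Phi> z u * \<Phi> z' q = \<Phi> z' u * \<Phi> z q" by (simp add: v_def)
  qed
qed

text \<open>Rescaling onto the slice affects only the products under \<open>\<sigma>\<close>, and
  the factor \<open>hform \<sigma> w q\<close> clears the scale. The resulting relation is
  holomorphic in \<open>w\<close> and spreads from a neighbourhood of \<open>x\<close>.\<close>

lemma slice_relation_extends:
  assumes x: "x \<in> W" "\<Phi> x q \<noteq> 0" and q: "q \<in> W" and \<rho>: "\<rho> > 0"
    and z: "\<And>e. hform \<sigma> e q = 0 \<Longrightarrow> x + e \<in> ball x \<rho> \<Longrightarrow> x + e \<in> W \<Longrightarrow>
      P * \<Phi> (x + e) u = hform \<sigma> (x + e) u * Q * \<Phi> (x + e) q" and w: "w \<in> W"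
  shows "P * \<Phi> w u * hform \<sigma> w q = hform \<sigma> w u * hform \<sigma> x q * Q * \<Phi> w q"
proof -
  have xq: "hform \<sigma> x q \<noteq> 0" using orth[OF x(1) q] x(2) by blast
  define f where "f w = P * \<Phi> w u * hform \<sigma> w q - hform \<sigma> w u * hform \<sigma> x q * Q * \<Phi> w q" for w
  obtain \<epsilon> where \<epsilon>: "\<epsilon> > 0" "\<And>z. dist z x < \<epsilon> \<Longrightarrow> z \<in> W \<and> hform \<sigma> z q \<noteq> 0 \<and>
      (hform \<sigma> x q / hform \<sigma> z q) *s z \<in> ball x \<rho>"
    using slice_scaling[OF x(1) xq \<rho>] unfolding eventually_nhds_metric by auto
  obtain \<rho>1 where \<rho>1: "\<rho>1 > 0" "ball x \<rho>1 \<subseteq> W" using W(1) x(1) openE by blast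
  obtain \<epsilon>1 where \<epsilon>1: "\<epsilon>1 > 0" "\<And>z. dist z x < \<epsilon>1 \<Longrightarrow> (hform \<sigma> x q / hform \<sigma> z q) *s z \<in> ball x \<rho>1"
    using slice_scaling[OF x(1) xq \<rho>1(1)] unfolding eventually_nhds_metric by auto
  have "f w = 0"
  proof (rule line_holo_identity[OF W, where U = "ball x (min \<epsilon> \<epsilon>1)" and ?y0.0 = x])
    show "line_holo f W" unfolding f_def by (intro line_holo_intros line_holo_G)
    fix y assume y: "y \<in> ball x (min \<epsilon> \<epsilon>1)" "y \<in> W"
    define c where "c = hform \<sigma> x q / hform \<sigma> y q"
    have yq: "hform \<sigma> y q \<noteq> 0" and cy: "c *s y \<in> ball x \<rho>" "c *s y \<in> W"
      using \<epsilon>(2)[of y] \<epsilon>1(2)[of y] \<rho>1(2) y(1) by (auto simp: dist_commute c_def)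
    have c0: "c \<noteq> 0" using xq yq by (simp add: c_def)
    have "G (c *s y) = G y" using hom[OF y(2) c0 cy(2)] .
    moreover have "hform \<sigma> (c *s y - x) q = 0" using yq by (simp add: hform_lin c_def)
    then have "P * \<Phi> (c *s y) u = hform \<sigma> (c *s y) u * Q * \<Phi> (c *s y) q"
      using z[of "c *s y - x"] cy by simp
    ultimately have "P * \<Phi> y u = c * hform \<sigma> y u * Q * \<Phi> y q" by (simp add: hform_lin)
    moreover have "c * hform \<sigma> y q = hform \<sigma> x q" using yq by (simp add: c_def)
    ultimately show "f y = 0" by (simp add: f_def mult_ac)
  qed (use \<epsilon> \<epsilon>1 x w in auto)
  then show ?thesis by (simp add: f_def)
qed

end

lemma cancel_common_factors:
  fixes a :: complex
  assumes "(a * b * s) * (a * c * t) = (a * c * s') * (a * b * t')" "a \<noteq> 0" "b \<noteq> 0" "c \<noteq> 0"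
  shows "s * t = s' * t'"
proof -
  have "(a * a * b * c) * (s * t) = (a * a * b * c) * (s' * t')" using assms(1) by (simp only: mult_ac)
  then show ?thesis using assms(2-4) by simp
qed

context orthogonal_map
begin

text \<open>Near a base point on a slice, shifts make \<open>\<Phi> z u / \<Phi> z q\<close> a
  function of the single number \<open>hform \<sigma> z u\<close>. Proportional increments make this
  function affine, and \<open>x0\<close>, where both it and its argument vanish, makes it
  linear.\<close>

lemma ratio_linear:
  assumes q: "q \<in> W" and U: "open U" "U \<subseteq> W" and u: "u \<in> U"
    and X: "ball X1 \<rho>X \<subseteq> W" "\<rho>X > 0" "\<And>X. X \<in> ball X1 \<rho>X \<Longrightarrow> G X \<noteq> 0"
    and XU: "\<And>u. u \<in> U \<Longrightarrow> \<exists>X\<in>ball X1 (\<rho>X / 2). hform \<sigma> X u = 0 \<and> hform \<sigma> X q = 0"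
    and x0: "x0 \<in> W" "hform \<sigma> x0 u = 0" "\<Phi> x0 q \<noteq> 0"
  obtains N where "\<And>z. z \<in> W \<Longrightarrow> \<Phi> z u * hform \<sigma> z q = hform \<sigma> z u * N * \<Phi> z q"
proof (cases "\<forall>z\<in>W. \<Phi> z u = 0")
  case True
  then show thesis using that[of 0] by simp
next
  case False
  then obtain zz where zz: "zz \<in> W" "\<Phi> zz u \<noteq> 0" by blast
  have uW: "u \<in> W" using u U by blast
  have \<Phi>x0u: "\<Phi> x0 u = 0" by (rule orth[OF x0(1) uW x0(2)])
  obtain \<rho> where \<rho>: "\<rho> > 0" "ball x0 \<rho> \<subseteq> W" "\<And>z. z \<in> ball x0 \<rho> \<Longrightarrow> \<Phi> z q \<noteq> 0" and
    shift0: "\<And>u z z'. u \<in> U \<Longrightarrow> z \<in> ball x0 \<rho> \<Longrightarrow> z' \<in> ball x0 \<rho> \<Longrightarrow> hform \<sigma> (z - z') u = 0 \<Longrightarrow>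
      hform \<sigma> (z - z') q = 0 \<Longrightarrow> \<Phi> z u * \<Phi> z' q = \<Phi> z' u * \<Phi> z q"
    using shift_near[OF x0(1,3) q U(2) X XU] by metis
  \<comment> \<open>Otherwise \<open>\<Phi> _ u\<close> vanishes on a slice near \<open>x0\<close>,
    hence wherever the product with \<open>q\<close> is nonzero; such points accumulate at
    \<open>zz\<close>.\<close>
  have "\<exists>e. hform \<sigma> e q = 0 \<and> x0 + e \<in> ball x0 \<rho> \<and> \<Phi> (x0 + e) u \<noteq> 0"
  proof (rule ccontr)
    assume n: "\<not> ?thesis"
    have v: "\<Phi> w u * hform \<sigma> w q = 0" if "w \<in> W" for w
      using slice_relation_extends[OF x0(1,3) q \<rho>(1), of 1 u 0 w] n that by auto
    have x0q: "hform \<sigma> x0 q \<noteq> 0" using orth[OF x0(1) q] x0(3) by blast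
    have "isCont (\<lambda>t. \<Phi> (zz + t *s (x0 - zz)) u) 0"
      by (rule isCont_o2[where f = "\<lambda>t. zz + t *s (x0 - zz)"])
        (auto intro!: continuous_intros isCont_\<Phi>_left simp: zz(1) simp del: vec.scale_right_diff_distrib)
    then have "eventually (\<lambda>t. \<Phi> (zz + t *s (x0 - zz)) u \<noteq> 0) (nhds 0)"
      by (rule isCont_eventually_nonzero) (simp add: zz)
    then obtain \<epsilon> where \<epsilon>: "\<epsilon> > 0" "\<And>t. cmod t < \<epsilon> \<Longrightarrow> \<Phi> (zz + t *s (x0 - zz)) u \<noteq> 0"
      by (rule eventually_nhds_0D) blast
    have "line_holo (\<lambda>z. hform \<sigma> z q) W" by (intro line_holo_intros)
    then obtain t where "cmod t < \<epsilon>" "zz + t *s (x0 - zz) \<in> W" "hform \<sigma> (zz + t *s (x0 - zz)) q \<noteq> 0"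
      using line_holo_nonzero_near[OF W, of "\<lambda>z. hform \<sigma> z q" zz x0 \<epsilon>] zz(1) x0(1) x0q \<epsilon>(1) by blast
    then show False using v \<epsilon>(2) by (metis mult_eq_0_iff)
  qed
  then obtain e where e: "hform \<sigma> e q = 0" "x0 + e \<in> ball x0 \<rho>" "\<Phi> (x0 + e) u \<noteq> 0" by blast
  define l where "l = hform \<sigma> e u"
  have l: "l \<noteq> 0"
  proof
    assume "l = 0"
    then have "\<Phi> (x0 + e) u * \<Phi> x0 q = \<Phi> x0 u * \<Phi> (x0 + e) q"
      using shift0[OF u e(2), of x0] \<rho>(1) e(1) by (simp add: l_def)
    then show False using \<Phi>x0u e(3) x0(3) by simp
  qed
  define fr where "fr u z = \<Phi> z u / \<Phi> z q" for u z
  define S where "S = {t. x0 + t *s e \<in> ball x0 \<rho>}"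
  have S: "open S" "convex S" "0 \<in> S" "1 \<in> S"
    unfolding S_def using e(2) \<rho>(1) open_line[OF open_ball] convex_line[OF convex_ball]
    by (blast, blast, simp, simp)
  define f where "f t = fr u (x0 + t *s e)" for t
  have f_hol: "f holomorphic_on S" unfolding f_def fr_def
    by (intro holomorphic_on_divide holomorphic_on_subset[OF holo_\<Phi>_line]) (use \<rho> in \<open>auto simp: S_def\<close>)
  \<comment> \<open>The ratio is \<open>0\<close> at \<open>x0\<close> and nonzero at
    \<open>x0 + e\<close>, so its derivative along the line is nonzero somewhere; the base point is
    moved there.\<close>
  obtain t where t: "t \<in> S" "deriv f t \<noteq> 0"
  proof (rule ccontr)
    assume "\<not> thesis"
    then have d0: "deriv f t = 0" if "t \<in> S" for t using that \<open>\<And>t. \<lbrakk>t \<in> S; deriv f t \<noteq> 0\<rbrakk> \<Longrightarrow> thesis\<close> by blast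
    have "\<exists>c. \<forall>t\<in>S. f t = c"
    proof (rule has_field_derivative_zero_constant[OF S(2)])
      fix t assume "t \<in> S"
      then show "(f has_field_derivative 0) (at t within S)"
        using holomorphic_derivI[OF f_hol S(1), of t] d0[of t] by simp
    qed
    then have "f 1 = f 0" using S by metis
    then show False using \<Phi>x0u e(3) \<rho>(3)[OF e(2)] by (simp add: f_def fr_def)
  qed
  define x where "x = x0 + t *s e"
  have x: "x \<in> W" "\<Phi> x q \<noteq> 0" using t(1) \<rho> unfolding x_def S_def by auto
  obtain \<rho>' where \<rho>': "\<rho>' > 0" "ball x \<rho>' \<subseteq> W" "\<And>z. z \<in> ball x \<rho>' \<Longrightarrow> \<Phi> z q \<noteq> 0" and
    shift: "\<And>u z z'. u \<in> U \<Longrightarrow> z \<in> ball x \<rho>' \<Longrightarrow> z' \<in> ball x \<rho>' \<Longrightarrow> hform \<sigma> (z - z') u = 0 \<Longrightarrow>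
      hform \<sigma> (z - z') q = 0 \<Longrightarrow> \<Phi> z u * \<Phi> z' q = \<Phi> z' u * \<Phi> z q"
    using shift_near[OF x q U(2) X XU] by metis
  have fr_shift: "fr u z = fr u z'" if "u \<in> U" "z \<in> ball x \<rho>'" "z' \<in> ball x \<rho>'" "hform \<sigma> (z - z') u = 0"
    "hform \<sigma> (z - z') q = 0" for u z z'
    using shift[OF that] \<rho>'(3)[OF that(2)] \<rho>'(3)[OF that(3)] by (simp add: fr_def field_simps)
  have inc: "(fr v (x + a *s y) - fr v x) * (fr v' (x + b *s y) - fr v' x)
      = (fr v (x + b *s y) - fr v x) * (fr v' (x + a *s y) - fr v' x)"
    if "v \<in> U" "v' \<in> U" "hform \<sigma> y q = 0" "x + a *s y \<in> ball x \<rho>'" "x + b *s y \<in> ball x \<rho>'" for v v' y a b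
  proof -
    have fr: "\<Phi> x q * \<Phi> z w - \<Phi> x w * \<Phi> z q = \<Phi> x q * \<Phi> z q * (fr w z - fr w x)"
      if "z \<in> ball x \<rho>'" for z w using x(2) \<rho>'(3)[OF that] by (simp add: fr_def field_simps)
    show ?thesis
      using increments_proportional[OF x q \<rho>'(2,1) U shift that(1,2,3,4,5)]
      unfolding fr[OF that(4)] fr[OF that(5)]
      by (rule cancel_common_factors[OF _ x(2) \<rho>'(3)[OF that(4)] \<rho>'(3)[OF that(5)]])
  qed
  define \<phi> where "\<phi> s = fr u (x + s *s e) - fr u x" for s
  have \<phi>0: "\<phi> 0 = 0" by (simp add: \<phi>_def)
  have \<phi>f: "\<phi> s = f (s + t) - f t" for s
    unfolding \<phi>_def f_def x_def by (simp add: vec.scale_left_distrib algebra_simps)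
  have "(f has_field_derivative deriv f t) (at t)" by (rule holomorphic_derivI[OF f_hol S(1) t(1)])
  then have "((\<lambda>s. f (s + t)) has_field_derivative deriv f t) (at 0)" using DERIV_shift[of f "deriv f t" 0 t] by simp
  then have \<phi>': "(\<phi> has_field_derivative deriv f t) (at 0)" unfolding \<phi>f
    by (auto intro!: derivative_eq_intros)
  define S' where "S' = {s. x + s *s e \<in> ball x \<rho>'}"
  have S': "open S'" "connected S'" "0 \<in> S'" unfolding S'_def
    using open_line[OF open_ball] convex_connected[OF convex_line[OF convex_ball]] \<rho>'(1)
    by (blast, blast, simp)
  have fr_hol: "(\<lambda>s. fr v (x + s *s e) - fr v x) holomorphic_on S'" for v unfolding fr_def
    by (intro holomorphic_intros holomorphic_on_divide holomorphic_on_subset[OF holo_\<Phi>_line])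
      (use \<rho>' in \<open>auto simp: S'_def\<close>)
  have "\<exists>s\<in>S'. \<phi> s \<noteq> 0"
  proof (rule ccontr)
    assume "\<not> ?thesis"
    then have "(\<phi> has_field_derivative 0) (at 0)"
      by (intro has_field_derivative_transform_within_open[OF DERIV_const S'(1,3)]) auto
    then show False using \<phi>' t(2) DERIV_unique by blast
  qed
  then obtain s1 where s1: "s1 \<in> S'" "\<phi> s1 \<noteq> 0" by blast

  \<comment> \<open>A second vector \<open>u'\<close> close to \<open>u\<close> whose functional is independent of that of \<open>u\<close> on \<open>q\<^sup>\<bottom>\<close>.\<close>
  let ?K = "UNIV \<inter> {y. hform \<sigma> y q = 0} \<inter> {y. hform \<sigma> y u = 0}"
  have "vec.dim (UNIV :: (complex^'n) set) \<le> vec.dim (UNIV \<inter> {y. hform \<sigma> y q = 0}) + 1"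
    by (rule dim_Int_kernel[OF vec.subspace_UNIV])
  also have "vec.dim (UNIV \<inter> {y. hform \<sigma> y q = 0}) \<le> vec.dim ?K + 1"
    by (rule dim_Int_kernel[OF vec.subspace_inter[OF vec.subspace_UNIV subspace_kernel]])
  finally have "vec.dim ?K \<noteq> 0" using dims unfolding vec_dim_card by linarith
  then have "\<not> ?K \<subseteq> {0}" unfolding vec.dim_eq_0 .
  then obtain y2 where y2: "hform \<sigma> y2 q = 0" "hform \<sigma> y2 u = 0" "y2 \<noteq> 0" by blast
  obtain h where h: "hform \<sigma> y2 h \<noteq> 0"
    using hform_nondegenerate[of \<sigma> y2] \<sigma>0 y2(3) hform_eq_0_commute by metis
  define u\<epsilon> where "u\<epsilon> \<epsilon> = u + \<epsilon> *s h" for \<epsilon>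
  have cu: "isCont u\<epsilon> 0" and u0: "u\<epsilon> 0 = u" unfolding u\<epsilon>_def by (auto intro!: continuous_intros)
  have "eventually (\<lambda>\<epsilon>. u\<epsilon> \<epsilon> \<in> U) (nhds 0)"
    using topological_tendstoD[OF cu[unfolded isCont_def tendsto_at_iff_tendsto_nhds] U(1)] u u0 by simp
  moreover have "eventually (\<lambda>\<epsilon>. fr (u\<epsilon> \<epsilon>) (x + s1 *s e) - fr (u\<epsilon> \<epsilon>) x \<noteq> 0) (nhds 0)"
  proof (rule isCont_eventually_nonzero)
    have cG: "isCont (\<lambda>\<epsilon>. G (u\<epsilon> \<epsilon>)) 0" by (rule isCont_o2[OF cu]) (simp add: u0 isCont_G uW)
    show "isCont (\<lambda>\<epsilon>. fr (u\<epsilon> \<epsilon>) (x + s1 *s e) - fr (u\<epsilon> \<epsilon>) x) 0"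
      unfolding fr_def using \<rho>'(3) s1(1) x(2) by (intro continuous_intros cG) (auto simp: S'_def)
    show "fr (u\<epsilon> 0) (x + s1 *s e) - fr (u\<epsilon> 0) x \<noteq> 0" using s1(2) by (simp add: u0 \<phi>_def)
  qed
  ultimately have "eventually (\<lambda>\<epsilon>. u\<epsilon> \<epsilon> \<in> U \<and> fr (u\<epsilon> \<epsilon>) (x + s1 *s e) - fr (u\<epsilon> \<epsilon>) x \<noteq> 0) (nhds 0)"
    by eventually_elim auto
  then obtain \<epsilon> where \<epsilon>: "\<epsilon> > 0" "\<And>t. cmod t < \<epsilon> \<Longrightarrow> u\<epsilon> t \<in> U \<and> fr (u\<epsilon> t) (x + s1 *s e) - fr (u\<epsilon> t) x \<noteq> 0"
    by (rule eventually_nhds_0D) blast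
  define u' where "u' = u\<epsilon> (complex_of_real (\<epsilon> / 2))"
  define \<psi> where "\<psi> s = fr u' (x + s *s e) - fr u' x" for s
  have u': "u' \<in> U" "\<psi> s1 \<noteq> 0" using \<epsilon>(2)[of "complex_of_real (\<epsilon> / 2)"] \<epsilon>(1) by (auto simp: u'_def \<psi>_def)
  define b2 where "b2 = hform \<sigma> y2 u'"
  have b2: "b2 \<noteq> 0" using h \<epsilon>(1) y2(2) by (simp add: b2_def u'_def u\<epsilon>_def hform_lin)
  define \<beta> where "\<beta> = hform \<sigma> e u'"
  \<comment> \<open>A step \<open>t *s y \<alpha>\<close> looks like
    \<open>(\<alpha> * t) *s e\<close> to \<open>u\<close> and like \<open>t *s e\<close> to
    \<open>u'\<close>: the multiple of \<open>y2\<close> is orthogonal to \<open>u\<close> and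
    \<open>q\<close> and keeps the product with \<open>u'\<close> at \<open>\<beta>\<close>. This
    decouples the two arguments.\<close>
  define y where "y \<alpha> = \<alpha> *s e + ((1 - \<alpha>) * (\<beta> / b2)) *s y2" for \<alpha>
  have y: "hform \<sigma> (y \<alpha>) q = 0" "hform \<sigma> (y \<alpha>) u = \<alpha> * l" "hform \<sigma> (y \<alpha>) u' = \<beta>" for \<alpha>
  proof -
    show "hform \<sigma> (y \<alpha>) q = 0" "hform \<sigma> (y \<alpha>) u = \<alpha> * l"
      using e(1) y2 by (simp_all add: y_def hform_lin l_def)
    have "hform \<sigma> (y \<alpha>) u' = \<alpha> * \<beta> + (1 - \<alpha>) * (\<beta> / b2 * b2)"
      by (simp add: y_def hform_lin b2_def \<beta>_def)
    then show "hform \<sigma> (y \<alpha>) u' = \<beta>" using b2 by (simp add: algebra_simps)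
  qed
  define M where "M = norm e + 2 * cmod (\<beta> / b2) * norm y2"
  have M: "norm (y \<alpha>) \<le> M" if "cmod \<alpha> \<le> 1" for \<alpha>
  proof -
    have "norm (y \<alpha>) \<le> norm (\<alpha> *s e) + norm (((1 - \<alpha>) * (\<beta> / b2)) *s y2)" unfolding y_def by (rule norm_triangle_ineq)
    also have "\<dots> \<le> 1 * norm e + 2 * cmod (\<beta> / b2) * norm y2"
      unfolding norm_cscale norm_mult using that norm_triangle_ineq4[of 1 \<alpha>]
      by (intro add_mono mult_right_mono) auto
    finally show ?thesis by (simp add: M_def)
  qed
  have M0: "M \<ge> 0" "norm e \<le> M" by (simp_all add: M_def)
  define \<delta> where "\<delta> = \<rho>' / (M + 1)"
  have \<delta>: "\<delta> > 0" using \<rho>'(1) M0 by (simp add: \<delta>_def)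
  have small: "x + s *s w \<in> ball x \<rho>'" if "cmod s < \<delta>" "norm w \<le> M" for s w
  proof -
    have "norm (s *s w) \<le> cmod s * (M + 1)" unfolding norm_cscale using that(2) by (intro mult_left_mono) auto
    also have "\<dots> < \<rho>'" using that(1) M0 by (simp add: \<delta>_def pos_less_divide_eq)
    finally show ?thesis by (simp add: dist_norm)
  qed
  have inB: "x + s *s e \<in> ball x \<rho>'" if "cmod s < \<delta>" for s by (rule small[OF that M0(2)])
  have pr: "\<phi> (\<alpha> * t) * \<psi> s = \<phi> (\<alpha> * s) * \<psi> t" if h: "cmod \<alpha> \<le> 1" "cmod t < \<delta>" "cmod s < \<delta>" for \<alpha> t s
  proof -
    have A: "fr u (x + t *s y \<alpha>) = fr u (x + (\<alpha> * t) *s e)" "fr u' (x + t *s y \<alpha>) = fr u' (x + t *s e)"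
      if t: "cmod t < \<delta>" for t
    proof -
      have "cmod (\<alpha> * t) \<le> cmod t" using h(1) by (simp add: norm_mult mult_left_le_one_le)
      then have at: "cmod (\<alpha> * t) < \<delta>" using t by simp
      show "fr u (x + t *s y \<alpha>) = fr u (x + (\<alpha> * t) *s e)"
        by (rule fr_shift[OF u small[OF t M[OF h(1)]] inB[OF at]])
          (simp_all add: hform_lin y e(1) l_def[symmetric] algebra_simps)
      show "fr u' (x + t *s y \<alpha>) = fr u' (x + t *s e)"
        by (rule fr_shift[OF u'(1) small[OF t M[OF h(1)]] inB[OF t]])
          (simp_all add: hform_lin y e(1) \<beta>_def[symmetric] algebra_simps)
    qed
    show ?thesis
      using inc[OF u u'(1) y(1) small[OF h(2) M[OF h(1)]] small[OF h(3) M[OF h(1)]]]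
      unfolding A[OF h(2)] A[OF h(3)] \<phi>_def \<psi>_def .
  qed
  \<comment> \<open>Both functions are nonzero at \<open>s1\<close>, which may lie outside this
    disc; the identity theorem supplies a point inside.\<close>
  have "\<exists>s0\<in>ball 0 \<delta>. \<phi> s0 * \<psi> s0 \<noteq> 0"
  proof (rule ccontr)
    assume n: "\<not> ?thesis"
    have "\<phi> s1 * \<psi> s1 = 0"
    proof (rule analytic_continuation[where f = "\<lambda>s. \<phi> s * \<psi> s" and S = S' and U = "ball 0 \<delta>" and \<xi> = 0])
      show "(\<lambda>s. \<phi> s * \<psi> s) holomorphic_on S'" unfolding \<phi>_def \<psi>_def by (intro holomorphic_on_mult fr_hol)
      show "ball 0 \<delta> \<subseteq> S'" using inB by (auto simp: S'_def)
    qed (use S' \<delta> s1(1) n in \<open>auto simp: islimpt_ball\<close>)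
    then show False using s1(2) u'(2) by simp
  qed
  then obtain s0 where s0: "cmod s0 < \<delta>" "\<phi> s0 \<noteq> 0" "\<psi> s0 \<noteq> 0" by auto
  define k where "k = \<phi> s0 / s0"
  have lin: "\<phi> s = k * s" if "cmod s \<le> cmod s0" for s
    unfolding k_def by (rule linear_from_proportionality[OF \<delta> \<phi>' t(2) \<phi>0 pr s0 that])
  have s0nz: "s0 \<noteq> 0" using s0(2) \<phi>0 by auto

  \<comment> \<open>The constant term is found at \<open>x0\<close>, where \<open>\<Phi> x0 u\<close> vanishes.\<close>
  define D where "D = {s. x + s *s e \<in> W}"
  have xx0: "x + (- t) *s e = x0" by (simp add: x_def vector_smult_lneg)
  have "\<Phi> (x + (- t) *s e) u - (fr u x + k * (- t)) * \<Phi> (x + (- t) *s e) q = 0"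
  proof (rule analytic_continuation[where S = D and U = "ball 0 (cmod s0)" and \<xi> = 0
        and f = "\<lambda>s. \<Phi> (x + s *s e) u - (fr u x + k * s) * \<Phi> (x + s *s e) q"])
    show "(\<lambda>s. \<Phi> (x + s *s e) u - (fr u x + k * s) * \<Phi> (x + s *s e) q) holomorphic_on D"
      unfolding D_def by (intro holomorphic_intros holo_\<Phi>_line)
    show "open D" "connected D" unfolding D_def
      using open_line[OF W(1)] convex_connected[OF convex_line[OF W(2)]] by blast+
    show sub: "ball 0 (cmod s0) \<subseteq> D" using inB s0(1) \<rho>'(2) by (auto simp: D_def)
    show "0 \<in> D" "- t \<in> D" using x(1) x0(1) xx0 unfolding D_def by auto
    show "(0::complex) islimpt ball 0 (cmod s0)" using s0nz by (simp add: islimpt_ball)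
    fix s :: complex assume "s \<in> ball 0 (cmod s0)"
    then have s: "cmod s < cmod s0" by simp
    then have "fr u (x + s *s e) = fr u x + k * s" using lin[of s] by (simp add: \<phi>_def algebra_simps)
    moreover have "\<Phi> (x + s *s e) q \<noteq> 0" using \<rho>'(3)[OF inB] s s0(1) by simp
    ultimately show "\<Phi> (x + s *s e) u - (fr u x + k * s) * \<Phi> (x + s *s e) q = 0"
      unfolding fr_def by (simp add: nonzero_divide_eq_eq)
  qed
  then have frx: "fr u x = k * t" unfolding xx0 using \<Phi>x0u x0(3) by simp
  have xu: "hform \<sigma> x u = t * l" by (simp add: x_def hform_lin x0(2) l_def)
  have "isCont (\<lambda>w. cmod (hform \<sigma> (w - x) u / l)) x" using l by (intro continuous_intros)
  then have "eventually (\<lambda>w. cmod (hform \<sigma> (w - x) u / l) < cmod s0) (nhds x)"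
    by (rule isCont_eventually_less) (use s0nz in simp)
  then obtain \<eta> where \<eta>: "\<eta> > 0" "\<And>w. dist w x < \<eta> \<Longrightarrow> cmod (hform \<sigma> (w - x) u / l) < cmod s0"
    unfolding eventually_nhds_metric by blast
  \<comment> \<open>By a shift, \<open>w\<close> can be replaced by the multiple of \<open>e\<close>
    that has the same product with \<open>u\<close>.\<close>
  have slice: "1 * \<Phi> (x + w) u = hform \<sigma> (x + w) u * (k / l) * \<Phi> (x + w) q"
    if w: "hform \<sigma> w q = 0" "x + w \<in> ball x (min \<eta> \<rho>')" for w
  proof -
    define s where "s = hform \<sigma> w u / l"
    have s: "cmod s < cmod s0" using \<eta>(2)[of "x + w"] w(2) by (simp add: s_def dist_norm)
    have wB: "x + w \<in> ball x \<rho>'" using w(2) by simp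
    have sd: "cmod s < \<delta>" using s s0(1) by simp
    have "fr u (x + w) = fr u (x + s *s e)"
      by (rule fr_shift[OF u wB inB[OF sd]])
        (use l w(1) e(1) in \<open>simp_all add: hform_lin s_def l_def[symmetric]\<close>)
    also have "\<dots> = k * t + k * s" using lin[of s] s frx by (simp add: \<phi>_def algebra_simps)
    also have "\<dots> = hform \<sigma> (x + w) u * (k / l)" using l by (simp add: hform_lin xu s_def field_simps)
    finally show ?thesis unfolding fr_def using \<rho>'(3)[OF wB] by (simp add: nonzero_divide_eq_eq)
  qed
  have "\<Phi> z u * hform \<sigma> z q = hform \<sigma> z u * (hform \<sigma> x q * (k / l)) * \<Phi> z q" if "z \<in> W" for z
    using slice_relation_extends[OF x q, of "min \<eta> \<rho>'" 1 u "k / l" z] slice \<eta>(1) \<rho>'(1) that by (simp add: mult_ac)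
  then show thesis using that by blast
qed

text \<open>Comparing \<open>ratio_linear\<close> at \<open>z\<close> and at \<open>q\<close>
  eliminates the constant \<open>N\<close>. This works for \<open>u\<close> near \<open>u1\<close>,
  where small corrections of \<open>X1\<close> and \<open>q\<close> are orthogonal to
  \<open>u\<close>; the conjugated relation is holomorphic in \<open>u\<close> and so extends to
  \<open>W\<close>.\<close>

lemma rank_one:
  assumes q: "q \<in> W" "\<Phi> q q \<noteq> 0" and X: "X1 \<in> W" "G X1 \<noteq> 0" "hform \<sigma> X1 q = 0"
    and u1: "u1 \<in> W" "u1 \<noteq> 0" "hform \<sigma> X1 u1 = 0" "hform \<sigma> q u1 = 0"
    and z: "z \<in> W" and u: "u \<in> W"
  shows "\<Phi> z u * hform \<sigma> z q * (hform \<sigma> q u * \<Phi> q q)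
       = \<Phi> q u * hform \<sigma> q q * (hform \<sigma> z u * \<Phi> z q)"
proof -
  have qq: "hform \<sigma> q q \<noteq> 0" using orth q by blast
  have "u1 \<notin> vec.span {q}"
    using u1(2,4) qq by (auto simp: vec.span_singleton hform_lin)
  then obtain d where d: "\<And>z. z \<in> vec.span {q} \<Longrightarrow> hform \<sigma> d z = 0" "hform \<sigma> d u1 \<noteq> 0"
    using hform_separation[where \<sigma> = \<sigma>, OF vec.subspace_span _ \<sigma>0] by blast
  have dq: "hform \<sigma> d q = 0" using d(1) vec.span_base by blast
  have "eventually (\<lambda>X. G X \<noteq> 0) (nhds X1)"
    using isCont_G[OF X(1)] X(2) tendsto_imp_eventually_ne
    unfolding isCont_def tendsto_at_iff_tendsto_nhds by blast
  moreover have "eventually (\<lambda>X. X \<in> W) (nhds X1)" using W(1) X(1) by (rule eventually_nhds_in_open)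
  ultimately have "eventually (\<lambda>X. G X \<noteq> 0 \<and> X \<in> W) (nhds X1)" by eventually_elim auto
  then obtain \<rho>X where \<rho>X: "\<rho>X > 0" "\<And>X. dist X X1 < \<rho>X \<Longrightarrow> G X \<noteq> 0 \<and> X \<in> W"
    unfolding eventually_nhds_metric by blast
  \<comment> \<open>Corrections along \<open>d\<close>, which is orthogonal to \<open>q\<close>, so
    \<open>Xu u\<close> remains orthogonal to \<open>q\<close>. The point \<open>xu u\<close>, close
    to \<open>q\<close>, serves as \<open>x0\<close> in \<open>ratio_linear\<close>.\<close>
  define Xu where "Xu u = X1 - (hform \<sigma> X1 u / hform \<sigma> d u) *s d" for u
  define xu where "xu u = q - (hform \<sigma> q u / hform \<sigma> d u) *s d" for u
  have c: "isCont Xu u1" "isCont xu u1" unfolding Xu_def xu_def by (intro continuous_intros d(2))+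
  have at1: "Xu u1 = X1" "xu u1 = q" by (simp_all add: Xu_def xu_def u1)
  have "eventually (\<lambda>u. Xu u \<in> ball X1 (\<rho>X / 2)) (nhds u1)"
    by (rule isCont_eventually_in_open[OF c(1) open_ball]) (simp add: at1 \<rho>X(1))
  moreover have "eventually (\<lambda>u. xu u \<in> W) (nhds u1)"
    by (rule isCont_eventually_in_open[OF c(2) W(1)]) (simp add: at1 q(1))
  moreover have "eventually (\<lambda>u. \<Phi> (xu u) q \<noteq> 0) (nhds u1)"
  proof (rule isCont_eventually_nonzero)
    have "isCont (\<lambda>u. G (xu u)) u1" by (rule isCont_o2[OF c(2)]) (simp add: at1 isCont_G q)
    then show "isCont (\<lambda>u. \<Phi> (xu u) q) u1" by (intro continuous_intros)
  qed (simp add: at1 q)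
  moreover have "eventually (\<lambda>u. hform \<sigma> d u \<noteq> 0) (nhds u1)"
    by (rule isCont_eventually_nonzero) (auto intro!: continuous_intros d(2))
  moreover have "eventually (\<lambda>u. u \<in> W) (nhds u1)" using W(1) u1(1) by (rule eventually_nhds_in_open)
  ultimately have "eventually (\<lambda>u. Xu u \<in> ball X1 (\<rho>X / 2) \<and> xu u \<in> W \<and> \<Phi> (xu u) q \<noteq> 0
      \<and> hform \<sigma> d u \<noteq> 0 \<and> u \<in> W) (nhds u1)" by eventually_elim auto
  then obtain \<omega> where \<omega>: "\<omega> > 0" "\<And>u. dist u u1 < \<omega> \<Longrightarrow> Xu u \<in> ball X1 (\<rho>X / 2) \<and> xu u \<in> W
      \<and> \<Phi> (xu u) q \<noteq> 0 \<and> hform \<sigma> d u \<noteq> 0 \<and> u \<in> W"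
    unfolding eventually_nhds_metric by blast
  have local: "\<Phi> z u * hform \<sigma> z q * (hform \<sigma> q u * \<Phi> q q) = \<Phi> q u * hform \<sigma> q q * (hform \<sigma> z u * \<Phi> z q)"
    if u: "u \<in> ball u1 \<omega>" for u
  proof -
    have w: "\<And>u. u \<in> ball u1 \<omega> \<Longrightarrow> Xu u \<in> ball X1 (\<rho>X / 2) \<and> xu u \<in> W
      \<and> \<Phi> (xu u) q \<noteq> 0 \<and> hform \<sigma> d u \<noteq> 0 \<and> u \<in> W" using \<omega>(2) by (simp add: dist_commute)
    have xo: "hform \<sigma> (xu u) u = 0" using w[OF u] by (simp add: xu_def hform_lin)
    obtain N where N: "\<And>z. z \<in> W \<Longrightarrow> \<Phi> z u * hform \<sigma> z q = hform \<sigma> z u * N * \<Phi> z q"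
    proof (rule ratio_linear[OF q(1) open_ball _ u, of X1 \<rho>X "xu u"])
      show "ball u1 \<omega> \<subseteq> W" using w by blast
      show "ball X1 \<rho>X \<subseteq> W" "\<And>X. X \<in> ball X1 \<rho>X \<Longrightarrow> G X \<noteq> 0" using \<rho>X(2) by (auto simp: dist_commute)
      show "\<exists>X\<in>ball X1 (\<rho>X / 2). hform \<sigma> X v = 0 \<and> hform \<sigma> X q = 0" if "v \<in> ball u1 \<omega>" for v
        using w[OF that] by (intro bexI[of _ "Xu v"]) (simp_all add: Xu_def hform_lin dq X)
    qed (use w[OF u] \<rho>X(1) xo in auto)
    show ?thesis unfolding N[OF z] N[OF q(1)] by (simp add: mult_ac)
  qed
  define f where "f u = \<Phi> u z * cnj (hform \<sigma> z q) * (hform \<sigma> u q * cnj (\<Phi> q q))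
    - \<Phi> u q * cnj (hform \<sigma> q q) * (hform \<sigma> u z * cnj (\<Phi> z q))" for u
  have fc: "f u = cnj (\<Phi> z u * hform \<sigma> z q * (hform \<sigma> q u * \<Phi> q q)
      - \<Phi> q u * hform \<sigma> q q * (hform \<sigma> z u * \<Phi> z q))" for u
    unfolding f_def complex_cnj_diff complex_cnj_mult hform_cnj ..
  have "f u = 0"
  proof (rule line_holo_identity[OF W, where U = "ball u1 \<omega>" and ?y0.0 = u1])
    show "line_holo f W" unfolding f_def by (intro line_holo_intros line_holo_G)
  qed (use \<omega>(1) u1(1) local u in \<open>auto simp: fc\<close>)
  then show ?thesis unfolding fc complex_cnj_zero_iff by simp
qed

end

section \<open>From the local isometry to the whole domain\<close>

lemma csubspace_iff: "csubspace H \<longleftrightarrow> vec.subspace H"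
  by (simp add: csubspace_def vec.subspace_def)

lemma span_hform_0:
  assumes "\<And>a. a \<in> S \<Longrightarrow> hform \<tau> a b = 0" "a \<in> vec.span S" shows "hform \<tau> a b = 0"
  using vec.span_minimal[OF _ subspace_kernel, of S \<tau> b] assms by auto

lemma span_open:
  fixes S :: "(complex^'n::finite) set"
  assumes S: "open S" "q \<in> S" shows "vec.span S = UNIV"
proof -
  have "v \<in> vec.span S" for v
  proof -
    have "open {t. q + t *s v \<in> S}" by (rule open_line[OF S(1)])
    moreover have "0 \<in> {t. q + t *s v \<in> S}" using S(2) by simp
    ultimately obtain e where e: "e > 0" "ball 0 e \<subseteq> {t. q + t *s v \<in> S}" by (rule openE)
    define t where "t = complex_of_real (e / 2)"
    have t: "t \<noteq> 0" "q + t *s v \<in> S" using e by (auto simp: t_def subset_iff)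
    have "(1 / t) *s ((q + t *s v) - q) \<in> vec.span S"
      using t(2) S(2) by (intro vec.span_scale vec.span_diff vec.span_base)
    then show ?thesis using t(1) by (simp add: vector_smult_assoc)
  qed
  then show ?thesis by blast
qed

text \<open>\<open>L\<close> agrees with \<open>g\<close> on a basis chosen inside \<open>S\<close>.
  By linearity \<open>g z\<close> and \<open>L *v z\<close> have the same products with the range of
  \<open>L\<close> and with all values of \<open>g\<close>, so their differences are orthogonal to
  both and span a null space.\<close>

lemma isometric_map_decomposition:
  fixes g :: "complex^'n::finite \<Rightarrow> complex^'m::finite"
  assumes S: "open S" "q \<in> S"
    and g: "\<And>z u. z \<in> S \<Longrightarrow> u \<in> S \<Longrightarrow> hform \<tau> (g z) (g u) = hform \<sigma> z u"
  obtains L :: "complex^'n^'m" and N where "lin_isometry \<sigma> \<tau> L" "null_space \<tau> N"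
    "\<And>z. z \<in> S \<Longrightarrow> g z - L *v z \<in> N" "\<And>a v. a \<in> N \<Longrightarrow> hform \<tau> a (L *v v) = 0"
proof -
  obtain B where B: "B \<subseteq> S" "vec.independent B" "S \<subseteq> vec.span B" "card B = vec.dim S"
    by (rule vec.basis_exists)
  have spB: "vec.span B = UNIV"
    using vec.span_minimal[OF B(3) vec.subspace_span] span_open[OF S] by auto
  obtain l where l: "Vector_Spaces.linear (*s) (*s) l" "\<And>x. x \<in> B \<Longrightarrow> l x = g x"
    using vec.linear_independent_extend[OF B(2), of g] by blast
  define L where "L = matrix l"
  have L: "L *v x = l x" for x unfolding L_def by (rule matrix_works[OF l(1)])
  have LB: "L *v x = g x" if "x \<in> B" for x using L l(2)[OF that] by simp
  have gl: "hform \<tau> (g z) (L *v v) = hform \<sigma> z v" if z: "z \<in> S" for z v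
  proof -
    have "v \<in> vec.span B" using spB by simp
    moreover have "vec.subspace {v. hform \<tau> (g z) (L *v v) = hform \<sigma> z v}"
      by (auto simp: vec.subspace_def hform_lin vec.add vec.scale)
    moreover have "B \<subseteq> {v. hform \<tau> (g z) (L *v v) = hform \<sigma> z v}" using LB g[OF z] B(1) by auto
    ultimately show ?thesis using vec.span_minimal by blast
  qed
  have iso: "hform \<tau> (L *v u) (L *v v) = hform \<sigma> u v" for u v
  proof -
    have "u \<in> vec.span B" using spB by simp
    moreover have "vec.subspace {u. hform \<tau> (L *v u) (L *v v) = hform \<sigma> u v}"
      by (auto simp: vec.subspace_def hform_lin vec.add vec.scale)
    moreover have "B \<subseteq> {u. hform \<tau> (L *v u) (L *v v) = hform \<sigma> u v}" using LB gl B(1) by auto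
    ultimately show ?thesis using vec.span_minimal by blast
  qed
  define N0 where "N0 = (\<lambda>z. g z - L *v z) ` S"
  define N where "N = vec.span N0"
  have NL: "hform \<tau> a (L *v v) = 0" if "a \<in> N" for a v
    by (rule span_hform_0[OF _ that[unfolded N_def]]) (auto simp: N0_def hform_lin gl iso)
  have gN: "hform \<tau> (g z) a = 0" if "z \<in> S" "a \<in> N" for z a
  proof -
    have "hform \<tau> a (g z) = 0"
    proof (rule span_hform_0[OF _ that(2)[unfolded N_def]])
      fix b assume "b \<in> N0"
      then obtain u where u: "u \<in> S" "b = g u - L *v u" unfolding N0_def by blast
      have "hform \<tau> (L *v u) (g z) = hform \<sigma> u z" by (metis gl[OF that(1)] hform_cnj)
      then show "hform \<tau> b (g z) = 0" using u g that(1) by (simp add: hform_lin)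
    qed
    then show ?thesis using hform_eq_0_commute by blast
  qed
  have NN: "hform \<tau> a b = 0" if "a \<in> N" "b \<in> N" for a b
  proof (rule span_hform_0[OF _ that(1)[unfolded N_def]])
    fix c assume "c \<in> N0"
    then obtain u where u: "u \<in> S" "c = g u - L *v u" unfolding N0_def by blast
    have "hform \<tau> (L *v u) b = 0" using NL[OF that(2), of u] hform_eq_0_commute by blast
    then show "hform \<tau> c b = 0" using u gN[OF u(1) that(2)] by (simp add: hform_lin)
  qed
  show thesis
  proof (rule that[of L N])
    show "lin_isometry \<sigma> \<tau> L" unfolding lin_isometry_def using iso by blast
    show "null_space \<tau> N" unfolding null_space_def csubspace_iff
      using NN by (simp add: N_def)
    show "g z - L *v z \<in> N" if "z \<in> S" for z unfolding N_def N0_def using that by (auto intro: vec.span_base)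
  qed (rule NL)
qed

text \<open>\<open>F\<close> is merely a choice of representatives, but homogeneous equations for
  its value can be tested on holomorphic lifts. In a ball with a lift, either every point or no
  point has a neighbourhood on which all equations hold; connectedness of \<open>V\<close> does the
  rest.\<close>

lemma proj_holo_propagation:
  fixes F :: "complex^'n::finite \<Rightarrow> complex^'m::finite" and \<Theta> :: "('k \<Rightarrow> complex^'n \<Rightarrow> complex^'m \<Rightarrow> complex)"
  assumes V: "proj_cone V" and F: "proj_holo F V"
    and hom: "\<And>k z d x. d \<noteq> 0 \<Longrightarrow> \<Theta> k z (d *s x) = 0 \<longleftrightarrow> \<Theta> k z x = 0"
    and hol: "\<And>k G W. (\<And>j. line_holo (\<lambda>z. G z $ j) W) \<Longrightarrow> line_holo (\<lambda>z. \<Theta> k z (G z)) W"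
    and S: "open S" "q \<in> S" "q \<in> V" "\<And>z k. z \<in> S \<Longrightarrow> z \<in> V \<Longrightarrow> \<Theta> k z (F z) = 0"
    and z: "z \<in> V"
  shows "\<Theta> k z (F z) = 0"
proof -
  have oV: "open V" and cV: "connected V" using V by (simp_all add: proj_cone_def)
  define P where "P w \<longleftrightarrow> (\<forall>k. \<Theta> k w (F w) = 0)" for w
  define V1 where "V1 = {w \<in> V. \<exists>U. open U \<and> w \<in> U \<and> (\<forall>y\<in>U. y \<in> V \<longrightarrow> P y)}"
  have V1open: "open V1"
  proof (subst open_subopen, intro ballI)
    fix w assume "w \<in> V1"
    then obtain U where U: "w \<in> V" "open U" "w \<in> U" "\<forall>y\<in>U. y \<in> V \<longrightarrow> P y" unfolding V1_def by blast
    have "U \<inter> V \<subseteq> V1" using U unfolding V1_def by blast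
    then show "\<exists>T. open T \<and> w \<in> T \<and> T \<subseteq> V1" using U oV by (intro exI[of _ "U \<inter> V"]) auto
  qed
  have dich: "\<exists>e>0. ball w e \<subseteq> V \<and> (ball w e \<subseteq> V1 \<or> ball w e \<inter> V1 = {})" if w: "w \<in> V" for w
  proof -
    obtain W G where W: "open W" "w \<in> W" "W \<subseteq> V"
      and G: "\<And>y. y \<in> W \<Longrightarrow> cholo_at G y \<and> (\<exists>d. d \<noteq> 0 \<and> G y = d *s F y)"
      using F w unfolding proj_holo_def by metis
    obtain e where e: "e > 0" "ball w e \<subseteq> W" using W openE by blast
    have GF: "\<Theta> k y (G y) = 0 \<longleftrightarrow> \<Theta> k y (F y) = 0" if "y \<in> ball w e" for k y
      using G[of y] e(2) that hom by (metis subsetD)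
    have "ball w e \<subseteq> V1" if y0: "y0 \<in> ball w e" "y0 \<in> V1" for y0
    proof
      obtain U where U: "open U" "y0 \<in> U" "\<forall>y\<in>U. y \<in> V \<longrightarrow> P y" using y0(2) unfolding V1_def by blast
      have "P y" if y: "y \<in> ball w e" for y unfolding P_def
      proof
        fix k
        have "\<Theta> k y (G y) = 0"
        proof (rule line_holo_identity[OF open_ball convex_ball _ U(1,2) y0(1) _ y])
          show "line_holo (\<lambda>z. \<Theta> k z (G z)) (ball w e)"
            by (rule hol, rule line_holo_cholo) (use G e(2) in blast)
          show "\<Theta> k x (G x) = 0" if "x \<in> U" "x \<in> ball w e" for x
            unfolding GF[OF that(2)] using U(3) that e(2) W(3) unfolding P_def by blast
        qed
        then show "\<Theta> k y (F y) = 0" unfolding GF[OF y] .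
      qed
      then show "x \<in> V1" if "x \<in> ball w e" for x
        using that e(2) W(3) unfolding V1_def by (intro CollectI conjI exI[of _ "ball w e"]) auto
    qed
    then show ?thesis using e W(3) by blast
  qed
  have "open (V - V1)"
  proof (subst open_subopen, intro ballI)
    fix w assume w: "w \<in> V - V1"
    then obtain e where e: "e > 0" "ball w e \<subseteq> V" "ball w e \<subseteq> V1 \<or> ball w e \<inter> V1 = {}" using dich by blast
    have "w \<in> ball w e" using e(1) by simp
    then have "ball w e \<subseteq> V - V1" using w e by blast
    then show "\<exists>T. open T \<and> w \<in> T \<and> T \<subseteq> V - V1" using e(1) by (intro exI[of _ "ball w e"]) auto
  qed
  moreover have "q \<in> V1" unfolding V1_def P_def using S by blast
  moreover have "V1 \<subseteq> V" unfolding V1_def by blast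
  ultimately have "V - V1 = {}" using cV V1open S(3) unfolding connected_def by blast
  then have "P z" using z unfolding V1_def by blast
  then show ?thesis unfolding P_def by blast
qed

text \<open>Expresses membership in \<open>N\<close> by linear equations, the form that
  \<open>proj_holo_propagation\<close> can continue.\<close>

lemma hermitian_orthogonal_iff:
  assumes "vec.subspace N"
  shows "x \<in> N \<longleftrightarrow> (\<forall>h. (\<forall>a\<in>N. hform (\<lambda>_. 1) a h = 0) \<longrightarrow> hform (\<lambda>_. 1) x h = 0)"
  using hermitian_separation[OF assms, of x] hform_eq_0_commute by metis

text \<open>Two facts spread from \<open>S\<close> to \<open>V\<close> as equations linear in the
  value of \<open>F\<close>: its component in the range of \<open>L\<close> is proportional to
  \<open>L *v z\<close>, and the remainder lies in \<open>N\<close>. The decomposition is the range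
  of \<open>L\<close> and its orthogonal complement.\<close>

lemma quasi_standard_if_local:
  fixes \<sigma> :: "'n::finite \<Rightarrow> real" and \<tau> :: "'m::finite \<Rightarrow> real"
    and F :: "complex^'n \<Rightarrow> complex^'m"
  assumes \<sigma>: "\<And>i. \<sigma> i = 1 \<or> \<sigma> i = -1" and V: "proj_cone V" and F: "proj_holo F V"
    and iso: "lin_isometry \<sigma> \<tau> L" and N: "null_space \<tau> N" and NL: "\<And>a v. a \<in> N \<Longrightarrow> hform \<tau> a (L *v v) = 0"
    and S: "open S" "q \<in> S" "q \<in> V" "\<And>z. z \<in> S \<Longrightarrow> \<exists>c n. n \<in> N \<and> F z = c *s (L *v z + n)"
  shows "quasi_standard \<sigma> \<tau> F V"
proof -
  have isoL: "hform \<tau> (L *v u) (L *v v) = hform \<sigma> u v" for u v using iso unfolding lin_isometry_def by blast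
  have subN: "vec.subspace N" and NN: "\<And>a b. a \<in> N \<Longrightarrow> b \<in> N \<Longrightarrow> hform \<tau> a b = 0"
    using N unfolding null_space_def csubspace_iff by blast+
  have \<sigma>0: "\<sigma> i \<noteq> 0" for i using \<sigma>[of i] by auto
  have \<sigma>\<sigma>: "\<sigma> i * \<sigma> i = 1" for i using \<sigma>[of i] by auto
  \<comment> \<open>The adjoint of \<open>L\<close> for the two forms. It is a left inverse of the
    isometry \<open>L\<close>, so \<open>L *v \<alpha> x\<close> is the orthogonal projection of
    \<open>x\<close> to the range.\<close>
  define \<alpha> where "\<alpha> x = (\<chi> i. complex_of_real (\<sigma> i) * hform \<tau> x (L *v axis i 1))" for x
  have \<alpha>: "hform \<sigma> (\<alpha> x) v = hform \<tau> x (L *v v)" for x v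
  proof -
    have "v = (\<Sum>i\<in>UNIV. v $ i *s axis i 1)"
      by (simp add: vec_eq_iff axis_component if_distrib cong: if_cong)
    then have "L *v v = (\<Sum>i\<in>UNIV. v $ i *s (L *v axis i 1))"
      by (metis (no_types, lifting) sum.cong vec.scale vec.sum)
    then have "hform \<tau> x (L *v v) = (\<Sum>i\<in>UNIV. cnj (v $ i) * hform \<tau> x (L *v axis i 1))"
      by (simp add: hform_sum_right hform_scale_right)
    also have "\<dots> = (\<Sum>i\<in>UNIV. complex_of_real (\<sigma> i * \<sigma> i) * hform \<tau> x (L *v axis i 1) * cnj (v $ i))"
      by (simp only: \<sigma>\<sigma> of_real_1 mult_1 mult.commute)
    also have "\<dots> = hform \<sigma> (\<alpha> x) v" by (simp add: hform_def \<alpha>_def mult_ac)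
    finally show ?thesis by simp
  qed
  have \<alpha>unique: "w = w'" if "\<And>v. hform \<sigma> w v = hform \<sigma> w' v" for w w'
  proof -
    have "hform \<sigma> v (w - w') = 0" for v
      using that[of v] hform_eq_0_commute[of \<sigma> v "w - w'"] by (simp add: hform_diff_left)
    then show ?thesis using hform_nondegenerate[of \<sigma> "w - w'"] \<sigma>0 by simp
  qed
  have \<alpha>L: "\<alpha> (L *v w) = w" for w by (rule \<alpha>unique) (simp add: \<alpha> isoL)
  have \<alpha>N: "\<alpha> a = 0" if "a \<in> N" for a by (rule \<alpha>unique) (simp add: \<alpha> NL[OF that])
  have \<alpha>add: "\<alpha> (x + y) = \<alpha> x + \<alpha> y" and \<alpha>scale: "\<alpha> (c *s x) = c *s \<alpha> x" for x y c
    by (rule \<alpha>unique, simp add: \<alpha> hform_lin)+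
  define A where "A = range (\<lambda>v. L *v v)"
  define B where "B = {b. \<forall>v. hform \<tau> b (L *v v) = 0}"
  have subA: "vec.subspace A" unfolding A_def vec.subspace_def
    by (auto simp: image_iff) (metis vec.zero, metis vec.add, metis vec.scale)
  have subB: "vec.subspace B" unfolding B_def by (auto simp: vec.subspace_def hform_lin)
  have NB: "N \<subseteq> B" using NL unfolding B_def by blast
  have xB: "x - L *v \<alpha> x \<in> B" for x unfolding B_def by (simp add: hform_lin isoL \<alpha>)
  have AB: "A \<inter> B = {0}"
  proof -
    have "x = 0" if "x \<in> A" "x \<in> B" for x
    proof -
      obtain v where v: "x = L *v v" using \<open>x \<in> A\<close> unfolding A_def by blast
      have "\<alpha> x = 0" by (rule \<alpha>unique) (use \<open>x \<in> B\<close> in \<open>simp add: \<alpha> B_def\<close>)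
      then show ?thesis using v \<alpha>L by simp
    qed
    then show ?thesis using subA subB vec.subspace_0 by blast
  qed
  have projA: "proj_along A B x = L *v \<alpha> x" for x unfolding proj_along_def
  proof (rule the_equality)
    show "L *v \<alpha> x \<in> A \<and> x - L *v \<alpha> x \<in> B" using xB unfolding A_def by blast
    fix a assume a: "a \<in> A \<and> x - a \<in> B"
    have "a - L *v \<alpha> x \<in> A" by (rule vec.subspace_diff[OF subA]) (use a in \<open>auto simp: A_def\<close>)
    moreover have "(x - L *v \<alpha> x) - (x - a) \<in> B" by (rule vec.subspace_diff[OF subB xB]) (use a in blast)
    moreover have "(x - L *v \<alpha> x) - (x - a) = a - L *v \<alpha> x" by simp
    ultimately have "a - L *v \<alpha> x \<in> A \<inter> B" by (simp only: Int_iff)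
    then have "a - L *v \<alpha> x = 0" unfolding AB by blast
    then show "a = L *v \<alpha> x" by simp
  qed
  have projB: "proj_along B A x = x - L *v \<alpha> x" for x unfolding proj_along_def
  proof (rule the_equality)
    show "x - L *v \<alpha> x \<in> B \<and> x - (x - L *v \<alpha> x) \<in> A" using xB unfolding A_def by simp
    fix b assume b: "b \<in> B \<and> x - b \<in> A"
    have "(x - b) - L *v \<alpha> x \<in> A" by (rule vec.subspace_diff[OF subA]) (use b in \<open>auto simp: A_def\<close>)
    moreover have "(x - L *v \<alpha> x) - b \<in> B" by (rule vec.subspace_diff[OF subB xB]) (use b in blast)
    moreover have "(x - L *v \<alpha> x) - b = (x - b) - L *v \<alpha> x" by simp
    ultimately have "(x - L *v \<alpha> x) - b \<in> A \<inter> B" by (simp only: Int_iff)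
    then have "(x - L *v \<alpha> x) - b = 0" unfolding AB by blast
    then show "b = x - L *v \<alpha> x" by simp
  qed
  have \<alpha>F: "\<exists>c. \<alpha> (F z) = c *s z" "F z - L *v \<alpha> (F z) \<in> N" if z: "z \<in> V" for z
  proof -
    have loc: "\<exists>c. \<alpha> (F z) = c *s z \<and> F z - L *v \<alpha> (F z) \<in> N" if zS: "z \<in> S" for z
    proof -
      obtain c n where cn: "n \<in> N" "F z = c *s (L *v z + n)" using S(4)[OF zS] by blast
      have a: "\<alpha> (F z) = c *s z" by (simp add: cn(2) \<alpha>scale \<alpha>add \<alpha>L \<alpha>N[OF cn(1)])
      have "F z - L *v \<alpha> (F z) = c *s n" unfolding a by (simp add: cn(2) vec.scale vec.scale_right_distrib)
      then show ?thesis using a subN cn(1) vec.subspace_scale by metis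
    qed
    have line\<alpha>: "line_holo (\<lambda>z. \<alpha> (G z) $ i) W" if "\<And>j. line_holo (\<lambda>z. G z $ j) W" for G :: "complex^'n \<Rightarrow> complex^'m" and W i
      unfolding \<alpha>_def using that by (simp add: line_holo_intros)
    have minors: "\<alpha> (F z) $ fst k * z $ snd k - \<alpha> (F z) $ snd k * z $ fst k = 0" for k
    proof (rule proj_holo_propagation[OF V F, where S = S and q = q
          and \<Theta> = "\<lambda>k z x. \<alpha> x $ fst k * z $ snd k - \<alpha> x $ snd k * z $ fst k"])
      show "(\<alpha> (d *s x) $ fst k * z $ snd k - \<alpha> (d *s x) $ snd k * z $ fst k = 0) \<longleftrightarrow>
        (\<alpha> x $ fst k * z $ snd k - \<alpha> x $ snd k * z $ fst k = 0)" if "d \<noteq> 0" for k z d x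
      proof -
        have "\<alpha> (d *s x) $ fst k * z $ snd k - \<alpha> (d *s x) $ snd k * z $ fst k
          = d * (\<alpha> x $ fst k * z $ snd k - \<alpha> x $ snd k * z $ fst k)" by (simp add: \<alpha>scale algebra_simps)
        then show ?thesis using that by simp
      qed
      show "line_holo (\<lambda>z. \<alpha> (G z) $ fst k * z $ snd k - \<alpha> (G z) $ snd k * z $ fst k) W"
        if "\<And>j. line_holo (\<lambda>z. G z $ j) W" for k G W
        by (intro line_holo_intros line\<alpha> that)
      show "\<alpha> (F z) $ fst k * z $ snd k - \<alpha> (F z) $ snd k * z $ fst k = 0" if "z \<in> S" for z k
        using loc[OF that] by auto
    qed (use S z in auto)
    have "z \<noteq> 0" using z V unfolding proj_cone_def by blast
    then obtain j where j: "z $ j \<noteq> 0" by (auto simp: vec_eq_iff)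
    have "\<alpha> (F z) = (\<alpha> (F z) $ j / z $ j) *s z"
      using minors[of "(_, j)"] j by (simp add: vec_eq_iff field_simps)
    then show "\<exists>c. \<alpha> (F z) = c *s z" by blast
    have "hform (\<lambda>_. 1) (F z - L *v \<alpha> (F z)) h = 0" if h: "\<forall>a\<in>N. hform (\<lambda>_. 1) a h = 0" for h
    proof (rule proj_holo_propagation[OF V F, where S = S and q = q
          and \<Theta> = "\<lambda>(k::unit) z x. hform (\<lambda>_. 1) (x - L *v \<alpha> x) h"])
      show "(hform (\<lambda>_. 1) (d *s x - L *v \<alpha> (d *s x)) h = 0) \<longleftrightarrow> (hform (\<lambda>_. 1) (x - L *v \<alpha> x) h = 0)"
        if "d \<noteq> 0" for d x using that by (simp add: \<alpha>scale vec.scale hform_lin right_diff_distrib[symmetric])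
      show "line_holo (\<lambda>z. hform (\<lambda>_. 1) (G z - L *v \<alpha> (G z)) h) W" if "\<And>j. line_holo (\<lambda>z. G z $ j) W"
        for G :: "complex^'n \<Rightarrow> complex^'m" and W
      proof (rule line_holo_hform)
        show "line_holo (\<lambda>z. (G z - L *v \<alpha> (G z)) $ i) W" for i
          unfolding matrix_vector_mult_def vector_minus_component vec_lambda_beta
          by (intro line_holo_intros line\<alpha> that)
      qed
      show "hform (\<lambda>_. 1) (F z - L *v \<alpha> (F z)) h = 0" if "z \<in> S" for z
        using loc[OF that] h by blast
    qed (use S z in auto)
    then show "F z - L *v \<alpha> (F z) \<in> N" using hermitian_orthogonal_iff[OF subN] by blast
  qed
  have scale: "\<exists>c. c \<noteq> 0 \<and> L *v z = c *s (L *v \<alpha> (F z))" if z: "z \<in> V" "L *v \<alpha> (F z) \<noteq> 0" for z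
  proof -
    obtain c where c: "\<alpha> (F z) = c *s z" using \<alpha>F(1)[OF z(1)] by blast
    have "c \<noteq> 0" using z(2) c by auto
    then show ?thesis unfolding c by (intro exI[of _ "1 / c"]) (simp add: vec.scale vector_smult_assoc)
  qed
  show ?thesis
  \<comment> \<open>A decomposition must have nonzero summands, so a trivial complement is the
    standard case.\<close>
  proof (cases "B = {0}")
    case True
    have "standard_map \<sigma> \<tau> F V" unfolding standard_map_def
    proof (rule exI[of _ L], intro conjI ballI)
      fix z assume z: "z \<in> V"
      have "F z - L *v \<alpha> (F z) = 0" using xB[of "F z"] True by blast
      then have F: "L *v \<alpha> (F z) = F z" by simp
      moreover have "F z \<noteq> 0" using F z assms(3) unfolding proj_holo_def by blast
      ultimately show "\<exists>c. c \<noteq> 0 \<and> L *v z = c *s F z" using scale[OF z] by simp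
    qed (rule iso)
    then show ?thesis unfolding quasi_standard_def by blast
  next
    case False
    have h1: "A \<noteq> {0}"
    proof
      assume "A = {0}"
      then have "L *v axis i 1 = 0" for i unfolding A_def by blast
      then have "\<alpha> (L *v axis i 1) = \<alpha> (0 *s 0)" for i :: 'n by simp
      then have "axis i (1::complex) = 0" for i :: 'n unfolding \<alpha>L \<alpha>scale by simp
      then show False by (simp add: axis_eq_0_iff)
    qed
    have h2: "\<exists>a\<in>A. \<exists>b\<in>B. x = a + b" for x
    proof (intro bexI)
      show "x = L *v \<alpha> x + (x - L *v \<alpha> x)" by simp
      show "L *v \<alpha> x \<in> A" unfolding A_def by blast
    qed (rule xB)
    have h3: "hform \<tau> a b = 0" if "a \<in> A" "b \<in> B" for a b
      using that hform_eq_0_commute unfolding A_def B_def by blast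
    have h4: "\<exists>L. (\<forall>u. L *v u \<in> A) \<and> lin_isometry \<sigma> \<tau> L \<and>
             (\<forall>z\<in>V. proj_along A B (F z) \<noteq> 0 \<longrightarrow>
                 (\<exists>c. c \<noteq> 0 \<and> L *v z = c *s proj_along A B (F z)))"
      using iso scale unfolding projA by (intro exI[of _ L]) (auto simp: A_def)
    have h5: "\<exists>H. H \<subseteq> B \<and> null_space \<tau> H \<and> (\<forall>z\<in>V. proj_along B A (F z) \<in> H)"
      using NB N \<alpha>F(2) unfolding projB by blast
    show ?thesis unfolding quasi_standard_def csubspace_iff
      by (rule disjI2, rule exI[of _ A], rule exI[of _ B])
        (intro conjI allI ballI subA subB h1 False AB h2 h3 h4 h5)
  qed
qed

section \<open>Preparation near a null point and proof of the theorem\<close>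

lemma bounded_linear_hform: "bounded_linear (\<lambda>z. hform \<sigma> z w)"
  unfolding hform_def
  by (intro bounded_linear_sum bounded_linear_mult_const[OF bounded_linear_const_mult] bounded_linear_vec_nth)

lemma cholo_normalize:
  assumes "hform \<sigma> z q \<noteq> 0" shows "cholo_at (\<lambda>z. (1 / hform \<sigma> z q) *s z) z"
proof -
  have "((\<lambda>z. hform \<sigma> z q) has_derivative (\<lambda>h. hform \<sigma> h q)) (at z)"
    by (rule bounded_linear.has_derivative[OF bounded_linear_hform has_derivative_ident])
  then have "((\<lambda>z. inverse (hform \<sigma> z q)) has_derivative
      (\<lambda>h. - (inverse (hform \<sigma> z q) * hform \<sigma> h q * inverse (hform \<sigma> z q)))) (at z)"
    using assms by (intro Deriv.has_derivative_inverse)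
  note d = bounded_bilinear.FDERIV[OF bounded_bilinear_cscale this has_derivative_ident]
  show ?thesis unfolding cholo_at_def divide_inverse mult_1
    by (rule exI, rule conjI, rule d) (simp add: hform_lin vec_eq_iff algebra_simps)
qed

lemma cholo_drop_radical: "cholo_at (\<lambda>x :: complex^'m::finite. \<chi> j. if P j then 0 else x $ j) x"
proof -
  define T where "T = (\<lambda>x :: complex^'m. \<chi> j. if P j then 0 else x $ j)"
  have "linear T" unfolding T_def by (rule linearI) (simp_all add: vec_eq_iff)
  then have "bounded_linear T" by (simp add: linear_conv_bounded_linear)
  then have "(T has_derivative T) (at x)" by (rule bounded_linear_imp_has_derivative)
  moreover have "T (c *s v) = c *s T v" for c v by (simp add: T_def vec_eq_iff)
  ultimately show ?thesis unfolding cholo_at_def T_def by blast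
qed

lemma hform_drop_radical:
  "hform \<tau> (\<chi> j. if \<tau> j = 0 then 0 else x $ j) (\<chi> j. if \<tau> j = 0 then 0 else y $ j) = hform \<tau> x y"
  unfolding hform_def by (rule sum.cong) auto

text \<open>Multiplying the coordinates of \<open>p\<close> by the signs gives a null vector whose
  product with \<open>x\<close> is the standard product of \<open>x\<close> and \<open>p\<close>;
  \<open>q\<close> is a multiple of it.\<close>

lemma hyperbolic_partner:
  fixes p :: "complex^'n::finite"
  assumes \<sigma>: "\<And>i. \<sigma> i = 1 \<or> \<sigma> i = -1" and p: "hform \<sigma> p p = 0" "p \<noteq> 0"
  obtains q where "hform \<sigma> p q = 1" "hform \<sigma> q q = 0"
    "\<And>x. hform (\<lambda>_. 1) x p = 0 \<Longrightarrow> hform \<sigma> x q = 0"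
proof -
  define Jp where "Jp = (\<chi> i. complex_of_real (\<sigma> i) * p $ i)"
  have \<sigma>\<sigma>: "complex_of_real (\<sigma> i) * complex_of_real (\<sigma> i) = 1" for i using \<sigma>[of i] by auto
  have xJ: "hform \<sigma> x Jp = hform (\<lambda>_. 1) x p" for x
    unfolding hform_def Jp_def
    by (rule sum.cong) (use \<sigma>\<sigma> in \<open>simp_all add: mult.left_commute mult.assoc[symmetric]\<close>)
  have JJ: "hform \<sigma> Jp Jp = 0"
    unfolding xJ using p(1) by (simp add: hform_def Jp_def)
  define N where "N = hform (\<lambda>_. 1) p p"
  have N: "N \<noteq> 0" "cnj N = N"
  proof -
    show "cnj N = N" unfolding N_def by (rule hform_cnj)
    show "N \<noteq> 0"
      unfolding N_def hform_self_eq_0_iff using p(2) by (simp add: sum_nonneg_eq_0_iff vec_eq_iff)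
  qed
  show thesis
  proof (rule that[of "(1 / N) *s Jp"])
    show "hform \<sigma> p ((1 / N) *s Jp) = 1" by (simp add: hform_lin xJ N N_def[symmetric])
    show "hform \<sigma> ((1 / N) *s Jp) ((1 / N) *s Jp) = 0" unfolding hform_lin JJ by simp
    show "hform \<sigma> x ((1 / N) *s Jp) = 0" if "hform (\<lambda>_. 1) x p = 0" for x
      using that by (simp add: hform_lin xJ)
  qed
qed

text \<open>On two positive coordinates, \<open>(cnj p_j, - cnj p_i)\<close> is orthogonal to
  \<open>p\<close> in both forms at once. Standard orthogonality also makes it orthogonal to the
  hyperbolic partner of \<open>p\<close>.\<close>

lemma positive_orthogonal_vector:
  fixes p :: "complex^'n::finite"
  assumes two: "2 \<le> card {i. \<sigma> i = 1}"
  obtains f where "hform \<sigma> f f = 1" "hform \<sigma> f p = 0" "hform (\<lambda>_. 1) f p = 0"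
proof -
  obtain i j where ij: "\<sigma> i = 1" "\<sigma> j = 1" "i \<noteq> j"
  proof -
    have "\<not> card {i. \<sigma> i = 1} \<le> Suc 0" using two by simp
    then show thesis using that by (auto simp: card_le_Suc0_iff_eq)
  qed
  define f0 where "f0 = (if p $ i = 0 \<and> p $ j = 0 then axis i 1 else axis i (cnj (p $ j)) - axis j (cnj (p $ i)))"
  have f0: "hform \<sigma> f0 p = 0" "hform (\<lambda>_. 1) f0 p = 0"
    using ij by (auto simp: f0_def hform_lin hform_axis)
  have "\<exists>c>0. hform \<sigma> f0 f0 = complex_of_real c"
  proof (cases "p $ i = 0 \<and> p $ j = 0")
    case True
    then show ?thesis using ij by (intro exI[of _ 1]) (simp add: f0_def hform_axis)
  next
    case False
    have "hform \<sigma> f0 f0 = cnj (p $ j) * p $ j + cnj (p $ i) * p $ i"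
      using False ij by (auto simp: f0_def hform_lin hform_axis axis_component)
    also have "\<dots> = complex_of_real ((cmod (p $ j))\<^sup>2 + (cmod (p $ i))\<^sup>2)"
      unfolding of_real_add complex_norm_square by (simp add: mult.commute)
    finally show ?thesis using False
      by (intro exI[of _ "(cmod (p $ j))\<^sup>2 + (cmod (p $ i))\<^sup>2"])
        (auto simp: sum_power2_gt_zero_iff)
  qed
  then obtain c where c: "c > 0" "hform \<sigma> f0 f0 = complex_of_real c" by blast
  define f where "f = complex_of_real (1 / sqrt c) *s f0"
  have "1 / sqrt c * (1 / sqrt c) * c = 1" using c(1) by (simp add: real_sqrt_mult[symmetric])
  moreover have "hform \<sigma> f f = complex_of_real (1 / sqrt c * (1 / sqrt c) * c)"
    unfolding f_def hform_lin c(2) complex_cnj_complex_of_real of_real_mult by (simp only: mult.assoc)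
  ultimately have "hform \<sigma> f f = 1" by (simp only: of_real_1)
  moreover have "hform \<sigma> f p = 0" "hform (\<lambda>_. 1) f p = 0" using f0 by (simp_all add: f_def hform_lin)
  ultimately show thesis using that[of f] by blast
qed

theorem mainTheorem17:
  fixes \<sigma> :: "'n::finite \<Rightarrow> real" and \<tau> :: "'m::finite \<Rightarrow> real"
    and F :: "complex^'n \<Rightarrow> complex^'m" and V :: "(complex^'n) set"
    and r s r' :: nat
  assumes "\<forall>i. \<sigma> i = 1 \<or> \<sigma> i = -1"
    and "\<forall>j. \<tau> j = 1 \<or> \<tau> j = -1 \<or> \<tau> j = 0"
    and "r = card {i. \<sigma> i = 1}" and "s = card {i. \<sigma> i = -1}"
    and "r' = card {j. \<tau> j = 1}"
    and "1 \<le> r" and "r \<le> s" and "r' \<le> 2 * r - 2"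
    and "local_proper \<sigma> \<tau> F V"
  shows "quasi_standard \<sigma> \<tau> F V"
proof -
  have \<sigma>: "\<sigma> i = 1 \<or> \<sigma> i = -1" for i using assms(1) by blast
  have \<tau>: "\<tau> j = 1 \<or> \<tau> j = -1 \<or> \<tau> j = 0" for j using assms(2) by blast
  have V: "proj_cone V" and F: "proj_holo F V"
    and Fpos: "\<And>z. z \<in> V \<Longrightarrow> Re (hform \<sigma> z z) > 0 \<Longrightarrow> Re (hform \<tau> (F z) (F z)) > 0"
    and Fnull: "\<And>z. z \<in> V \<Longrightarrow> hform \<sigma> z z = 0 \<Longrightarrow> hform \<tau> (F z) (F z) = 0"
    using assms(9) unfolding local_proper_def by blast+
  have Vc: "c *s z \<in> V" if "z \<in> V" "c \<noteq> 0" for c z using V that unfolding proj_cone_def by blast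
  obtain p where p: "p \<in> V" "hform \<sigma> p p = 0" using assms(9) unfolding local_proper_def by blast
  have p0: "p \<noteq> 0" using p(1) V unfolding proj_cone_def by blast
  obtain qn where qn: "hform \<sigma> p qn = 1" "hform \<sigma> qn qn = 0"
    and qn_orth: "\<And>x. hform (\<lambda>_. 1) x p = 0 \<Longrightarrow> hform \<sigma> x qn = 0"
    using hyperbolic_partner[OF \<sigma> p(2) p0] by metis
  have qnp: "hform \<sigma> qn p = 1" using qn(1) hform_cnj[of \<sigma> p qn] by simp
  \<comment> \<open>Here \<open>r' = 0\<close>, so the target has no positive points, but adding a
    small positive multiple of \<open>qn\<close> to \<open>p\<close> gives a positive point of the
    source.\<close>
  have "r \<noteq> 1"
  proof
    assume "r = 1"
    then have no_pos: "\<tau> j \<le> 0" for j using assms(5,8) \<tau>[of j] by auto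
    have "isCont (\<lambda>t. p + complex_of_real t *s qn) 0" by (intro continuous_intros)
    then have "eventually (\<lambda>t. p + complex_of_real t *s qn \<in> V) (nhds 0)"
      using V p(1) by (intro isCont_eventually_in_open) (auto simp: proj_cone_def)
    then obtain d where d: "d > 0" "\<And>t. dist t 0 < d \<Longrightarrow> p + complex_of_real t *s qn \<in> V"
      unfolding eventually_nhds_metric by blast
    define z where "z = p + complex_of_real (d / 2) *s qn"
    have "z \<in> V" using d(1) d(2)[of "d / 2"] by (simp add: z_def)
    moreover have "hform \<sigma> z z = complex_of_real d" by (simp add: z_def hform_lin p(2) qn qnp)
    ultimately have "Re (hform \<tau> (F z) (F z)) > 0" using Fpos[of z] d(1) by simp
    moreover have "(\<Sum>j\<in>UNIV. \<tau> j * (cmod (F z $ j))\<^sup>2) \<le> 0"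
      by (intro sum_nonpos mult_nonpos_nonneg no_pos) simp
    ultimately show False unfolding hform_self_eq by simp
  qed
  then have r2: "2 \<le> r" using assms(6) by linarith
  obtain f where f: "hform \<sigma> f f = 1" "hform \<sigma> f p = 0" "hform \<sigma> f qn = 0"
    using positive_orthogonal_vector[of \<sigma> p] r2 assms(3) qn_orth by metis
  have sym: "hform \<sigma> qn p = 1" "hform \<sigma> p f = 0" "hform \<sigma> qn f = 0"
    using qnp f hform_eq_0_commute by blast+

  obtain W1 Gl where W1: "open W1" "p \<in> W1" "W1 \<subseteq> V"
    and Gl: "\<And>w. w \<in> W1 \<Longrightarrow> cholo_at Gl w" "\<And>w. w \<in> W1 \<Longrightarrow> \<exists>d. d \<noteq> 0 \<and> Gl w = d *s F w"
    using F p(1) unfolding proj_holo_def by metis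
  define nz where "nz z = (1 / hform \<sigma> z qn) *s z" for z
  define drop where "drop x = (\<chi> j. if \<tau> j = 0 then 0 else x $ j)" for x :: "complex^'m"
  \<comment> \<open>\<open>nz\<close> makes the lift homogeneous of degree zero; \<open>drop\<close>
    changes no product and lets null families obey the bound by \<open>r'\<close>.\<close>
  define G where "G z = drop (Gl (nz z))" for z
  have nzp: "nz p = p" by (simp add: nz_def qn)
  have "isCont nz p" unfolding nz_def by (intro continuous_intros) (simp add: qn)
  then have "eventually (\<lambda>z. nz z \<in> W1) (nhds p)"
    by (rule isCont_eventually_in_open[OF _ W1(1)]) (simp add: nzp W1)
  moreover have "eventually (\<lambda>z. hform \<sigma> z qn \<noteq> 0) (nhds p)"
    by (rule isCont_eventually_nonzero) (auto simp: qn intro!: continuous_intros)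
  ultimately have "eventually (\<lambda>z. nz z \<in> W1 \<and> hform \<sigma> z qn \<noteq> 0) (nhds p)" by eventually_elim auto
  then obtain R where R: "R > 0" "\<And>z. z \<in> ball p R \<Longrightarrow> nz z \<in> W1 \<and> hform \<sigma> z qn \<noteq> 0"
    unfolding eventually_nhds_metric by (auto simp: dist_commute)
  have nzV: "nz z \<in> V" "z \<in> V" if "z \<in> ball p R" for z
  proof -
    show "nz z \<in> V" using R(2)[OF that] W1 by blast
    then have "hform \<sigma> z qn *s nz z \<in> V" using R(2)[OF that] by (intro Vc) auto
    then show "z \<in> V" using R(2)[OF that] by (simp add: nz_def vector_smult_assoc)
  qed
  have GG: "hform \<tau> (G z) (G w) = hform \<tau> (Gl (nz z)) (Gl (nz w))" for z w
    unfolding G_def drop_def by (rule hform_drop_radical)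
  have lift: "\<exists>d. d \<noteq> 0 \<and> Gl (nz z) = d *s F z" if z: "z \<in> ball p R" for z
  proof -
    obtain d where d: "d \<noteq> 0" "Gl (nz z) = d *s F (nz z)" using Gl(2) R(2)[OF z] by blast
    obtain d' where d': "d' \<noteq> 0" "F (nz z) = d' *s F z"
      using F nzV[OF z] R(2)[OF z] unfolding proj_holo_def nz_def by (metis divide_eq_0_iff zero_neq_one)
    show ?thesis using d d' by (intro exI[of _ "d * d'"]) (simp add: vector_smult_assoc)
  qed
  have GF: "\<exists>c>0. hform \<tau> (G z) (G z) = complex_of_real c * hform \<tau> (F z) (F z)" if z: "z \<in> ball p R" for z
  proof -
    obtain d where d: "d \<noteq> 0" "Gl (nz z) = d *s F z" using lift[OF z] by blast
    have "hform \<tau> (G z) (G z) = (d * cnj d) * hform \<tau> (F z) (F z)" unfolding GG d(2) by (simp add: hform_lin)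
    also have "d * cnj d = complex_of_real ((cmod d)\<^sup>2)" by (rule complex_norm_square[symmetric])
    finally show ?thesis using d(1) by (intro exI[of _ "(cmod d)\<^sup>2"]) simp
  qed
  have Ghol: "cholo_at G z" if "z \<in> ball p R" for z
  proof -
    have n: "cholo_at nz z" unfolding nz_def by (rule cholo_normalize) (use R(2)[OF that] in blast)
    have "cholo_at Gl (nz z)" using R(2)[OF that] Gl(1) by blast
    then have "cholo_at (\<lambda>z. Gl (nz z)) z" by (rule cholo_compose[OF n])
    then show ?thesis unfolding G_def drop_def by (rule cholo_compose[OF _ cholo_drop_radical])
  qed
  have Ghom: "G (c *s z) = G z" if "c \<noteq> 0" for c z
  proof -
    have "nz (c *s z) = nz z" using that by (simp add: nz_def hform_lin vector_smult_assoc)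
    then show ?thesis by (simp add: G_def)
  qed
  have Gnull: "hform \<tau> (G z) (G z) = 0" if "z \<in> ball p R" "hform \<sigma> z z = 0" for z
    using GF[OF that(1)] Fnull[OF nzV(2)[OF that(1)] that(2)] by auto
  have Gpos: "Re (hform \<tau> (G z) (G z)) > 0" if "z \<in> ball p R" "Re (hform \<sigma> z z) > 0" for z
    using GF[OF that(1)] Fpos[OF nzV(2)[OF that(1)] that(2)] by auto
  obtain \<rho>1 where \<rho>1: "\<rho>1 > 0" "ball p \<rho>1 \<subseteq> ball p R"
    and orth: "\<And>z w. z \<in> ball p \<rho>1 \<Longrightarrow> w \<in> ball p \<rho>1 \<Longrightarrow> hform \<sigma> z w = 0 \<Longrightarrow> hform \<tau> (G z) (G w) = 0"
    by (rule orthogonality_polarization[of "ball p R" p G \<sigma> \<tau> qn])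
      (use R(1) Ghol Ghom Gnull p(2) qn in auto)
  obtain \<rho> where \<rho>: "\<rho> > 0" "\<rho> \<le> \<rho>1" and rank: "\<And>A z (I :: nat set). vec.dim A \<le> card {i. \<sigma> i = 1} \<Longrightarrow>
      finite I \<Longrightarrow> card {j. \<tau> j = 1} < card I \<Longrightarrow> (\<And>a. a \<in> I \<Longrightarrow> z a \<in> A \<inter> ball p \<rho>) \<Longrightarrow>
      \<not> cindep I (\<lambda>a. G (z a))"
  proof (rule rank_bound[of \<sigma> \<tau> p \<rho>1 G])
    show "card {i. \<sigma> i = 1} \<le> card {i. \<sigma> i = -1}" using assms by simp
    show "G z $ j = 0" if "\<tau> j = 0" for z j using that by (simp add: G_def drop_def)
  qed (use \<sigma> \<tau> p \<rho>1 Ghol orth in auto)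
  have sub: "ball p \<rho> \<subseteq> ball p \<rho>1" "ball p \<rho> \<subseteq> ball p R" using \<rho> \<rho>1 by auto
  have "CARD('n) = r + s"
  proof -
    have U: "(UNIV :: 'n set) = {i. \<sigma> i = 1} \<union> {i. \<sigma> i = -1}" using \<sigma> by auto
    show ?thesis unfolding assms(3,4) U by (rule card_Un_disjoint) auto
  qed
  then have dims: "r + 2 \<le> CARD('n)" using r2 assms(7) by linarith
  interpret orthogonal_map \<sigma> \<tau> G "ball p \<rho>" r
  proof
    show "\<not> cindep I (\<lambda>a. G (z a))" if "vec.dim A \<le> r" "finite I" "2 * r \<le> card I + 1"
      "\<And>a. a \<in> I \<Longrightarrow> z a \<in> A \<inter> ball p \<rho>" for A z and I :: "nat set"
      by (rule rank[where A = A]) (use that assms(3,5,8) r2 in auto)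
    show "hform \<tau> (G z) (G w) = 0" if "z \<in> ball p \<rho>" "w \<in> ball p \<rho>" "hform \<sigma> z w = 0" for z w
      by (rule orth) (use that sub in auto)
    show "cholo_at G z" if "z \<in> ball p \<rho>" for z
      by (rule Ghol) (use that sub in auto)
  qed (use \<sigma> Ghom r2 dims in auto)

  \<comment> \<open>The coefficients make the three vectors mutually orthogonal, and
    \<open>X1 \<delta>\<close> and \<open>qq \<delta>\<close> have square
    \<open>\<delta>^2 / 2\<close>. Being positive, these two have nonzero values under
    \<open>G\<close>.\<close>
  define X1 where "X1 \<delta> = p + complex_of_real (\<delta>\<^sup>2 / 4) *s qn" for \<delta> :: real
  define qq where "qq \<delta> = p - complex_of_real (\<delta>\<^sup>2 / 4) *s qn + complex_of_real \<delta> *s f" for \<delta> :: real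
  define u1 where "u1 \<delta> = p - complex_of_real (\<delta>\<^sup>2 / 4) *s qn + complex_of_real (\<delta> / 2) *s f" for \<delta> :: real
  have c: "isCont X1 0" "isCont qq 0" "isCont u1 0"
    unfolding X1_def qq_def u1_def by (intro continuous_intros; simp)+
  have at0: "X1 0 \<in> ball p \<rho>" "qq 0 \<in> ball p \<rho>" "u1 0 \<in> ball p \<rho>"
    using \<rho>(1) by (simp_all add: X1_def qq_def u1_def)
  note isCont_eventually_in_open[OF c(1) open_ball at0(1)] isCont_eventually_in_open[OF c(2) open_ball at0(2)]
    isCont_eventually_in_open[OF c(3) open_ball at0(3)]
  then have "eventually (\<lambda>\<delta>. X1 \<delta> \<in> ball p \<rho> \<and> qq \<delta> \<in> ball p \<rho> \<and> u1 \<delta> \<in> ball p \<rho>) (nhds 0)"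
    by eventually_elim auto
  then obtain e where e: "e > 0" "\<And>\<delta>. dist \<delta> 0 < e \<Longrightarrow> X1 \<delta> \<in> ball p \<rho> \<and> qq \<delta> \<in> ball p \<rho> \<and> u1 \<delta> \<in> ball p \<rho>"
    unfolding eventually_nhds_metric by blast
  define \<delta> where "\<delta> = e / 2"
  have \<delta>: "\<delta> > 0" and mem: "X1 \<delta> \<in> ball p \<rho>" "qq \<delta> \<in> ball p \<rho>" "u1 \<delta> \<in> ball p \<rho>"
    using e(1) e(2)[of \<delta>] by (auto simp: \<delta>_def)
  define q where "q = qq \<delta>"
  have ips: "hform \<sigma> (X1 \<delta>) (X1 \<delta>) = complex_of_real (\<delta>\<^sup>2 / 2)" "hform \<sigma> q q = complex_of_real (\<delta>\<^sup>2 / 2)"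
    "hform \<sigma> (X1 \<delta>) q = 0" "hform \<sigma> (X1 \<delta>) (u1 \<delta>) = 0" "hform \<sigma> q (u1 \<delta>) = 0" "hform \<sigma> (u1 \<delta>) qn = 1"
    unfolding q_def qq_def X1_def u1_def
    by (simp_all add: hform_lin p(2) qn f sym power2_eq_square field_simps)
  have qW: "q \<in> ball p \<rho>" using mem by (simp add: q_def)
  have \<Phi>q: "Re (\<Phi> q q) > 0" using Gpos[of q] qW sub ips(2) \<delta> by auto
  have \<Phi>X: "Re (\<Phi> (X1 \<delta>) (X1 \<delta>)) > 0" using Gpos[of "X1 \<delta>"] mem sub ips(1) \<delta> by auto
  have one: "\<Phi> z u * hform \<sigma> z q * (hform \<sigma> q u * \<Phi> q q) = \<Phi> q u * hform \<sigma> q q * (hform \<sigma> z u * \<Phi> z q)"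
    if "z \<in> ball p \<rho>" "u \<in> ball p \<rho>" for z u
  proof (rule rank_one[OF qW _ mem(1) _ ips(3) mem(3) _ ips(4,5) that])
    show "\<Phi> q q \<noteq> 0" using \<Phi>q by auto
    show "G (X1 \<delta>) \<noteq> 0" using \<Phi>X by auto
    show "u1 \<delta> \<noteq> 0" using ips(6) by auto
  qed

  define S where "S = {z \<in> ball p \<rho>. \<Phi> z q * hform \<sigma> z q \<noteq> 0}"
  have S: "open S"
  proof -
    have "continuous_on (ball p \<rho>) (\<lambda>z. \<Phi> z q * hform \<sigma> z q)" by (intro continuous_intros continuous_G)
    from continuous_open_preimage[OF this open_ball, of "- {0}"]
    show ?thesis unfolding S_def by (simp add: vimage_def Int_def open_Compl)
  qed
  have qS: "q \<in> S" using qW \<Phi>q ips(2) \<delta> unfolding S_def by auto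
  \<comment> \<open>Chosen so that \<open>hform \<sigma> q q = \<kappa> * \<Phi> q q\<close>; it is
    positive because \<open>q\<close> and its image are, so its square root can be absorbed into
    \<open>b\<close>.\<close>
  define \<kappa> where "\<kappa> = (\<delta>\<^sup>2 / 2) / Re (\<Phi> q q)"
  have \<kappa>: "\<kappa> > 0" using \<delta> \<Phi>q by (simp add: \<kappa>_def)
  have \<kappa>eq: "hform \<sigma> q q = complex_of_real \<kappa> * \<Phi> q q"
  proof -
    have "\<delta>\<^sup>2 / 2 = \<kappa> * Re (\<Phi> q q)" using \<Phi>q by (simp add: \<kappa>_def)
    then have "complex_of_real (\<delta>\<^sup>2 / 2) = complex_of_real \<kappa> * complex_of_real (Re (\<Phi> q q))"
      by (simp only: of_real_mult)
    then show ?thesis unfolding ips(2) hform_self[of \<tau> "G q", symmetric] .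
  qed
  define a where "a z = \<Phi> z q / hform \<sigma> z q" for z
  have \<Phi>a: "\<Phi> z u = complex_of_real \<kappa> * (a z * cnj (a u)) * hform \<sigma> z u" if "z \<in> S" "u \<in> S" for z u
  proof -
    have nz: "hform \<sigma> z q \<noteq> 0" "hform \<sigma> q u \<noteq> 0" "\<Phi> q q \<noteq> 0"
      using that \<Phi>q hform_eq_0_commute[of \<sigma> q u] unfolding S_def by auto
    have ca: "cnj (a u) = \<Phi> q u / hform \<sigma> q u" unfolding a_def complex_cnj_divide hform_cnj ..
    have "\<Phi> z u * hform \<sigma> z q * (hform \<sigma> q u * \<Phi> q q)
        = \<Phi> q u * (complex_of_real \<kappa> * \<Phi> q q) * (hform \<sigma> z u * \<Phi> z q)"
      using one[of z u] that unfolding \<kappa>eq S_def by blast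
    then have "\<Phi> z u * hform \<sigma> z q * hform \<sigma> q u = \<Phi> q u * complex_of_real \<kappa> * (hform \<sigma> z u * \<Phi> z q)"
      using nz(3) by (simp add: mult_ac)
    then show ?thesis unfolding ca unfolding a_def using nz by (simp add: field_simps)
  qed
  have a0: "a z \<noteq> 0" if "z \<in> S" for z using that unfolding S_def a_def by auto
  define b where "b z = complex_of_real (sqrt \<kappa>) * a z" for z
  have b0: "b z \<noteq> 0" if "z \<in> S" for z using a0[OF that] \<kappa> by (simp add: b_def)
  \<comment> \<open>Formed with \<open>Gl\<close> instead of \<open>G\<close>: the radical
    coordinates return, unseen by the form, and division by \<open>b\<close> makes the map
    isometric.\<close>
  define g where "g z = (1 / b z) *s Gl (nz z)" for z
  have iso: "hform \<tau> (g z) (g u) = hform \<sigma> z u" if "z \<in> S" "u \<in> S" for z u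
  proof -
    have "b z * cnj (b u) = complex_of_real (sqrt \<kappa> * sqrt \<kappa>) * (a z * cnj (a u))"
      unfolding b_def complex_cnj_mult complex_cnj_complex_of_real of_real_mult by (simp only: mult_ac)
    moreover have "sqrt \<kappa> * sqrt \<kappa> = \<kappa>" using \<kappa> by simp
    ultimately have bb: "b z * cnj (b u) = complex_of_real \<kappa> * (a z * cnj (a u))" by (simp only:)
    have "hform \<tau> (g z) (g u) = \<Phi> z u / (b z * cnj (b u))" by (simp add: g_def hform_lin GG)
    also have "\<dots> = hform \<sigma> z u" unfolding \<Phi>a[OF that] bb using a0[OF that(1)] a0[OF that(2)] \<kappa> by simp
    finally show ?thesis .
  qed
  obtain L N where L: "lin_isometry \<sigma> \<tau> L" and N: "null_space \<tau> N"
    and gN: "\<And>z. z \<in> S \<Longrightarrow> g z - L *v z \<in> N" and NL: "\<And>a v. a \<in> N \<Longrightarrow> hform \<tau> a (L *v v) = 0"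
    using isometric_map_decomposition[OF S qS iso] by metis
  show ?thesis
  proof (rule quasi_standard_if_local[OF \<sigma> V F L N NL S qS])
    show "q \<in> V" using nzV(2) qW sub by blast
    fix z assume z: "z \<in> S"
    then have "z \<in> ball p R" using sub unfolding S_def by blast
    then obtain d where d: "d \<noteq> 0" "Gl (nz z) = d *s F z" using lift by blast
    have "F z = (b z / d) *s g z" unfolding g_def d(2) using d(1) b0[OF z] by (simp add: vector_smult_assoc)
    also have "g z = L *v z + (g z - L *v z)" by simp
    finally show "\<exists>c n. n \<in> N \<and> F z = c *s (L *v z + n)" using gN[OF z] by blast
  qed
qed

end
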